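(* For any loopless matroid $\mathsf{M}$ of rank $r$ on $E=[n]$ and a generic vector $w\in N=\mathbb{Z}^n/\mathbb{Z}(1,\dots,1)$, $$u^rT_{\mathsf{M}}\Big(1+\tfrac1u,\,1+v\Big)=\sum_{\substack{\sigma_{\mathcal{F}}\cap\sigma_{\mathcal{G}}=\{0\}\\(\sigma_{\mathcal{F}}+w)\cap\sigma_{\mathcal{G}}\neq\emptyset}}(-1)^{\ell(\mathcal{F})+\ell(\mathcal{G})-n+1}\,I_{\mathsf{M}}(u)[\mathcal{F}]\,(1+v)^{\operatorname{loop}(\mathsf{M})}[\mathcal{G}],$$ where $\mathcal{F},\mathcal{G}$ range over all flags of nonempty proper subsets of $[n]$ (satisfying the displayed conditions).
   Context: $[n]=\{1,\dots,n\}$. A flag is a (possibly empty) chain $\mathcal{F}:\emptyset\subsetneq F_1\subsetneq\cdots\subsetneq F_k\subsetneq[n]$, with length $\ell(\mathcal{F})=k$, and $\sigma_{\mathcal{F}}=\operatorname{cone}(\bar e_{F_1},\dots,\bar e_{F_k})\subset N_{\mathbb{R}}=N\otimes\mathbb{R}$, where $\bar e_S$ is the image of $\sum_{i\in S}e_i$ in $N$ (and $\sigma_\emptyset=\{0\}$). The cones $\sigma_{\mathcal{F}}$ form the permutohedral fan $\Sigma_{[n]}$. A vector $w\in N$ is generic if for all $\sigma,\tau\in\Sigma_{[n]}$ with $(\sigma+w)\cap\tau\neq\emptyset$: (1) the relative interiors satisfy $(\sigma^\circ+w)\cap\tau^\circ\ne\emptyset$; (2) $\dim((\sigma+w)\cap\tau)=\dim\sigma+\dim\tau-(n-1)$.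 $T_{\mathsf{M}}$ is the Tutte polynomial; $I_{\mathsf{M}}(u)=\sum_{I\text{ independent}}u^{|I|}$; $\operatorname{loop}(\mathsf{M})$ is the number of loops of $\mathsf{M}$. For a matroid invariant $\phi$, $\phi(\mathsf{M})[\mathcal{F}]:=\phi(\mathsf{M}|F_1)\phi(\mathsf{M}|F_2/F_1)\cdots\phi(\mathsf{M}/F_k)$ (for the empty flag it is $\phi(\mathsf{M})$); it is applied to $\phi(\mathsf{N})=I_{\mathsf{N}}(u)$ and to $\phi(\mathsf{N})=(1+v)^{\operatorname{loop}(\mathsf{N})}$. *)

theory Defs
  imports "HOL-Analysis.Analysis"
begin

section \<open>Matroids\<close>

record 'a indep_structure =
  ground :: "'a set"
  indeps :: "'a set set"

definition matroid :: "'a indep_structure \<Rightarrow> bool" where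
  "matroid M \<longleftrightarrow>
     finite (ground M) \<and>
     indeps M \<subseteq> Pow (ground M) \<and>
     {} \<in> indeps M \<and>
     (\<forall>I\<in>indeps M. \<forall>J. J \<subseteq> I \<longrightarrow> J \<in> indeps M) \<and>
     (\<forall>I\<in>indeps M. \<forall>J\<in>indeps M. card J < card I \<longrightarrow> (\<exists>x\<in>I - J. insert x J \<in> indeps M))"

definition rank_of :: "'a indep_structure \<Rightarrow> 'a set \<Rightarrow> nat" where
  "rank_of M A = Max {card I | I. I \<in> indeps M \<and> I \<subseteq> A}"

abbreviation matroid_rank :: "'a indep_structure \<Rightarrow> nat" where
  "matroid_rank M \<equiv> rank_of M (ground M)"

definition loops :: "'a indep_structure \<Rightarrow> 'a set" where
  "loops M = {x \<in> ground M. {x} \<notin> indeps M}"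

abbreviation loopless :: "'a indep_structure \<Rightarrow> bool" where
  "loopless M \<equiv> loops M = {}"

definition bases :: "'a indep_structure \<Rightarrow> 'a set set" where
  "bases M = {B \<in> indeps M. \<forall>I\<in>indeps M. B \<subseteq> I \<longrightarrow> I = B}"

definition restriction :: "'a indep_structure \<Rightarrow> 'a set \<Rightarrow> 'a indep_structure" where
  "restriction M A = \<lparr>ground = ground M \<inter> A, indeps = {I \<in> indeps M. I \<subseteq> A}\<rparr>"

definition contraction :: "'a indep_structure \<Rightarrow> 'a set \<Rightarrow> 'a indep_structure" where
  "contraction M A = \<lparr>ground = ground M - A,
     indeps = {I. I \<subseteq> ground M - A \<and> (\<exists>B\<in>bases (restriction M A). I \<union> B \<in> indeps M)}\<rparr>"

text \<open>
  The two polynomials below are given by their values at points of an arbitrary commutative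
  ring; evaluating at the indeterminates of a polynomial ring recovers the formal polynomials.
  Both natural-number subtractions in the Tutte polynomial are exact for a matroid.
\<close>

definition tutte :: "'a indep_structure \<Rightarrow> 'k::comm_ring_1 \<Rightarrow> 'k \<Rightarrow> 'k" where
  "tutte M x y = (\<Sum>A\<in>Pow (ground M).
     (x - 1) ^ (matroid_rank M - rank_of M A) * (y - 1) ^ (card A - rank_of M A))"

definition indep_poly :: "'k::comm_ring_1 \<Rightarrow> 'a indep_structure \<Rightarrow> 'k" where
  "indep_poly u M = (\<Sum>I\<in>indeps M. u ^ card I)"

definition loop_poly :: "'k::comm_ring_1 \<Rightarrow> 'a indep_structure \<Rightarrow> 'k" where
  "loop_poly v M = (1 + v) ^ card (loops M)"

section \<open>Flags\<close>

text \<open>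
  The set $[n]$ is the universe of a finite type with $n$ elements.  A flag
  $F_1 \subsetneq \dots \subsetneq F_k$ is the list $[F_1, \dots, F_k]$, so its length is the length
  of the list.
\<close>

definition flags :: "'n::finite set list set" where
  "flags = {Fs. sorted_wrt (\<subset>) Fs \<and> (\<forall>F\<in>set Fs. F \<noteq> {} \<and> F \<noteq> UNIV)}"

lemma finite_flags: "finite (flags :: 'n::finite set list set)"
proof (rule finite_subset)
  have "distinct Fs" if "sorted_wrt (\<subset>) Fs" for Fs :: "'n set list"
    using that
  proof (induction Fs)
    case (Cons F Fs)
    then have "F \<notin> set Fs" by (metis sorted_wrt.simps(2) psubset_eq)
    with Cons show ?case by simp
  qed simp
  then show "flags \<subseteq> {Fs :: 'n set list. set Fs \<subseteq> UNIV \<and> distinct Fs}"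
    unfolding flags_def by blast
  show "finite {Fs :: 'n set list. set Fs \<subseteq> UNIV \<and> distinct Fs}"
    by (rule finite_subset_distinct) simp
qed

text \<open>
  With $F_0 = \emptyset$ and $F_{k+1} = E$ this is the product of the values of \<open>\<phi>\<close> at
  the minors $M|F_{i+1}/F_i$ for $0 \le i \le k$.
\<close>

definition flag_value ::
    "('a indep_structure \<Rightarrow> 'k::comm_monoid_mult) \<Rightarrow> 'a indep_structure \<Rightarrow> 'a set list \<Rightarrow> 'k" where
  "flag_value \<phi> M Fs =
     (\<Prod>(A, B) \<leftarrow> zip ({} # Fs) (Fs @ [ground M]). \<phi> (contraction (restriction M B) A))"

section \<open>The space of cocharacters modulo the diagonal\<close>

text \<open>
  The type below is $N_{\mathbb{R}} = \mathbb{R}^n / \mathbb{R}(1,\dots,1)$, with the quotient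
  vector space structure and the quotient topology.
\<close>

definition diag_equiv :: "real ^ 'n::finite \<Rightarrow> real ^ 'n \<Rightarrow> bool" where
  "diag_equiv x y \<longleftrightarrow> (\<exists>c. x - y = c *\<^sub>R 1)"

lemma equivp_diag_equiv: "equivp diag_equiv"
proof (rule equivpI)
  show "reflp diag_equiv"
  proof (rule reflpI)
    fix x :: "real ^ 'n"
    have "x - x = 0 *\<^sub>R 1" by simp
    then show "diag_equiv x x" unfolding diag_equiv_def by blast
  qed
  show "symp diag_equiv"
  proof (rule sympI)
    fix x y :: "real ^ 'n" assume "diag_equiv x y"
    then obtain c where "x - y = c *\<^sub>R 1" by (auto simp: diag_equiv_def)
    moreover have "y - x = - (x - y)" by simp
    ultimately have "y - x = (- c) *\<^sub>R 1" by (simp only: scaleR_minus_left)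
    then show "diag_equiv y x" unfolding diag_equiv_def by blast
  qed
  show "transp diag_equiv"
  proof (rule transpI)
    fix x y z :: "real ^ 'n" assume "diag_equiv x y" "diag_equiv y z"
    then obtain c d where "x - y = c *\<^sub>R 1" "y - z = d *\<^sub>R 1" by (auto simp: diag_equiv_def)
    moreover have "x - z = (x - y) + (y - z)" by simp
    ultimately have "x - z = (c + d) *\<^sub>R 1" by (simp only: scaleR_add_left)
    then show "diag_equiv x z" unfolding diag_equiv_def by blast
  qed
qed

quotient_type (overloaded) 'n NR = "real ^ 'n::finite" / diag_equiv
  morphisms rep_NR proj_NR
  by (rule equivp_diag_equiv)

instantiation NR :: (finite) real_vector
begin

lift_definition zero_NR :: "'a NR" is 0 .

lift_definition plus_NR :: "'a NR \<Rightarrow> 'a NR \<Rightarrow> 'a NR" is "(+)"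
proof -
  fix x x' y y' :: "real ^ 'a"
  assume "diag_equiv x x'" "diag_equiv y y'"
  then obtain c d where "x - x' = c *\<^sub>R 1" "y - y' = d *\<^sub>R 1" by (auto simp: diag_equiv_def)
  moreover have "(x + y) - (x' + y') = (x - x') + (y - y')" by simp
  ultimately have "(x + y) - (x' + y') = (c + d) *\<^sub>R 1" by (simp only: scaleR_add_left)
  then show "diag_equiv (x + y) (x' + y')" unfolding diag_equiv_def by blast
qed

lift_definition uminus_NR :: "'a NR \<Rightarrow> 'a NR" is uminus
proof -
  fix x x' :: "real ^ 'a"
  assume "diag_equiv x x'"
  then obtain c where "x - x' = c *\<^sub>R 1" by (auto simp: diag_equiv_def)
  moreover have "- x - (- x') = - (x - x')" by simp
  ultimately have "- x - (- x') = (- c) *\<^sub>R 1" by (simp only: scaleR_minus_left)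
  then show "diag_equiv (- x) (- x')" unfolding diag_equiv_def by blast
qed

definition minus_NR :: "'a NR \<Rightarrow> 'a NR \<Rightarrow> 'a NR" where
  "minus_NR x y = x + - y"

lift_definition scaleR_NR :: "real \<Rightarrow> 'a NR \<Rightarrow> 'a NR" is scaleR
proof -
  fix a :: real and x x' :: "real ^ 'a"
  assume "diag_equiv x x'"
  then obtain c where "x - x' = c *\<^sub>R 1" by (auto simp: diag_equiv_def)
  then have "a *\<^sub>R x - a *\<^sub>R x' = (a * c) *\<^sub>R 1"
    by (simp only: scaleR_right_diff_distrib[symmetric] scaleR_scaleR)
  then show "diag_equiv (a *\<^sub>R x) (a *\<^sub>R x')" unfolding diag_equiv_def by blast
qed

instance
proof
  fix x y z :: "'a NR" and a b :: real
  have eq: "diag_equiv p q" if "p = q" for p q :: "real ^ 'a"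
    unfolding that by (rule equivp_reflp[OF equivp_diag_equiv])
  show "x + y + z = x + (y + z)" by transfer (simp add: eq add.assoc)
  show "x + y = y + x" by transfer (simp add: eq add.commute)
  show "0 + x = x" by transfer (simp add: eq)
  show "- x + x = 0" by transfer (simp add: eq)
  show "x - y = x + - y" by (rule minus_NR_def)
  show "a *\<^sub>R (x + y) = a *\<^sub>R x + a *\<^sub>R y" by transfer (simp add: eq scaleR_add_right)
  show "(a + b) *\<^sub>R x = a *\<^sub>R x + b *\<^sub>R x" by transfer (simp add: eq scaleR_add_left)
  show "a *\<^sub>R b *\<^sub>R x = (a * b) *\<^sub>R x" by transfer (simp add: eq)
  show "1 *\<^sub>R x = x" by transfer (simp add: eq)
qed

end

instantiation NR :: (finite) topological_space
begin

definition open_NR :: "'a NR set \<Rightarrow> bool" where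
  "open_NR U \<longleftrightarrow> open (proj_NR -` U)"

instance
proof
  show "open (UNIV :: 'a NR set)"
    by (simp add: open_NR_def)
  show "open (S \<inter> T)" if "open S" "open T" for S T :: "'a NR set"
    using that by (simp add: open_NR_def vimage_Int open_Int)
  show "open (\<Union>K)" if "\<forall>S\<in>K. open S" for K :: "'a NR set set"
    using that unfolding open_NR_def vimage_Union by (intro open_UN)
qed

end

text \<open>
  $N = \mathbb{Z}^n/\mathbb{Z}(1,\dots,1)$, which embeds in $N_{\mathbb{R}}$ because the integer
  points of the diagonal line are the integer multiples of $(1,\dots,1)$.
\<close>

definition lattice_N :: "'n::finite NR set" where
  "lattice_N = {proj_NR (\<chi> i. of_int (x i)) | x. True}"

definition e_bar :: "'n::finite set \<Rightarrow> 'n NR" where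
  "e_bar S = proj_NR (\<Sum>i\<in>S. axis i 1)"

section \<open>The permutohedral fan\<close>

definition flag_cone :: "'n::finite set list \<Rightarrow> 'n NR set" where
  "flag_cone Fs = {\<Sum>F\<in>set Fs. c F *\<^sub>R e_bar F | c. \<forall>F. c F \<ge> (0::real)}"

definition permutohedral_fan :: "'n::finite NR set set" where
  "permutohedral_fan = flag_cone ` flags"

definition translate :: "'n::finite NR set \<Rightarrow> 'n NR \<Rightarrow> 'n NR set" where
  "translate S w = (\<lambda>x. x + w) ` S"

text \<open>
  The dimension of (the affine hull of) a nonempty convex set.  The library's \<^const>\<open>aff_dim\<close>
  needs a Euclidean space, which a zero-dimensional space (the case $n = 1$) is not.
\<close>

definition convex_dim :: "'v::real_vector set \<Rightarrow> nat" where
  "convex_dim S = dim {x - y | x y. x \<in> affine hull S \<and> y \<in> affine hull S}"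

definition generic :: "'n::finite NR \<Rightarrow> bool" where
  "generic w \<longleftrightarrow>
     (\<forall>\<sigma>\<in>permutohedral_fan. \<forall>\<tau>\<in>permutohedral_fan. translate \<sigma> w \<inter> \<tau> \<noteq> {} \<longrightarrow>
        translate (rel_interior \<sigma>) w \<inter> rel_interior \<tau> \<noteq> {} \<and>
        int (convex_dim (translate \<sigma> w \<inter> \<tau>)) =
          int (convex_dim \<sigma>) + int (convex_dim \<tau>) - (int CARD('n) - 1))"

end

theory Submission
  imports Defs
begin

text \<open>
  Write $w$ also for a representative in $\mathbb{R}^n$.  For $x$ in the relative interior of
  $\sigma_{\mathcal{F}}$ and $y = x + w$ in that of $\sigma_{\mathcal{G}}$, the flag values are
  $I_M(u)[\mathcal{F}] = \sum_I u^{|I|}$ over the independent sets $I$ of the initial matroid $M_x$ and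
  $(1+v)^{\operatorname{loop}(M)}[\mathcal{G}] = \sum_A v^{|A|}$ over the sets $A$ of loops of $M_y$.
  The pairs $(\mathcal{F}, \mathcal{G})$ in the sum are the bounded cells of the common refinement of
  $\Sigma_{[n]} + w$ and $\Sigma_{[n]}$, and genericity says that the sign is $(-1)^{\dim}$.  Hence the
  coefficient of $u^{|I|} v^{|A|}$ for fixed $I$, $A$ is the Euler characteristic of the set of $x$ such
  that $I$ is independent in $M_x$ and $A$ consists of loops of $M_{x+w}$, for the valuation that is 1
  on every nonempty closed polyhedron and therefore 0 on unbounded relatively open cells.  This valuation is an
  iterated one-dimensional Euler integral and may be evaluated in any order of the coordinates.
  Integrating first over the coordinates outside $I \cup A$ and then in increasing order of $w$ shows
  that the coefficient is 1 if $I$ is the greedy $w$-maximal basis of $I \sqcup A$, and 0 otherwise.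
  Every subset of $[n]$ arises as $I \sqcup A$ exactly once, so the total is
  $\sum_B u^{r(B)} v^{|B| - r(B)}$, which is the Tutte side.
\<close>

section \<open>Euler integration on the line\<close>

text \<open>Integrating each pair (I, A) in its own elimination order would call for a Fubini
  theorem. It is avoided by proving that a cell has the same integral, read off from its dimension
  and boundedness, for every order of all coordinates; additivity transfers this to the tight sets,
  with one order chosen per pair. The integrals live on R^n and not on N_R, so that coordinates can
  be eliminated singly. Every cell is then invariant under the diagonal; the last coordinate runs
  over a full line, which the valuation counts as 1, so the only effect is a shift of dimension by
  one. Bounded accordingly means that all differences of coordinates are bounded. A line fibre at an
  earlier stage would spoil the rule that unbounded cells count 0; there is none, because a flag
  totally preorders the coordinates. Genericity enters three times: cones that meet have meeting
  relative interiors, so that they give nonempty cells; the dimension formula turns lengths into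
  signs; and the coordinates of w are distinct, so that the greedy choice has no ties.\<close>

definition tame :: "(real \<Rightarrow> int) \<Rightarrow> bool" where
  "tame f \<longleftrightarrow> (\<exists>v. \<forall>\<^sub>F t in at_top. f t = v) \<and> (\<forall>p. \<exists>v. \<forall>\<^sub>F t in at_right p. f t = v) \<and>
     finite {p. \<not> (\<forall>\<^sub>F t in at_right p. f t = f p)}"

definition rlim :: "(real \<Rightarrow> int) \<Rightarrow> real \<Rightarrow> int" where
  "rlim f p = (THE v. \<forall>\<^sub>F t in at_right p. f t = v)"

definition toplim :: "(real \<Rightarrow> int) \<Rightarrow> int" where
  "toplim f = (THE v. \<forall>\<^sub>F t in at_top. f t = v)"

text \<open>An interval is counted at its right end: +1 at a closed right end point, or through
  \<open>toplim\<close> if it runs to infinity. An open left end point costs 1, all other ends cost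
  nothing. Hence closed intervals, closed rays and the line get 1, half-open intervals and open rays
  0, open intervals -1. Comparing with right limits only keeps the formula linear.\<close>

definition euler_int :: "(real \<Rightarrow> int) \<Rightarrow> int" where
  "euler_int f = toplim f + (\<Sum>p | f p \<noteq> rlim f p. f p - rlim f p)"

lemma rlim_eqI: "\<forall>\<^sub>F t in at_right p. f t = v \<Longrightarrow> rlim f p = v"
  unfolding rlim_def
proof (rule the_equality)
  fix v' assume "\<forall>\<^sub>F t in at_right p. f t = v" "\<forall>\<^sub>F t in at_right p. f t = v'"
  then have "\<forall>\<^sub>F t in at_right p. v = v'" by eventually_elim simp
  then show "v' = v" by simp
qed

lemma toplim_eqI: "\<forall>\<^sub>F t in at_top. f t = v \<Longrightarrow> toplim f = v"
  unfolding toplim_def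
proof (rule the_equality)
  fix v' assume "\<forall>\<^sub>F t in at_top. f t = v" "\<forall>\<^sub>F t in at_top. f t = v'"
  then have "\<forall>\<^sub>F t::real in at_top. v = v'" by eventually_elim simp
  then show "v' = v" by simp
qed

lemma tame_rlim: "tame f \<Longrightarrow> \<forall>\<^sub>F t in at_right p. f t = rlim f p"
  unfolding tame_def using rlim_eqI by metis

lemma tame_toplim: "tame f \<Longrightarrow> \<forall>\<^sub>F t in at_top. f t = toplim f"
  unfolding tame_def using toplim_eqI by metis

text \<open>\<open>B\<close> only has to contain all jumps: a surplus point has
  \<open>f p = g p\<close> and contributes 0. So two functions can share the union of their jump
  sets in the proof of additivity.\<close>

lemma euler_int_eqI:
  assumes "finite B"
    and "\<And>p. p \<notin> B \<Longrightarrow> \<forall>\<^sub>F t in at_right p. f t = f p"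
    and "\<And>p. p \<in> B \<Longrightarrow> \<forall>\<^sub>F t in at_right p. f t = g p"
    and "\<forall>\<^sub>F t in at_top. f t = v"
  shows "tame f" and "euler_int f = v + (\<Sum>p\<in>B. f p - g p)"
proof -
  show "tame f"
    unfolding tame_def
  proof (intro conjI allI)
    show "\<exists>v. \<forall>\<^sub>F t in at_right p. f t = v" for p
      using assms(2,3) by blast
    show "finite {p. \<not> (\<forall>\<^sub>F t in at_right p. f t = f p)}"
      by (rule finite_subset[OF _ assms(1)]) (use assms(2) in blast)
  qed (use assms(4) in blast)
  have rl: "rlim f p = (if p \<in> B then g p else f p)" for p
    using assms(2,3) rlim_eqI by auto
  have "{p. f p \<noteq> rlim f p} = {p \<in> B. f p \<noteq> g p}"
    by (auto simp: rl)
  then have "(\<Sum>p | f p \<noteq> rlim f p. f p - rlim f p) = (\<Sum>p | p \<in> B \<and> f p \<noteq> g p. f p - g p)"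
    by (simp add: rl)
  also have "\<dots> = (\<Sum>p\<in>B. f p - g p)"
    by (rule sum.mono_neutral_left) (use assms(1) in auto)
  finally show "euler_int f = v + (\<Sum>p\<in>B. f p - g p)"
    using assms(4) toplim_eqI by (simp add: euler_int_def)
qed

lemma tame_finite: "tame f \<Longrightarrow> finite {p. f p \<noteq> rlim f p}"
proof -
  assume t: "tame f"
  have "{p. f p \<noteq> rlim f p} \<subseteq> {p. \<not> (\<forall>\<^sub>F t in at_right p. f t = f p)}"
    using rlim_eqI by force
  then show ?thesis using t unfolding tame_def using finite_subset by blast
qed

lemma
  assumes "tame f" "tame g"
  shows tame_add: "tame (\<lambda>t. f t + g t)"
    and euler_int_add: "euler_int (\<lambda>t. f t + g t) = euler_int f + euler_int g"
proof -
  let ?A = "{p. f p \<noteq> rlim f p}" and ?B = "{p. g p \<noteq> rlim g p}"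
  have fin: "finite (?A \<union> ?B)" using assms tame_finite by simp
  have ev: "\<forall>\<^sub>F t in at_right p. f t + g t = rlim f p + rlim g p" for p
    using tame_rlim[OF assms(1), of p] tame_rlim[OF assms(2), of p]
    by eventually_elim simp
  have top: "\<forall>\<^sub>F t in at_top. f t + g t = toplim f + toplim g"
    using tame_toplim[OF assms(1)] tame_toplim[OF assms(2)] by eventually_elim simp
  have ev': "\<forall>\<^sub>F t in at_right p. f t + g t = f p + g p" if "p \<notin> ?A \<union> ?B" for p
    using ev[of p] that by simp
  note * = euler_int_eqI[of "?A \<union> ?B" "\<lambda>t. f t + g t" "\<lambda>p. rlim f p + rlim g p",
      OF fin ev' ev top]
  show "tame (\<lambda>t. f t + g t)" by (rule *(1))
  have "(\<Sum>p\<in>?A \<union> ?B. f p + g p - (rlim f p + rlim g p)) =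
        (\<Sum>p\<in>?A \<union> ?B. f p - rlim f p) + (\<Sum>p\<in>?A \<union> ?B. g p - rlim g p)"
    by (simp add: sum.distrib[symmetric] algebra_simps)
  also have "(\<Sum>p\<in>?A \<union> ?B. f p - rlim f p) = (\<Sum>p\<in>?A. f p - rlim f p)"
    by (rule sum.mono_neutral_right[OF fin]) auto
  also have "(\<Sum>p\<in>?A \<union> ?B. g p - rlim g p) = (\<Sum>p\<in>?B. g p - rlim g p)"
    by (rule sum.mono_neutral_right[OF fin]) auto
  finally show "euler_int (\<lambda>t. f t + g t) = euler_int f + euler_int g"
    using *(2) by (simp add: euler_int_def)
qed

lemma
  assumes "tame f"
  shows tame_cmult: "tame (\<lambda>t. c * f t)"
    and euler_int_cmult: "euler_int (\<lambda>t. c * f t) = c * euler_int f"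
proof -
  let ?A = "{p. f p \<noteq> rlim f p}"
  have fin: "finite ?A" using assms tame_finite by simp
  have ev: "\<forall>\<^sub>F t in at_right p. c * f t = c * rlim f p" for p
    using tame_rlim[OF assms(1), of p] by eventually_elim simp
  have top: "\<forall>\<^sub>F t in at_top. c * f t = c * toplim f"
    using tame_toplim[OF assms(1)] by eventually_elim simp
  have ev': "\<forall>\<^sub>F t in at_right p. c * f t = c * f p" if "p \<notin> ?A" for p
    using ev[of p] that by simp
  note * = euler_int_eqI[of "?A" "\<lambda>t. c * f t" "\<lambda>p. c * rlim f p", OF fin ev' ev top]
  show "tame (\<lambda>t. c * f t)" by (rule *(1))
  show "euler_int (\<lambda>t. c * f t) = c * euler_int f"
    using *(2) by (simp add: euler_int_def algebra_simps sum_distrib_left)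
qed

section \<open>Integrals of points, rays and intervals\<close>

lemma tame_const: "tame (\<lambda>t. c)" and euler_int_const: "euler_int (\<lambda>t. c) = c"
  using euler_int_eqI[of "{}" "\<lambda>t. c" undefined c] by auto

lemma ev_right_less: "(p::real) < b \<Longrightarrow> \<forall>\<^sub>F t in at_right p. t < b"
  by (rule eventually_at_rightI[of p b]) auto

lemma ev_right_greater: "\<forall>\<^sub>F t in at_right (p::real). p < t"
  by (rule eventually_at_rightI[of p "p + 1"]) auto

lemma tame_point: "tame (\<lambda>t. of_bool (t = a))"
  and euler_int_point: "euler_int (\<lambda>t. of_bool (t = a)) = 1"
proof -
  have 1: "\<forall>\<^sub>F t in at_right p. (of_bool (t = a)::int) = 0" for p
  proof (cases "p < a")
    case True
    show ?thesis using ev_right_less[OF True] by eventually_elim simp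
  next
    case False
    show ?thesis using ev_right_greater[of p] by eventually_elim (use False in simp)
  qed
  have 2: "\<forall>\<^sub>F t in at_top. (of_bool (t = a)::int) = 0"
    using eventually_gt_at_top[of a] by eventually_elim simp
  show "tame (\<lambda>t. of_bool (t = a))"
    by (rule euler_int_eqI(1)[of "{a}" _ "\<lambda>_. 0" 0]) (use 1 2 in auto)
  show "euler_int (\<lambda>t. of_bool (t = a)) = 1"
    using euler_int_eqI(2)[of "{a}" "\<lambda>t. of_bool (t = a)" "\<lambda>_. 0" 0] 1 2 by auto
qed

lemma tame_greater: "tame (\<lambda>t. of_bool (a < t))"
  and euler_int_greater: "euler_int (\<lambda>t. of_bool (a < t)) = 0"
proof -
  have 1: "\<forall>\<^sub>F t in at_right p. (of_bool (a < t)::int) = of_bool (a \<le> p)" for p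
  proof (cases "p < a")
    case True
    show ?thesis using ev_right_less[OF True] by eventually_elim (use True in simp)
  next
    case False
    show ?thesis using ev_right_greater[of p] by eventually_elim (use False in simp)
  qed
  have 2: "\<forall>\<^sub>F t in at_top. (of_bool (a < t)::int) = 1"
    using eventually_gt_at_top[of a] by eventually_elim simp
  have 3: "\<forall>\<^sub>F t in at_right p. (of_bool (a < t)::int) = of_bool (a < p)" if "p \<notin> {a}" for p
    using 1[of p] that by (simp add: order_less_le)
  show "tame (\<lambda>t. of_bool (a < t))"
    by (rule euler_int_eqI(1)[of "{a}" _ "\<lambda>p. of_bool (a \<le> p)" 1]) (use 1 2 3 ev_right_greater in simp_all)
  show "euler_int (\<lambda>t. of_bool (a < t)) = 0"
    using euler_int_eqI(2)[of "{a}" "\<lambda>t. of_bool (a < t)" "\<lambda>p. of_bool (a \<le> p)" 1, OF _ 3 1 2] by simp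
qed

lemma
  assumes "tame f" "tame g"
  shows tame_diff: "tame (\<lambda>t. f t - g t)"
    and euler_int_diff: "euler_int (\<lambda>t. f t - g t) = euler_int f - euler_int g"
  using tame_add[OF assms(1) tame_cmult[OF assms(2), of "-1"]]
    euler_int_add[OF assms(1) tame_cmult[OF assms(2), of "-1"]]
    euler_int_cmult[OF assms(2), of "-1"]
  by simp_all

lemma tame_less_eq: "tame (\<lambda>t. of_bool (t \<le> a))"
  and euler_int_less_eq: "euler_int (\<lambda>t. of_bool (t \<le> a)) = 1"
proof -
  have eq: "(\<lambda>t. of_bool (t \<le> a)) = (\<lambda>t. 1 - of_bool (a < t) :: int)"
    by (auto simp: of_bool_def)
  show "tame (\<lambda>t. of_bool (t \<le> a))" "euler_int (\<lambda>t. of_bool (t \<le> a)) = 1"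
    unfolding eq
    by (simp_all add: tame_diff euler_int_diff tame_const tame_greater euler_int_const
        euler_int_greater)
qed

lemma tame_less: "tame (\<lambda>t. of_bool (t < a))"
  and euler_int_less: "euler_int (\<lambda>t. of_bool (t < a)) = 0"
proof -
  have eq: "(\<lambda>t. of_bool (t < a)) = (\<lambda>t. of_bool (t \<le> a) - of_bool (t = a) :: int)"
    by (auto simp: of_bool_def)
  show "tame (\<lambda>t. of_bool (t < a))" "euler_int (\<lambda>t. of_bool (t < a)) = 0"
    unfolding eq
    by (simp_all add: tame_diff euler_int_diff tame_less_eq tame_point euler_int_less_eq
        euler_int_point)
qed

lemma
  assumes "a < b"
  shows tame_open_interval: "tame (\<lambda>t. of_bool (a < t \<and> t < b))"
    and euler_int_open_interval: "euler_int (\<lambda>t. of_bool (a < t \<and> t < b)) = -1"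
proof -
  have eq: "(\<lambda>t. of_bool (a < t \<and> t < b)) = (\<lambda>t. of_bool (t < b) - of_bool (t \<le> a) :: int)"
    using assms by (auto simp: of_bool_def)
  show "tame (\<lambda>t. of_bool (a < t \<and> t < b))" "euler_int (\<lambda>t. of_bool (a < t \<and> t < b)) = -1"
    unfolding eq
    by (simp_all add: tame_diff euler_int_diff tame_less tame_less_eq euler_int_less
        euler_int_less_eq)
qed

lemma euler_int_half_open: 
  "euler_int (\<lambda>t. of_bool (a < t \<and> t \<le> b)) = 0"
proof (cases "a < b")
  case True
  have eq: "(\<lambda>t. of_bool (a < t \<and> t \<le> b)) = (\<lambda>t. of_bool (t \<le> b) - of_bool (t \<le> a) :: int)"
    using True by (auto simp: of_bool_def)
  show ?thesis
    unfolding eq by (simp add: euler_int_diff tame_less_eq euler_int_less_eq)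
next
  case False
  then have eq: "(\<lambda>t. of_bool (a < t \<and> t \<le> b)) = (\<lambda>t. 0 :: int)" by auto
  show ?thesis unfolding eq by (rule euler_int_const)
qed

text \<open>The second hypothesis says that the complement has no least element, so a bounded
  nonempty \<open>D\<close> contains its supremum. This order form of closedness is what finitely
  many thresholds deliver directly.\<close>

lemma down_set_cases:
  fixes D :: "real set"
  assumes down: "\<And>p q. p \<in> D \<Longrightarrow> q \<le> p \<Longrightarrow> q \<in> D"
    and closed: "\<And>p. p \<notin> D \<Longrightarrow> \<exists>q<p. q \<notin> D"
  shows "D = {} \<or> D = UNIV \<or> (\<exists>s. D = {..s})"
proof (cases "D = {} \<or> D = UNIV")
  case False
  then obtain b where b: "b \<notin> D" by blast
  have bdd: "bdd_above D"
    by (rule bdd_aboveI[of _ b]) (meson down b linear)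
  have "Sup D \<in> D"
  proof (rule ccontr)
    assume "Sup D \<notin> D"
    then obtain q where q: "q < Sup D" "q \<notin> D" using closed by blast
    then obtain d where "d \<in> D" "q < d" using False less_cSup_iff[of D q] bdd by blast
    then show False using down q(2) by auto
  qed
  then have "D = {..Sup D}"
    using down cSup_upper[OF _ bdd] by auto
  then show ?thesis by blast
qed auto

text \<open>A set of the form $(s, t]$ has Euler integral 0, and $(-\infty, t]$ has Euler integral 1.\<close>

lemma euler_int_down_up:
  fixes D U :: "real set"
  assumes D: "\<And>p q. p \<in> D \<Longrightarrow> q \<le> p \<Longrightarrow> q \<in> D" "\<And>p. p \<notin> D \<Longrightarrow> \<exists>q<p. q \<notin> D"
    and U: "\<And>p q. p \<in> U \<Longrightarrow> p \<le> q \<Longrightarrow> q \<in> U" "\<And>p. p \<in> U \<Longrightarrow> \<exists>q<p. q \<in> U"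
    and low: "\<forall>\<^sub>F t in at_bot. t \<in> D \<inter> U \<longleftrightarrow> P"
  shows "euler_int (\<lambda>t. of_bool (t \<in> D \<inter> U)) = of_bool P"
proof -
  \<comment> \<open>The hypotheses on \<open>U\<close> are those on \<open>D\<close> for the
    complement: a down-set whose own complement has no least element.\<close>
  have "- U = {} \<or> - U = UNIV \<or> (\<exists>s. - U = {..s})"
    by (rule down_set_cases) (use U in auto)
  then have Uc: "U = UNIV \<or> U = {} \<or> (\<exists>s. U = {s<..})"
    by (metis (no_types, opaque_lifting) Compl_UNIV_eq Compl_atMost double_compl)
  have Dc: "D = {} \<or> D = UNIV \<or> (\<exists>s. D = {..s})"
    by (rule down_set_cases) (use D in auto)
  \<comment> \<open>Every shape of the two sets is constant near minus infinity; comparing its value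
    there with \<open>low\<close> replaces \<open>Q\<close> by \<open>P\<close>.\<close>
  have no: "euler_int (\<lambda>t. of_bool (t \<in> D \<inter> U)) = of_bool P"
    if "\<exists>c. \<forall>t<c. t \<in> D \<inter> U \<longleftrightarrow> Q" "euler_int (\<lambda>t. of_bool (t \<in> D \<inter> U)) = of_bool Q" for Q
  proof -
    from that(1) have "\<forall>\<^sub>F t in at_bot. t \<in> D \<inter> U \<longleftrightarrow> Q"
      unfolding eventually_at_bot_dense by auto
    with low have "\<forall>\<^sub>F t::real in at_bot. P \<longleftrightarrow> Q" by eventually_elim auto
    then have "P \<longleftrightarrow> Q" by simp
    with that show ?thesis by simp
  qed
  consider "D = {} \<or> U = {}" | "D = UNIV" "U = UNIV" | s where "D = UNIV" "U = {s<..}"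
    | t where "D = {..t}" "U = UNIV" | s t where "D = {..t}" "U = {s<..}"
    using Uc Dc by blast
  then show ?thesis
  proof cases
    case 1
    show ?thesis by (rule no[of False]) (use 1 euler_int_const in auto)
  next
    case 2
    show ?thesis by (rule no[of True]) (use 2 euler_int_const in auto)
  next
    case 3
    show ?thesis by (rule no[of False]) (use 3 euler_int_greater in \<open>auto intro!: exI[of _ s]\<close>)
  next
    case 4
    show ?thesis by (rule no[of True]) (use 4 euler_int_less_eq in \<open>auto intro!: exI[of _ t]\<close>)
  next
    case 5
    show ?thesis
      by (rule no[of False]) (use 5 euler_int_half_open[of s t] in \<open>auto intro!: exI[of _ s] simp: conj_commute\<close>)
  qed
qed

section \<open>Iterated Euler integrals and difference constraints\<close>

text \<open>The head of the list is integrated first. Every stage is again a function of all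
  coordinates that no longer depends on those already integrated, so the domain never
  changes.\<close>

primrec iter_int :: "'i list \<Rightarrow> (('i \<Rightarrow> real) \<Rightarrow> int) \<Rightarrow> ('i \<Rightarrow> real) \<Rightarrow> int" where
  "iter_int [] f = f"
| "iter_int (e # es) f = iter_int es (\<lambda>x. euler_int (\<lambda>t. f (x(e := t))))"

primrec iter_tame :: "'i list \<Rightarrow> (('i \<Rightarrow> real) \<Rightarrow> int) \<Rightarrow> bool" where
  "iter_tame [] f \<longleftrightarrow> True"
| "iter_tame (e # es) f \<longleftrightarrow> (\<forall>x. tame (\<lambda>t. f (x(e := t)))) \<and>
     iter_tame es (\<lambda>x. euler_int (\<lambda>t. f (x(e := t))))"

lemma iter_append: "iter_int (es @ es') f = iter_int es' (iter_int es f)"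
  by (induction es arbitrary: f) simp_all

lemma iter_zero: "iter_tame es (\<lambda>x. 0)" "iter_int es (\<lambda>x. 0) = (\<lambda>x. 0)"
  by (induction es) (simp_all add: tame_const euler_int_const)

lemma iter_cmult:
  "iter_tame es f \<Longrightarrow> iter_tame es (\<lambda>x. c * f x) \<and> iter_int es (\<lambda>x. c * f x) = (\<lambda>x. c * iter_int es f x)"
  by (induction es arbitrary: f) (simp_all add: tame_cmult euler_int_cmult)

lemma iter_add:
  "iter_tame es f \<Longrightarrow> iter_tame es g \<Longrightarrow> iter_tame es (\<lambda>x. f x + g x) \<and>
     iter_int es (\<lambda>x. f x + g x) = (\<lambda>x. iter_int es f x + iter_int es g x)"
  by (induction es arbitrary: f g) (simp_all add: tame_add euler_int_add)

lemma iter_sum: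
  assumes "finite C" "\<And>c. c \<in> C \<Longrightarrow> iter_tame es (f c)"
  shows "iter_int es (\<lambda>x. \<Sum>c\<in>C. h c * f c x) = (\<lambda>x. \<Sum>c\<in>C. h c * iter_int es (f c) x)"
proof -
  have "iter_tame es (\<lambda>x. \<Sum>c\<in>C. h c * f c x) \<and>
    iter_int es (\<lambda>x. \<Sum>c\<in>C. h c * f c x) = (\<lambda>x. \<Sum>c\<in>C. h c * iter_int es (f c) x)"
    using assms
  proof (induction C rule: finite_induct)
    case empty
    then show ?case by (simp add: iter_zero)
  next
    case (insert c C)
    have "iter_tame es (\<lambda>x. h c * f c x)"
      "iter_int es (\<lambda>x. h c * f c x) = (\<lambda>x. h c * iter_int es (f c) x)"
      using iter_cmult insert.prems by blast+
    moreover have "iter_tame es (\<lambda>x. \<Sum>c\<in>C. h c * f c x)"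
      "iter_int es (\<lambda>x. \<Sum>c\<in>C. h c * f c x) = (\<lambda>x. \<Sum>c\<in>C. h c * iter_int es (f c) x)"
      using insert by simp_all
    ultimately show ?case
      using iter_add[of es "\<lambda>x. h c * f c x" "\<lambda>x. \<Sum>c\<in>C. h c * f c x"] insert.hyps by simp
  qed
  then show ?thesis by blast
qed

section \<open>Polyhedra cut out by conditions on differences of coordinates\<close>

type_synonym 'i difference_constraint = "bool \<times> 'i \<times> 'i \<times> real"

text \<open>With equations and strict inequalities only, nonempty solution sets are relatively open
  polyhedra invariant under the diagonal, a class closed under projecting a coordinate away.\<close>

fun sat :: "('i \<Rightarrow> real) \<Rightarrow> 'i difference_constraint \<Rightarrow> bool" where
  "sat x (True, i, j, c) \<longleftrightarrow> x i - x j = c"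
| "sat x (False, i, j, c) \<longleftrightarrow> x i - x j < c"

definition sols :: "'i difference_constraint set \<Rightarrow> ('i \<Rightarrow> real) set" where
  "sols Q = {x. \<forall>q\<in>Q. sat x q}"

definition over :: "'i set \<Rightarrow> 'i difference_constraint set \<Rightarrow> bool" where
  "over S Q \<longleftrightarrow> (\<forall>(b, i, j, c)\<in>Q. i \<in> S \<and> j \<in> S)"

definition diff_bdd :: "('i \<Rightarrow> real) set \<Rightarrow> 'i \<Rightarrow> 'i \<Rightarrow> bool" where
  "diff_bdd P i j \<longleftrightarrow> (\<exists>B. \<forall>x\<in>P. x i - x j \<le> B)"

definition diff_const :: "('i \<Rightarrow> real) set \<Rightarrow> 'i \<Rightarrow> 'i \<Rightarrow> bool" where
  "diff_const P i j \<longleftrightarrow> (\<exists>c. \<forall>x\<in>P. x i - x j = c)"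

text \<open>For \<open>diff_const P\<close>, with \<open>P\<close> the nonempty solution set of
  finitely many constraints, \<open>card T\<close> is the dimension of \<open>P\<close> and
  \<open>card T - 1\<close> its dimension modulo the diagonal. Representatives are easier to extend
  by a coordinate than a quotient.\<close>

definition transversal :: "('i \<Rightarrow> 'i \<Rightarrow> bool) \<Rightarrow> 'i set \<Rightarrow> 'i set \<Rightarrow> bool" where
  "transversal r S T \<longleftrightarrow> T \<subseteq> S \<and> (\<forall>i\<in>S. \<exists>t\<in>T. r i t) \<and> (\<forall>s\<in>T. \<forall>t\<in>T. r s t \<longrightarrow> s = t)"

lemma diff_bdd_refl: "diff_bdd P i i"
  unfolding diff_bdd_def by auto

lemma diff_bdd_trans: "diff_bdd P i j \<Longrightarrow> diff_bdd P j k \<Longrightarrow> diff_bdd P i k"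
proof -
  assume "diff_bdd P i j" "diff_bdd P j k"
  then obtain B C where "\<forall>x\<in>P. x i - x j \<le> B" "\<forall>x\<in>P. x j - x k \<le> C"
    unfolding diff_bdd_def by blast
  then have "\<forall>x\<in>P. x i - x k \<le> B + C" by force
  then show ?thesis unfolding diff_bdd_def by blast
qed

lemma diff_const_refl: "diff_const P i i"
  unfolding diff_const_def by auto

lemma diff_const_sym: "diff_const P i j \<Longrightarrow> diff_const P j i"
proof -
  assume "diff_const P i j"
  then obtain c where "\<forall>x\<in>P. x i - x j = c" unfolding diff_const_def by blast
  then have "\<forall>x\<in>P. x j - x i = - c" by force
  then show ?thesis unfolding diff_const_def by blast
qed

lemma diff_const_trans: "diff_const P i j \<Longrightarrow> diff_const P j k \<Longrightarrow> diff_const P i k"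
proof -
  assume "diff_const P i j" "diff_const P j k"
  then obtain B C where "\<forall>x\<in>P. x i - x j = B" "\<forall>x\<in>P. x j - x k = C"
    unfolding diff_const_def by blast
  then have "\<forall>x\<in>P. x i - x k = B + C" by force
  then show ?thesis unfolding diff_const_def by blast
qed

lemma sat_cong:
  assumes "x i = y i" "x j = y j"
  shows "sat x (b, i, j, c) \<longleftrightarrow> sat y (b, i, j, c)"
  using assms by (cases b) simp_all

lemma sols_upd: "over S Q \<Longrightarrow> e \<notin> S \<Longrightarrow> x(e := t) \<in> sols Q \<longleftrightarrow> x \<in> sols Q"
proof -
  assume a: "over S Q" "e \<notin> S"
  have "sat (x(e := t)) q \<longleftrightarrow> sat x q" if "q \<in> Q" for q
  proof -
    obtain b i j c where q: "q = (b, i, j, c)" by (cases q)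
    then have "i \<noteq> e" "j \<noteq> e" using a that unfolding over_def by auto
    then show ?thesis unfolding q by (intro sat_cong) auto
  qed
  then show ?thesis unfolding sols_def by blast
qed

lemma sols_Un: "sols (Q \<union> R) = sols Q \<inter> sols R"
  unfolding sols_def by auto

lemma sols_empty: "sols {} = UNIV"
  unfolding sols_def by auto

text \<open>Either an equation ties \<open>e\<close> to another coordinate and can be solved for
  \<open>e\<close>, or \<open>e\<close> is only bounded strictly, below by \<open>L\<close> and
  above by \<open>U\<close>. These are the point fibres and the open fibres of the
  projection.\<close>

lemma eliminate_cases:
  assumes fin: "finite Q" and ne: "sols Q \<noteq> {}" and ov: "over (insert e S) Q" and e: "e \<notin> S"
  obtains (point) j c Q' where "j \<in> S" "finite Q'" "over S Q'"
      "\<And>x. x \<in> sols Q \<longleftrightarrow> x e = x j + c \<and> x \<in> sols Q'"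
  | (interval) L U R where "finite L" "finite U" "L \<subseteq> S \<times> UNIV" "U \<subseteq> S \<times> UNIV" "finite R" "over S R"
      "\<And>x. x \<in> sols Q \<longleftrightarrow> x \<in> sols R \<and> (\<forall>(j, c)\<in>L. x j + c < x e) \<and> (\<forall>(j, c)\<in>U. x e < x j + c)"
proof (cases "\<exists>j\<in>S. \<exists>c. (True, e, j, c) \<in> Q \<or> (True, j, e, - c) \<in> Q")
  case True
  then obtain j c where j: "j \<in> S" and jc: "(True, e, j, c) \<in> Q \<or> (True, j, e, - c) \<in> Q" by blast
  \<comment> \<open>Substitutes \<open>x j + c\<close> for \<open>x e\<close>; the constant moves to
    the right-hand side, with opposite signs for the two positions of \<open>e\<close>.\<close>
  define s where "s = (\<lambda>(b :: bool, i, k, d :: real). (b, if i = e then j else i, if k = e then j else k,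
     d - (if i = e then c else 0) + (if k = e then c else 0)))"
  have s: "sat x (s q) \<longleftrightarrow> sat x q" if "x e = x j + c" for x q
  proof -
    obtain b i k d where q: "q = (b, i, k, d)" by (cases q)
    show ?thesis unfolding q s_def using that by (cases b) (auto simp: algebra_simps)
  qed
  have "x \<in> sols Q \<longleftrightarrow> x e = x j + c \<and> x \<in> sols (s ` Q)" for x
  proof -
    have "x e = x j + c" if "x \<in> sols Q"
      using jc
    proof
      assume "(True, e, j, c) \<in> Q"
      then have "sat x (True, e, j, c)" using that unfolding sols_def by blast
      then show ?thesis by simp
    next
      assume "(True, j, e, - c) \<in> Q"
      then have "sat x (True, j, e, - c)" using that unfolding sols_def by blast
      then show ?thesis by simp
    qed
    then show ?thesis using s unfolding sols_def by auto
  qed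
  moreover have "over S (s ` Q)"
    using ov j unfolding over_def s_def by fastforce
  ultimately show ?thesis using point[of j "s ` Q" c] j fin by blast
next
  case False
  define L where "L = {(j, c). j \<in> S \<and> (False, j, e, - c) \<in> Q}"
  define U where "U = {(j, c). j \<in> S \<and> (False, e, j, c) \<in> Q}"
  define R where "R = {(b, i, j, c) \<in> Q. i \<in> S \<and> j \<in> S}"
  have "L \<subseteq> (\<lambda>(b, i, k, d). (i, - d)) ` Q"
    unfolding L_def by (force simp: image_iff)
  then have L: "finite L" using fin finite_subset by blast
  have "U \<subseteq> (\<lambda>(b, i, k, d). (k, d)) ` Q"
    unfolding U_def by (force simp: image_iff)
  then have U: "finite U" using fin finite_subset by blast
  have R: "finite R" unfolding R_def using fin by (auto intro: finite_subset)
  have "x \<in> sols Q \<longleftrightarrow> x \<in> sols R \<and> (\<forall>(j, c)\<in>L. x j + c < x e) \<and> (\<forall>(j, c)\<in>U. x e < x j + c)"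
    (is "_ \<longleftrightarrow> ?rhs") for x
  proof
    assume x: "x \<in> sols Q"
    have "x j + c < x e" if "(j, c) \<in> L" for j c
    proof -
      have "sat x (False, j, e, - c)" using that x unfolding L_def sols_def by blast
      then show ?thesis by simp
    qed
    moreover have "x e < x j + c" if "(j, c) \<in> U" for j c
    proof -
      have "sat x (False, e, j, c)" using that x unfolding U_def sols_def by blast
      then show ?thesis by simp
    qed
    moreover have "x \<in> sols R" using x unfolding R_def sols_def by blast
    ultimately show ?rhs by auto
  next
    assume x: ?rhs
    have "sat x q" if "q \<in> Q" for q
    proof -
      obtain b i k d where q: "q = (b, i, k, d)" by (cases q)
      have ik: "i = e \<or> i \<in> S" "k = e \<or> k \<in> S" using ov that q unfolding over_def by auto
      obtain z where "z \<in> sols Q" using ne by blast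
      then have z: "sat z q" using that unfolding sols_def by blast
      consider "i = e" "k = e" | "i = e" "k \<in> S" | "i \<in> S" "k = e" | "i \<in> S" "k \<in> S" using ik by blast
      then show ?thesis
      proof cases
        \<comment> \<open>A constraint between \<open>e\<close> and itself has no unknown left, so
          its truth at the solution \<open>z\<close> decides it. Such constraints were dropped from
          \<open>R\<close>.\<close>
        case 1
        then show ?thesis using z q by (cases b) auto
      next
        case 2
        then have "\<not> b" using False that q by (cases b) auto
        then have "(k, d) \<in> U" using 2 that q unfolding U_def by auto
        then show ?thesis using x 2 q \<open>\<not> b\<close> by auto
      next
        case 3
        have "\<not> b"
        proof
          assume b
          then have "(True, i, e, - (- d)) \<in> Q" using that q 3 by simp
          then show False using False 3 by blast
        qed
        then have "(i, - d) \<in> L" using 3 that q unfolding L_def by auto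
        then show ?thesis using x 3 q \<open>\<not> b\<close> by fastforce
      next
        case 4
        then have "q \<in> R" using that q unfolding R_def by auto
        then show ?thesis using x unfolding sols_def by blast
      qed
    qed
    then show "x \<in> sols Q" unfolding sols_def by blast
  qed
  moreover have "L \<subseteq> S \<times> UNIV" "U \<subseteq> S \<times> UNIV" "over S R"
    unfolding L_def U_def R_def over_def by auto
  ultimately show ?thesis using interval[of L U R] L U R by blast
qed

lemma diff_project:
  assumes "P' = {x. \<exists>t. x(e := t) \<in> P}" "i \<noteq> e" "j \<noteq> e"
  shows "diff_bdd P' i j \<longleftrightarrow> diff_bdd P i j" "diff_const P' i j \<longleftrightarrow> diff_const P i j"
proof -
  have P: "x \<in> P \<Longrightarrow> x \<in> P'" for x using assms(1) by (auto intro!: exI[of _ "x e"])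
  have P': "x \<in> P' \<Longrightarrow> \<exists>y\<in>P. y i = x i \<and> y j = x j" for x
    using assms by (auto intro!: bexI[of _ "x(e := _)"])
  show "diff_bdd P' i j \<longleftrightarrow> diff_bdd P i j"
    unfolding diff_bdd_def using P P' by metis
  show "diff_const P' i j \<longleftrightarrow> diff_const P i j"
    unfolding diff_const_def using P P' by metis
qed

lemma ball_less_iff_Max:
  fixes f :: "'a \<Rightarrow> real"
  assumes "finite L" "L \<noteq> {}"
  shows "(\<forall>l\<in>L. f l < t) \<longleftrightarrow> Max (f ` L) < t" "(\<forall>l\<in>L. t < f l) \<longleftrightarrow> t < Min (f ` L)"
  using assms by auto

text \<open>Fourier-Motzkin elimination: integrating out one coordinate replaces the solution set by its
  projection, up to a sign that records whether the fibres are points or open intervals.\<close>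

lemma iter_int_sols:
  fixes Q :: "'i difference_constraint set"
  assumes "distinct es" "es \<noteq> []" "finite Q" "over (set es) Q" "sols Q \<noteq> {}"
    and "\<And>i j. i \<in> set es \<Longrightarrow> j \<in> set es \<Longrightarrow> diff_bdd (sols Q) i j \<or> diff_bdd (sols Q) j i"
  shows "iter_tame es (\<lambda>x. of_bool (x \<in> sols Q)) \<and>
    (if \<forall>i\<in>set es. \<forall>j\<in>set es. diff_bdd (sols Q) i j
     then \<exists>T. transversal (diff_const (sols Q)) (set es) T \<and>
       iter_int es (\<lambda>x. of_bool (x \<in> sols Q)) = (\<lambda>x. (- 1) ^ (card T - 1))
     else iter_int es (\<lambda>x. of_bool (x \<in> sols Q)) = (\<lambda>x. 0))"
  using assms
proof (induction es arbitrary: Q)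
  case (Cons e es)
  let ?P = "sols Q" and ?S = "set es"
  have eS: "e \<notin> ?S" and ov: "over (insert e ?S) Q" using Cons.prems by auto
  obtain z where z: "z \<in> ?P" using Cons.prems by blast
  from Cons.prems(3) Cons.prems(5) ov eS show ?case
  proof (cases rule: eliminate_cases)
    case (point j c Q')
    let ?P' = "sols Q'"
    have fibre: "of_bool (x(e := t) \<in> ?P) = of_bool (x \<in> ?P') * (of_bool (t = x j + c) :: int)" for x t
      using point(4)[of "x(e := t)"] sols_upd[OF point(3) eS, of x t] eS point(1) by auto
    have E: "(\<lambda>x. euler_int (\<lambda>t. of_bool (x(e := t) \<in> ?P))) = (\<lambda>x. of_bool (x \<in> ?P'))"
      unfolding fibre by (simp add: euler_int_cmult tame_point euler_int_point)
    have T: "tame (\<lambda>t. of_bool (x(e := t) \<in> ?P))" for x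
      unfolding fibre by (intro tame_cmult tame_point)
    have proj: "?P' = {x. \<exists>t. x(e := t) \<in> ?P}"
    proof -
      have "x \<in> ?P' \<longleftrightarrow> (\<exists>t. x(e := t) \<in> ?P)" for x
      proof
        assume "x \<in> ?P'"
        then have "x(e := x j + c) \<in> ?P"
          using point(1) point(4)[of "x(e := x j + c)"] sols_upd[OF point(3) eS, of x "x j + c"] eS
          by auto
        then show "\<exists>t. x(e := t) \<in> ?P" ..
      qed (use point(4) sols_upd[OF point(3) eS] in blast)
      then show ?thesis by blast
    qed
    have dp: "diff_bdd ?P' i k \<longleftrightarrow> diff_bdd ?P i k" "diff_const ?P' i k \<longleftrightarrow> diff_const ?P i k"
      if "i \<in> ?S" "k \<in> ?S" for i k
      using diff_project[OF proj, of i k] that eS by blast+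
    have ej: "diff_const ?P e j" unfolding diff_const_def using point(4) by (intro exI[of _ c]) auto
    have ejb: "diff_bdd ?P e j" "diff_bdd ?P j e"
      unfolding diff_bdd_def using point(4) by (intro exI[of _ c] exI[of _ "- c"]; auto)+
    have IH: "iter_tame es (\<lambda>x. of_bool (x \<in> ?P')) \<and>
      (if \<forall>i\<in>?S. \<forall>j\<in>?S. diff_bdd ?P' i j
       then \<exists>T. transversal (diff_const ?P') ?S T \<and>
         iter_int es (\<lambda>x. of_bool (x \<in> ?P')) = (\<lambda>x. (- 1) ^ (card T - 1))
       else iter_int es (\<lambda>x. of_bool (x \<in> ?P')) = (\<lambda>x. 0))"
    proof (rule Cons.IH)
      show "distinct es" using Cons.prems(1) by simp
      show "es \<noteq> []" using point(1) by auto
      show "sols Q' \<noteq> {}" using z point(4) by blast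
      show "diff_bdd (sols Q') i k \<or> diff_bdd (sols Q') k i" if "i \<in> ?S" "k \<in> ?S" for i k
        using that Cons.prems(6) dp by simp
    qed (use point in auto)
    have b: "(\<forall>i\<in>set (e # es). \<forall>k\<in>set (e # es). diff_bdd ?P i k) \<longleftrightarrow>
        (\<forall>i\<in>?S. \<forall>k\<in>?S. diff_bdd ?P' i k)"
    proof
      assume a: "\<forall>i\<in>?S. \<forall>k\<in>?S. diff_bdd ?P' i k"
      then have "diff_bdd ?P i j \<and> diff_bdd ?P j i" if "i \<in> set (e # es)" for i
        using that ejb dp point(1) by auto
      then show "\<forall>i\<in>set (e # es). \<forall>k\<in>set (e # es). diff_bdd ?P i k"
        using diff_bdd_trans by metis
    qed (use dp in simp)
    \<comment> \<open>\<open>e\<close> joins the class of \<open>j\<close>, so \<open>T\<close> and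
      with it the sign stay unchanged, as fits a point fibre of integral 1.\<close>
    have tr: "transversal (diff_const ?P) (set (e # es)) T" if T: "transversal (diff_const ?P') ?S T" for T
    proof -
      have "\<exists>t\<in>T. diff_const ?P e t"
      proof -
        obtain t where "t \<in> T" "diff_const ?P' j t" using T point(1) unfolding transversal_def by blast
        moreover have "t \<in> ?S" using T \<open>t \<in> T\<close> unfolding transversal_def by blast
        ultimately show ?thesis using dp(2)[of j t] point(1) diff_const_trans[OF ej] by blast
      qed
      then show ?thesis using T dp(2) unfolding transversal_def by (auto simp: subset_iff)
    qed
    show ?thesis
      using IH unfolding b iter_int.simps iter_tame.simps E
      using T tr by (auto split: if_splits)
  next
    case (interval L U R)
    let ?L = "\<lambda>x. (\<lambda>(j, c). x j + c) ` L" and ?U = "\<lambda>x. (\<lambda>(j, c). x j + c) ` U"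
    have upd: "x(e := t) \<in> ?P \<longleftrightarrow> x \<in> sols R \<and> (\<forall>l\<in>L. (\<lambda>(j, c). x j + c) l < t) \<and>
        (\<forall>l\<in>U. t < (\<lambda>(j, c). x j + c) l)" for x t
    proof -
      have "(x(e := t)) (fst l) = x (fst l)" if "l \<in> L \<union> U" for l
        using interval(3,4) eS that by force
      then have "(\<forall>(j, c)\<in>L. (x(e := t)) j + c < t) \<longleftrightarrow> (\<forall>(j, c)\<in>L. x j + c < t)"
        "(\<forall>(j, c)\<in>U. t < (x(e := t)) j + c) \<longleftrightarrow> (\<forall>(j, c)\<in>U. t < x j + c)"
        unfolding case_prod_beta by simp_all
      then show ?thesis
        using interval(7)[of "x(e := t)"] sols_upd[OF interval(6) eS, of x t]
        by (simp add: case_prod_beta)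
    qed
    consider "es = []" | "es \<noteq> []" "L = {}" "U = {}" | "L = {}" "U \<noteq> {}" | "L \<noteq> {}" "U = {}"
      | "L \<noteq> {}" "U \<noteq> {}" by blast
    then show ?thesis
    proof cases
      case 1
      \<comment> \<open>Only the diagonal direction is left: the fibre is a full line, and its
        integral 1 is \<open>(- 1) ^ (card {e} - 1)\<close>.\<close>
      then have "R = {}" using interval(6) unfolding over_def by auto
      moreover have "L = {}" "U = {}" using interval(3,4) 1 by auto
      ultimately have P: "?P = UNIV" using interval(7) by (auto simp: sols_empty)
      have "transversal (diff_const ?P) (set (e # es)) {e}"
        using 1 diff_const_refl unfolding transversal_def by auto
      then show ?thesis
        using 1 unfolding P by (auto simp: tame_const euler_int_const diff_bdd_refl intro!: exI[of _ "{e}"])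
    next
      case 2
      \<comment> \<open>A free coordinate would give a line fibre of integral 1 although
        \<open>?P\<close> is unbounded. It is excluded because its difference with any remaining
        \<open>k\<close> is unbounded on both sides, against the comparability hypothesis.\<close>
      then obtain k where k: "k \<in> ?S" by (meson last_in_set)
      have "z \<in> sols R" using z interval(7) by blast
      then have all: "z(e := t) \<in> ?P" for t using upd[of z t] 2 by simp
      have "\<not> diff_bdd ?P e k"
      proof
        assume "diff_bdd ?P e k"
        then obtain B where B: "\<And>x. x \<in> ?P \<Longrightarrow> x e - x k \<le> B" unfolding diff_bdd_def by blast
        show False using B[OF all[of "B + z k + 1"]] k eS by (auto split: if_splits)
      qed
      moreover have "\<not> diff_bdd ?P k e"
      proof
        assume "diff_bdd ?P k e"
        then obtain B where B: "\<And>x. x \<in> ?P \<Longrightarrow> x k - x e \<le> B" unfolding diff_bdd_def by blast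
        show False using B[OF all[of "z k - B - 1"]] k eS by (auto split: if_splits)
      qed
      ultimately show ?thesis using Cons.prems(6)[of e k] k by auto
    next
      case 3
      have fibre: "of_bool (x(e := t) \<in> ?P) = of_bool (x \<in> sols R) * (of_bool (t < Min (?U x)) :: int)"
        for x t
        unfolding upd using 3 ball_less_iff_Max(2)[OF interval(2), of t] by auto
      have E: "(\<lambda>x. euler_int (\<lambda>t. of_bool (x(e := t) \<in> ?P))) = (\<lambda>x. 0)"
        unfolding fibre by (simp add: euler_int_cmult tame_less euler_int_less)
      have T: "tame (\<lambda>t. of_bool (x(e := t) \<in> ?P))" for x
        unfolding fibre by (intro tame_cmult tame_less)
      obtain j c where jc: "(j, c) \<in> U" using 3 by auto
      then have j: "j \<in> ?S" using interval(4) by auto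
      have "\<not> diff_bdd ?P j e"
      proof
        assume "diff_bdd ?P j e"
        then obtain B where B: "\<And>x. x \<in> ?P \<Longrightarrow> x j - x e \<le> B" unfolding diff_bdd_def by blast
        define t where "t = min (z e) (z j - B - 1)"
        have zt: "z(e := t) \<in> ?P"
          using upd[of z t] upd[of z "z e"] z 3 unfolding t_def by auto
        show False using B[OF zt] j eS unfolding t_def by (auto split: if_splits)
      qed
      then have nb: "\<not> (\<forall>i\<in>set (e # es). \<forall>j\<in>set (e # es). diff_bdd ?P i j)" using j by auto
      show ?thesis
        unfolding if_not_P[OF nb] iter_int.simps iter_tame.simps E using T iter_zero by blast
    next
      case 4
      have fibre: "of_bool (x(e := t) \<in> ?P) = of_bool (x \<in> sols R) * (of_bool (Max (?L x) < t) :: int)"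
        for x t
        unfolding upd using 4 ball_less_iff_Max(1)[OF interval(1)] by auto
      have E: "(\<lambda>x. euler_int (\<lambda>t. of_bool (x(e := t) \<in> ?P))) = (\<lambda>x. 0)"
        unfolding fibre by (simp add: euler_int_cmult tame_greater euler_int_greater)
      have T: "tame (\<lambda>t. of_bool (x(e := t) \<in> ?P))" for x
        unfolding fibre by (intro tame_cmult tame_greater)
      obtain j c where jc: "(j, c) \<in> L" using 4 by auto
      then have j: "j \<in> ?S" using interval(3) by auto
      have "\<not> diff_bdd ?P e j"
      proof
        assume "diff_bdd ?P e j"
        then obtain B where B: "\<And>x. x \<in> ?P \<Longrightarrow> x e - x j \<le> B" unfolding diff_bdd_def by blast
        define t where "t = max (z e) (z j + B + 1)"
        have zt: "z(e := t) \<in> ?P"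
          using upd[of z t] upd[of z "z e"] z 4 unfolding t_def by auto
        show False using B[OF zt] j eS unfolding t_def by (auto split: if_splits)
      qed
      then have nb: "\<not> (\<forall>i\<in>set (e # es). \<forall>j\<in>set (e # es). diff_bdd ?P i j)" using j by auto
      show ?thesis
        unfolding if_not_P[OF nb] iter_int.simps iter_tame.simps E using T iter_zero by blast
    next
      case 5
      \<comment> \<open>The open fibre is nonempty exactly if every lower bound is below every upper
        bound, and \<open>x j + c < x k + d\<close> is again a difference constraint.\<close>
      define C where "C = (\<lambda>((j, c), (k, d)). (False, j, k, d - c)) ` (L \<times> U)"
      define Q' where "Q' = R \<union> C"
      let ?P' = "sols Q'"
      have C: "x \<in> sols C \<longleftrightarrow> Max (?L x) < Min (?U x)" for x
      proof -
        have "x \<in> sols C \<longleftrightarrow> (\<forall>l\<in>L. \<forall>u\<in>U. (\<lambda>(j, c). x j + c) l < (\<lambda>(j, c). x j + c) u)"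
          unfolding sols_def C_def by (force simp: algebra_simps)
        also have "\<dots> \<longleftrightarrow> (\<forall>l\<in>L. (\<lambda>(j, c). x j + c) l < Min (?U x))"
          using ball_less_iff_Max(2)[OF interval(2) 5(2)] by auto
        also have "\<dots> \<longleftrightarrow> Max (?L x) < Min (?U x)"
          using ball_less_iff_Max(1)[OF interval(1) 5(1)] by auto
        finally show ?thesis .
      qed
      have upd': "x(e := t) \<in> ?P \<longleftrightarrow> x \<in> sols R \<and> Max (?L x) < t \<and> t < Min (?U x)" for x t
        unfolding upd using ball_less_iff_Max(1)[OF interval(1) 5(1)]
          ball_less_iff_Max(2)[OF interval(2) 5(2)] by auto
      have P': "x \<in> ?P' \<longleftrightarrow> x \<in> sols R \<and> Max (?L x) < Min (?U x)" for x
        unfolding Q'_def sols_Un using C by auto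
      have ET: "euler_int (\<lambda>t. of_bool (x(e := t) \<in> ?P)) = (- 1) * of_bool (x \<in> ?P') \<and>
          tame (\<lambda>t. of_bool (x(e := t) \<in> ?P))" for x
      proof (cases "x \<in> ?P'")
        case True
        then show ?thesis
          unfolding upd' using euler_int_open_interval tame_open_interval P'[of x] by simp
      next
        case False
        then have "(\<lambda>t. of_bool (x(e := t) \<in> ?P)) = (\<lambda>t. 0 :: int)"
          unfolding upd' using P'[of x] by auto
        then show ?thesis using False tame_const euler_int_const by simp
      qed
      then have E: "(\<lambda>x. euler_int (\<lambda>t. of_bool (x(e := t) \<in> ?P))) = (\<lambda>x. (- 1) * of_bool (x \<in> ?P'))"
        by blast
      have proj: "?P' = {x. \<exists>t. x(e := t) \<in> ?P}"
        unfolding upd' using P' dense by (auto intro: less_trans)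
      have dp: "diff_bdd ?P' i k \<longleftrightarrow> diff_bdd ?P i k" "diff_const ?P' i k \<longleftrightarrow> diff_const ?P i k"
        if "i \<in> ?S" "k \<in> ?S" for i k
        using diff_project[OF proj, of i k] that eS by blast+
      obtain l c u d where l: "(l, c) \<in> L" and u: "(u, d) \<in> U" using 5 by auto
      have lu: "l \<in> ?S" "u \<in> ?S" using l u interval(3,4) by auto
      have eb: "diff_bdd ?P e u" "diff_bdd ?P l e"
      proof -
        have "x l + c < x e" "x e < x u + d" if "x \<in> ?P" for x
          using interval(7) l u that by fastforce+
        then show "diff_bdd ?P e u" "diff_bdd ?P l e"
          unfolding diff_bdd_def by (intro exI[of _ d] exI[of _ "- c"]; force)+
      qed
      have IH: "iter_tame es (\<lambda>x. of_bool (x \<in> ?P')) \<and>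
        (if \<forall>i\<in>?S. \<forall>j\<in>?S. diff_bdd ?P' i j
         then \<exists>T. transversal (diff_const ?P') ?S T \<and>
           iter_int es (\<lambda>x. of_bool (x \<in> ?P')) = (\<lambda>x. (- 1) ^ (card T - 1))
         else iter_int es (\<lambda>x. of_bool (x \<in> ?P')) = (\<lambda>x. 0))"
      proof (rule Cons.IH)
        show "distinct es" using Cons.prems(1) by simp
        show "es \<noteq> []" using lu by auto
        show "sols Q' \<noteq> {}" using z unfolding proj by (auto intro!: exI[of _ z] exI[of _ "z e"])
        show "finite Q'" unfolding Q'_def C_def using interval by simp
        show "over ?S Q'" using interval(3,4,6) unfolding Q'_def C_def over_def by fastforce
        show "diff_bdd (sols Q') i k \<or> diff_bdd (sols Q') k i" if "i \<in> ?S" "k \<in> ?S" for i k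
          using that Cons.prems(6) dp by simp
      qed
      \<comment> \<open>\<open>e\<close> is squeezed between the coordinates \<open>l\<close> and
        \<open>u\<close> and adds no direction of unboundedness.\<close>
      have b: "(\<forall>i\<in>set (e # es). \<forall>k\<in>set (e # es). diff_bdd ?P i k) \<longleftrightarrow>
          (\<forall>i\<in>?S. \<forall>k\<in>?S. diff_bdd ?P' i k)"
      proof
        assume a: "\<forall>i\<in>?S. \<forall>k\<in>?S. diff_bdd ?P' i k"
        have "diff_bdd ?P i u \<and> diff_bdd ?P l i" if "i \<in> set (e # es)" for i
          using that eb dp a lu by auto
        moreover have "diff_bdd ?P u l" using a dp lu by blast
        ultimately show "\<forall>i\<in>set (e # es). \<forall>k\<in>set (e # es). diff_bdd ?P i k"
          using diff_bdd_trans by meson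
      qed (use dp in simp)
      \<comment> \<open>The fibre over \<open>z\<close> is an open interval and holds two points, so
        \<open>e\<close> forms a class of its own. The dimension rises by one while the fibre
        contributes -1.\<close>
      have ne: "\<not> diff_const ?P e k" if "k \<in> ?S" for k
      proof
        assume "diff_const ?P e k"
        then obtain c where c: "\<And>x. x \<in> ?P \<Longrightarrow> x e - x k = c" unfolding diff_const_def by blast
        have "z \<in> ?P'" using z unfolding proj by (auto intro!: exI[of _ "z e"])
        then have zz: "z \<in> sols R" "Max (?L z) < Min (?U z)" using P' by auto
        then obtain t where t: "Max (?L z) < t" "t < Min (?U z)" using dense by blast
        obtain t' where t': "t < t'" "t' < Min (?U z)" using dense t by blast
        have 1: "z(e := t) \<in> ?P" "z(e := t') \<in> ?P" unfolding upd' using zz t t' by auto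
        show False using c[OF 1(1)] c[OF 1(2)] that eS t' by (auto split: if_splits)
      qed
      have tr: "transversal (diff_const ?P) (set (e # es)) (insert e T) \<and>
          (- 1 :: int) * (- 1) ^ (card T - 1) = (- 1) ^ (card (insert e T) - 1)"
        if T: "transversal (diff_const ?P') ?S T" for T
      proof
        have TS: "T \<subseteq> ?S" using T unfolding transversal_def by blast
        then show "transversal (diff_const ?P) (set (e # es)) (insert e T)"
          unfolding transversal_def
        proof (intro conjI ballI impI)
          show "insert e T \<subseteq> set (e # es)" using TS by auto
          show "\<exists>t\<in>insert e T. diff_const ?P i t" if "i \<in> set (e # es)" for i
          proof (cases "i = e")
            case True
            then show ?thesis using diff_const_refl[of ?P e] by blast
          next
            case False
            then have "i \<in> ?S" using that by simp
            moreover obtain t where "t \<in> T" "diff_const ?P' i t"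
              using T calculation unfolding transversal_def by blast
            ultimately show ?thesis using dp(2)[of i t] TS by blast
          qed
          show "s = t" if "s \<in> insert e T" "t \<in> insert e T" "diff_const ?P s t" for s t
            using that T dp(2)[of s t] ne[of s] ne[of t] TS diff_const_sym[of ?P s t]
            unfolding transversal_def by blast
        qed
        \<comment> \<open>For nonempty \<open>T\<close> the truncated subtraction
          \<open>card T - 1\<close> is exact, so that adding \<open>e\<close> flips the
          sign.\<close>
        have "T \<noteq> {}" "finite T" "e \<notin> T"
          using T lu(1) TS eS finite_subset unfolding transversal_def by auto
        then show "(- 1 :: int) * (- 1) ^ (card T - 1) = (- 1) ^ (card (insert e T) - 1)"
          by (cases "card T") auto
      qed
      note cm = iter_cmult[OF conjunct1[OF IH], of "- 1"]
      show ?thesis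
      proof (cases "\<forall>i\<in>?S. \<forall>j\<in>?S. diff_bdd ?P' i j")
        case True
        then obtain T where T: "transversal (diff_const ?P') ?S T"
          "iter_int es (\<lambda>x. of_bool (x \<in> ?P')) = (\<lambda>x. (- 1) ^ (card T - 1))" using IH by auto
        have "\<exists>T. transversal (diff_const ?P) (set (e # es)) T \<and>
          iter_int (e # es) (\<lambda>x. of_bool (x \<in> ?P)) = (\<lambda>x. (- 1) ^ (card T - 1))"
        proof (intro exI[of _ "insert e T"] conjI)
          show "iter_int (e # es) (\<lambda>x. of_bool (x \<in> ?P)) = (\<lambda>x. (- 1) ^ (card (insert e T) - 1))"
            unfolding iter_int.simps E using cm tr[OF T(1)] T(2) by (simp only: fun_eq_iff) metis
        qed (use tr[OF T(1)] in blast)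
        then show ?thesis
          unfolding b if_P[OF True] iter_tame.simps E using ET cm by blast
      next
        case False
        then have "iter_int es (\<lambda>x. of_bool (x \<in> ?P')) = (\<lambda>x. 0)" using IH by auto
        then have "iter_int (e # es) (\<lambda>x. of_bool (x \<in> ?P)) = (\<lambda>x. 0)"
          unfolding iter_int.simps E using cm by (simp only: fun_eq_iff) simp
        then show ?thesis
          unfolding b if_not_P[OF False] iter_tame.simps E using ET cm by blast
      qed
    qed
  qed
qed simp

section \<open>Matroid rank and greedy bases\<close>

text \<open>\<open>e\<close> lies in the matroid closure of \<open>A\<close>; stated by ranks, so
  that submodularity applies without choosing bases.\<close>

definition spanned :: "'a indep_structure \<Rightarrow> 'a \<Rightarrow> 'a set \<Rightarrow> bool" where
  "spanned M e A \<longleftrightarrow> rank_of M (insert e A) = rank_of M A"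

lemma
  assumes "matroid M"
  shows matroid_finite: "I \<in> indeps M \<Longrightarrow> finite I"
    and matroid_finite_indeps: "finite (indeps M)"
    and matroid_subset: "I \<in> indeps M \<Longrightarrow> J \<subseteq> I \<Longrightarrow> J \<in> indeps M"
    and matroid_empty: "{} \<in> indeps M"
    and matroid_exchange: "I \<in> indeps M \<Longrightarrow> J \<in> indeps M \<Longrightarrow> card J < card I \<Longrightarrow>
      \<exists>x\<in>I - J. insert x J \<in> indeps M"
proof -
  have g: "finite (ground M)" "indeps M \<subseteq> Pow (ground M)"
    using assms unfolding matroid_def by auto
  then show "I \<in> indeps M \<Longrightarrow> finite I" "finite (indeps M)"
    by (auto intro: finite_subset)
  show "I \<in> indeps M \<Longrightarrow> J \<subseteq> I \<Longrightarrow> J \<in> indeps M" "{} \<in> indeps M"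
    "I \<in> indeps M \<Longrightarrow> J \<in> indeps M \<Longrightarrow> card J < card I \<Longrightarrow> \<exists>x\<in>I - J. insert x J \<in> indeps M"
    using assms unfolding matroid_def by blast+
qed

lemma
  assumes M: "matroid M"
  shows rank_ge: "I \<in> indeps M \<Longrightarrow> I \<subseteq> A \<Longrightarrow> card I \<le> rank_of M A"
    and rank_witness: "\<exists>I\<in>indeps M. I \<subseteq> A \<and> card I = rank_of M A"
proof -
  let ?S = "{card I | I. I \<in> indeps M \<and> I \<subseteq> A}"
  have "?S = card ` {I \<in> indeps M. I \<subseteq> A}" by auto
  then have fin: "finite ?S" using matroid_finite_indeps[OF M] by simp
  then show "I \<in> indeps M \<Longrightarrow> I \<subseteq> A \<Longrightarrow> card I \<le> rank_of M A"
    unfolding rank_of_def by (intro Max_ge) auto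
  have "Max ?S \<in> ?S" by (rule Max_in[OF fin]) (use matroid_empty[OF M] in auto)
  then show "\<exists>I\<in>indeps M. I \<subseteq> A \<and> card I = rank_of M A"
    unfolding rank_of_def by auto
qed

lemma indep_extend:
  assumes M: "matroid M" and J: "J \<in> indeps M" "J \<subseteq> A"
  obtains I where "I \<in> indeps M" "J \<subseteq> I" "I \<subseteq> A" "card I = rank_of M A"
proof -
  have "\<exists>I\<in>indeps M. J \<subseteq> I \<and> I \<subseteq> A \<and> card I = rank_of M A"
    using J
  proof (induction "rank_of M A - card J" arbitrary: J rule: less_induct)
    case less
    show ?case
    proof (cases "card J = rank_of M A")
      case False
      then have lt: "card J < rank_of M A" using rank_ge[OF M] less.prems by (simp add: order_less_le)
      obtain K where K: "K \<in> indeps M" "K \<subseteq> A" "card K = rank_of M A"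
        using rank_witness[OF M] by blast
      obtain x where x: "x \<in> K - J" "insert x J \<in> indeps M"
        using matroid_exchange[OF M K(1) less.prems(1)] lt K(3) by auto
      have "card (insert x J) = Suc (card J)"
        using x matroid_finite[OF M less.prems(1)] by simp
      then have "rank_of M A - card (insert x J) < rank_of M A - card J" using lt by simp
      from less.hyps[OF this x(2)] x(1) K(2) less.prems(2) show ?thesis by auto
    qed (use less.prems in blast)
  qed
  then show ?thesis using that by blast
qed

lemma rank_mono: "matroid M \<Longrightarrow> A \<subseteq> B \<Longrightarrow> rank_of M A \<le> rank_of M B"
  by (metis rank_ge rank_witness order_trans)

lemma rank_le_card: "matroid M \<Longrightarrow> finite A \<Longrightarrow> rank_of M A \<le> card A"
  by (metis rank_witness card_mono)

lemma indep_rank: "matroid M \<Longrightarrow> I \<in> indeps M \<Longrightarrow> rank_of M I = card I"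
  by (simp add: matroid_finite rank_ge rank_le_card order_antisym)

lemma indep_iff_rank:
  assumes "matroid M" "finite I"
  shows "I \<in> indeps M \<longleftrightarrow> rank_of M I = card I"
  using assms indep_rank rank_witness[OF assms(1), of I] card_subset_eq[OF assms(2)] by metis

lemma rank_submodular:
  assumes M: "matroid M"
  shows "rank_of M (A \<union> B) + rank_of M (A \<inter> B) \<le> rank_of M A + rank_of M B"
proof -
  obtain K where K: "K \<in> indeps M" "K \<subseteq> A \<inter> B" "card K = rank_of M (A \<inter> B)"
    using rank_witness[OF M] by blast
  obtain I where I: "I \<in> indeps M" "K \<subseteq> I" "I \<subseteq> A \<union> B" "card I = rank_of M (A \<union> B)"
    using indep_extend[OF M K(1), of "A \<union> B"] K(2) by blast
  have fin: "finite I" using I(1) matroid_finite[OF M] by blast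
  have "card I + card K \<le> card ((I \<inter> A) \<union> (I \<inter> B)) + card ((I \<inter> A) \<inter> (I \<inter> B))"
    using I K fin by (intro add_mono card_mono) auto
  also have "\<dots> = card (I \<inter> A) + card (I \<inter> B)"
    using card_Un_Int[of "I \<inter> A" "I \<inter> B"] fin by simp
  also have "\<dots> \<le> rank_of M A + rank_of M B"
    by (intro add_mono rank_ge[OF M] matroid_subset[OF M I(1)]) auto
  finally show ?thesis using I K by simp
qed

lemma rank_Un_le:
  assumes M: "matroid M" and fin: "finite J"
  shows "rank_of M (A \<union> J) \<le> rank_of M A + card (J - A)"
  using rank_submodular[OF M, of A "J - A"] rank_le_card[OF M, of "J - A"] fin by simp

lemma spanned_mono:
  assumes M: "matroid M" and "spanned M e A" "A \<subseteq> B"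
  shows "spanned M e B"
proof (cases "e \<in> B")
  case True
  then show ?thesis unfolding spanned_def by (simp add: insert_absorb)
next
  case False
  have "insert e A \<union> B = insert e B" "insert e A \<inter> B = A" using assms False by auto
  then have "rank_of M (insert e B) \<le> rank_of M B"
    using rank_submodular[OF M, of "insert e A" B] assms(2) unfolding spanned_def by simp
  then show ?thesis unfolding spanned_def using rank_mono[OF M, of B "insert e B"] by (simp add: subset_insertI)
qed

lemma rank_spanned_Un:
  assumes M: "matroid M" and "finite C" "\<And>e. e \<in> C \<Longrightarrow> spanned M e A"
  shows "rank_of M (A \<union> C) = rank_of M A"
  using assms(2,3)
proof (induction C rule: finite_induct)
  case (insert c C)
  then have "spanned M c (A \<union> C)" using spanned_mono[OF M, of c A] by blast
  then show ?case using insert unfolding spanned_def by simp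
qed simp

lemma spanned_trans:
  assumes M: "matroid M" and "finite C" "\<And>e. e \<in> C \<Longrightarrow> spanned M e A" "spanned M x (A \<union> C)"
  shows "spanned M x A"
proof -
  have "rank_of M (insert x A) \<le> rank_of M (insert x (A \<union> C))"
    by (rule rank_mono[OF M]) auto
  also have "\<dots> = rank_of M A"
    using rank_spanned_Un[OF M assms(2,3)] assms(4) unfolding spanned_def by simp
  finally show ?thesis
    using rank_mono[OF M, of A "insert x A"] unfolding spanned_def by (simp add: order_antisym subset_insertI)
qed

lemma indep_not_spanned:
  assumes M: "matroid M" and I: "I \<in> indeps M" "i \<in> I" "J \<subseteq> I - {i}"
  shows "\<not> spanned M i J"
proof -
  have "insert i J \<in> indeps M" "J \<in> indeps M" using I by (auto intro: matroid_subset[OF M I(1)])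
  moreover have "card (insert i J) = Suc (card J)"
    using I(3) matroid_finite[OF M \<open>J \<in> indeps M\<close>] by (intro card_insert_disjoint) auto
  ultimately show ?thesis using indep_rank[OF M] unfolding spanned_def by auto
qed

lemma indep_insert:
  assumes M: "matroid M" and I: "I \<in> indeps M" "\<not> spanned M e I"
  shows "insert e I \<in> indeps M"
proof -
  have fin: "finite I" using matroid_finite[OF M I(1)] .
  have "e \<notin> I" using I(2) unfolding spanned_def by (auto simp: insert_absorb)
  then have c: "card (insert e I) = Suc (card I)" using fin by simp
  have "rank_of M (insert e I) > card I"
    using I indep_rank[OF M I(1)] rank_mono[OF M subset_insertI[of I e]] unfolding spanned_def by simp
  then have "rank_of M (insert e I) = card (insert e I)"
    using rank_le_card[OF M, of "insert e I"] fin c by simp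
  then show ?thesis using indep_iff_rank[OF M] fin by simp
qed

text \<open>Rank is cardinality on subsets of \<open>I\<close>, hence modular there, and
  submodularity of \<open>insert e J\<close> and \<open>insert e K\<close> leaves no rank for
  \<open>e\<close> to add to \<open>J \<inter> K\<close>. Without a common independent set this
  fails: two parallel elements each span a third parallel one, but the empty intersection does
  not.\<close>

lemma spanned_Int:
  assumes M: "matroid M" and I: "I \<in> indeps M" "J \<subseteq> I" "K \<subseteq> I"
    and e: "spanned M e J" "spanned M e K"
  shows "spanned M e (J \<inter> K)"
proof (cases "e \<in> J \<union> K")
  case True
  then have "e \<in> J \<inter> K"
    using e indep_not_spanned[OF M I(1), of e] I(2,3) by blast
  then show ?thesis unfolding spanned_def by (simp add: insert_absorb)
next
  case False
  have ind: "J \<in> indeps M" "K \<in> indeps M" "J \<union> K \<in> indeps M" "J \<inter> K \<in> indeps M"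
    using I by (auto intro: matroid_subset[OF M I(1)])
  have "finite J" "finite K" using ind matroid_finite[OF M] by auto
  then have "card J + card K = card (J \<union> K) + card (J \<inter> K)" by (rule card_Un_Int)
  moreover have "rank_of M (insert e J \<union> insert e K) + rank_of M (insert e J \<inter> insert e K)
      \<le> rank_of M (insert e J) + rank_of M (insert e K)"
    by (rule rank_submodular[OF M])
  moreover have "insert e J \<inter> insert e K = insert e (J \<inter> K)" by auto
  moreover have "rank_of M (J \<union> K) \<le> rank_of M (insert e J \<union> insert e K)"
    by (rule rank_mono[OF M]) auto
  ultimately have "rank_of M (insert e (J \<inter> K)) \<le> card (J \<inter> K)"
    using e indep_rank[OF M] ind unfolding spanned_def by simp
  then show ?thesis
    using rank_mono[OF M subset_insertI[of "J \<inter> K" e]] indep_rank[OF M ind(4)]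
    unfolding spanned_def by simp
qed

text \<open>The fundamental circuit of \<open>e\<close> in \<open>insert e I\<close>, without
  \<open>e\<close> itself, when \<open>I\<close> is independent and spans
  \<open>e \<notin> I\<close>.\<close>

definition circuit_part :: "'a indep_structure \<Rightarrow> 'a set \<Rightarrow> 'a \<Rightarrow> 'a set" where
  "circuit_part M I e = {i \<in> I. \<not> spanned M e (I - {i})}"

text \<open>By \<open>spanned_Int\<close> the subsets of \<open>I\<close> spanning \<open>e\<close>
  are closed under intersection. Each element outside the circuit may be removed alone, hence all of
  \<open>I - J\<close> together. Closure conditions thereby become containments, and later
  inequalities between coordinates.\<close>

lemma spanned_iff_circuit:
  assumes M: "matroid M" and I: "I \<in> indeps M" "J \<subseteq> I" and e: "spanned M e I"
  shows "spanned M e J \<longleftrightarrow> circuit_part M I e \<subseteq> J"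
proof
  assume J: "spanned M e J"
  show "circuit_part M I e \<subseteq> J"
    unfolding circuit_part_def using spanned_mono[OF M J, of "I - {_}"] I(2) by blast
next
  assume C: "circuit_part M I e \<subseteq> J"
  have fin: "finite (I - J)" using matroid_finite[OF M I(1)] by simp
  have "spanned M e (I - K)" if "finite K" "K \<subseteq> I - J" for K
    using that
  proof (induction K rule: finite_induct)
    case (insert k K)
    then have "spanned M e (I - {k})" using C unfolding circuit_part_def by blast
    then have "spanned M e ((I - {k}) \<inter> (I - K))"
      using insert by (intro spanned_Int[OF M I(1)]) auto
    also have "(I - {k}) \<inter> (I - K) = I - insert k K" by auto
    finally show ?case .
  qed (use e in simp)
  from this[OF fin] have "spanned M e (I - (I - J))" by simp
  also have "I - (I - J) = J" using I(2) by auto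
  finally show "spanned M e J" .
qed

text \<open>Induction on the number of elements strictly above \<open>a\<close>: those in
  \<open>A\<close> are themselves spanned by elements outside \<open>A\<close> still higher up, and
  closure is transitive.\<close>

lemma spanned_above_greedy:
  fixes y :: "'a \<Rightarrow> real"
  assumes M: "matroid M" and fin: "finite W"
  shows "(\<forall>a\<in>A. spanned M a {j \<in> W. y a < y j}) \<longleftrightarrow> (\<forall>a\<in>A. spanned M a {j \<in> W - A. y a < y j})"
proof
  assume "\<forall>a\<in>A. spanned M a {j \<in> W - A. y a < y j}"
  then show "\<forall>a\<in>A. spanned M a {j \<in> W. y a < y j}"
    using spanned_mono[OF M, of _ "{j \<in> W - A. y _ < y j}" "{j \<in> W. y _ < y j}"] by blast
next
  assume H: "\<forall>a\<in>A. spanned M a {j \<in> W. y a < y j}"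
  have "spanned M a {j \<in> W - A. y a < y j}" if "a \<in> A" for a
    using that
  proof (induction "card {j \<in> W. y a < y j}" arbitrary: a rule: less_induct)
    case less
    let ?C = "{b \<in> W \<inter> A. y a < y b}"
    show ?case
    proof (rule spanned_trans[OF M])
      show "finite ?C" using fin by simp
      show "spanned M b {j \<in> W - A. y a < y j}" if b: "b \<in> ?C" for b
      proof -
        have "card {j \<in> W. y b < y j} < card {j \<in> W. y a < y j}"
          using fin b by (intro psubset_card_mono) auto
        then have "spanned M b {j \<in> W - A. y b < y j}" using less.hyps b by blast
        then show ?thesis by (rule spanned_mono[OF M]) (use b in auto)
      qed
      have "{j \<in> W - A. y a < y j} \<union> ?C = {j \<in> W. y a < y j}" by auto
      then show "spanned M a ({j \<in> W - A. y a < y j} \<union> ?C)" using H less.prems by simp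
    qed
  qed
  then show "\<forall>a\<in>A. spanned M a {j \<in> W - A. y a < y j}" by blast
qed

section \<open>Greedy bases and the expansion over all subsets\<close>

definition greedy_pair :: "'a indep_structure \<Rightarrow> ('a \<Rightarrow> real) \<Rightarrow> 'a set \<Rightarrow> 'a set \<Rightarrow> bool" where
  "greedy_pair M w I A \<longleftrightarrow> I \<in> indeps M \<and> (\<forall>a\<in>A. spanned M a {i \<in> I. w a < w i})"

lemma greedy_pair_disjoint:
  assumes M: "matroid M" and g: "greedy_pair M w I A"
  shows "I \<inter> A = {}"
proof -
  have False if "a \<in> I" "a \<in> A" for a
    using indep_not_spanned[OF M _ that(1), of "{i \<in> I. w a < w i}"] g that
    unfolding greedy_pair_def by auto
  then show ?thesis by blast
qed

lemma greedy_pair_rank: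
  assumes M: "matroid M" and fin: "finite A" and g: "greedy_pair M w I A"
  shows "rank_of M (I \<union> A) = card I"
proof -
  have "spanned M a I" if "a \<in> A" for a
    using g that spanned_mono[OF M, of a "{i \<in> I. w a < w i}" I] unfolding greedy_pair_def by blast
  then show ?thesis
    using rank_spanned_Un[OF M fin] indep_rank[OF M] g unfolding greedy_pair_def by metis
qed

text \<open>The inverse runs the greedy algorithm on \<open>B\<close> in decreasing order of
  \<open>w\<close>: \<open>i\<close> is kept unless the elements of \<open>B\<close> with larger
  \<open>w\<close> span it. Distinct weights are needed for the kept set to be independent: of two
  parallel elements with equal weight both could be kept.\<close>

lemma greedy_pair_bij:
  fixes w :: "'a::finite \<Rightarrow> real"
  assumes M: "matroid M" and inj: "inj w"
  shows "bij_betw (\<lambda>(I, A). I \<union> A) {(I, A). greedy_pair M w I A} UNIV"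
proof (rule bij_betw_byWitness[where f' = "\<lambda>B. let I = {i \<in> B. \<not> spanned M i {j \<in> B. w i < w j}} in (I, B - I)"])
  have inv: "{i \<in> I \<union> A. \<not> spanned M i {j \<in> I \<union> A. w i < w j}} = I" if g: "greedy_pair M w I A" for I A
  proof -
    have "spanned M a {j \<in> I \<union> A. w a < w j}" if "a \<in> A" for a
      using g that spanned_mono[OF M, of a "{i \<in> I. w a < w i}" "{j \<in> I \<union> A. w a < w j}"]
      unfolding greedy_pair_def by auto
    moreover have "\<not> spanned M i {j \<in> I \<union> A. w i < w j}" if i: "i \<in> I" for i
    proof
      assume s: "spanned M i {j \<in> I \<union> A. w i < w j}"
      have "spanned M i {j \<in> I. w i < w j}"
      proof (rule spanned_trans[OF M])
        show "finite {a \<in> A. w i < w a}" by simp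
        show "spanned M a {j \<in> I. w i < w j}" if "a \<in> {a \<in> A. w i < w a}" for a
        proof (rule spanned_mono[OF M])
          show "spanned M a {j \<in> I. w a < w j}" using g that unfolding greedy_pair_def by blast
          show "{j \<in> I. w a < w j} \<subseteq> {j \<in> I. w i < w j}" using that by auto
        qed
        have "{j \<in> I. w i < w j} \<union> {a \<in> A. w i < w a} = {j \<in> I \<union> A. w i < w j}" by auto
        then show "spanned M i ({j \<in> I. w i < w j} \<union> {a \<in> A. w i < w a})" using s by simp
      qed
      then show False
        using indep_not_spanned[OF M _ i, of "{j \<in> I. w i < w j}"] g unfolding greedy_pair_def by auto
    qed
    ultimately show ?thesis by blast
  qed
  show "\<forall>p\<in>{(I, A). greedy_pair M w I A}.
      (let I = {i \<in> (case p of (I, A) \<Rightarrow> I \<union> A). \<not> spanned M i {j \<in> (case p of (I, A) \<Rightarrow> I \<union> A). w i < w j}}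
       in (I, (case p of (I, A) \<Rightarrow> I \<union> A) - I)) = p"
  proof
    fix p assume "p \<in> {(I, A). greedy_pair M w I A}"
    then obtain I A where p: "p = (I, A)" and gp: "greedy_pair M w I A" by blast
    have "I \<union> A - I = A" using greedy_pair_disjoint[OF M gp] by blast
    then show "(let I = {i \<in> (case p of (I, A) \<Rightarrow> I \<union> A). \<not> spanned M i {j \<in> (case p of (I, A) \<Rightarrow> I \<union> A). w i < w j}}
       in (I, (case p of (I, A) \<Rightarrow> I \<union> A) - I)) = p"
      unfolding p prod.case inv[OF gp] Let_def by simp
  qed
  have "greedy_pair M w {i \<in> B. \<not> spanned M i {j \<in> B. w i < w j}}
      (B - {i \<in> B. \<not> spanned M i {j \<in> B. w i < w j}})" for B
  proof -
    define I where "I = {i \<in> B. \<not> spanned M i {j \<in> B. w i < w j}}"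
    have "\<forall>a\<in>B - I. spanned M a {j \<in> B. w a < w j}" unfolding I_def by blast
    then have "\<forall>a\<in>B - I. spanned M a {j \<in> B - (B - I). w a < w j}"
      by (subst (asm) spanned_above_greedy[OF M]) simp_all
    moreover have "B - (B - I) = I" unfolding I_def by auto
    ultimately have sp: "\<forall>a\<in>B - I. spanned M a {j \<in> I. w a < w j}" by simp
    \<comment> \<open>Independence is built up in decreasing order of \<open>w\<close>, through the
      superlevel sets of \<open>I\<close>; a threshold below all weights finally gives
      \<open>I\<close> itself.\<close>
    have "{j \<in> I. t < w j} \<in> indeps M" for t
    proof (induction "card {j \<in> I. t < w j}" arbitrary: t)
      case 0
      then have "{j \<in> I. t < w j} = {}" by simp
      then show ?case using matroid_empty[OF M] by (simp only:)
    next
      case (Suc n)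
      let ?J = "{j \<in> I. t < w j}"
      have ne: "?J \<noteq> {}" using Suc.hyps(2) by (metis card.empty nat.distinct(1))
      \<comment> \<open>The lightest element of \<open>?J\<close>. By injectivity of
        \<open>w\<close> the others are exactly those above it, and they do not span it.\<close>
      define i where "i = arg_min_on w ?J"
      have i: "i \<in> ?J" "\<And>j. j \<in> ?J \<Longrightarrow> w i \<le> w j"
        using arg_min_if_finite[of ?J w] ne unfolding i_def by (auto simp: not_less)
      have J: "?J = insert i {j \<in> I. w i < w j}"
      proof -
        have "w i < w j \<or> j = i" if "j \<in> ?J" for j
          using i(2)[OF that] inj unfolding inj_on_def by (metis UNIV_I order_less_le)
        then show ?thesis using i(1) by auto
      qed
      have "card ?J = Suc (card {j \<in> I. w i < w j})"
        unfolding J by (rule card_insert_disjoint) auto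
      then have "{j \<in> I. w i < w j} \<in> indeps M" using Suc.hyps by simp
      moreover have "\<not> spanned M i {j \<in> I. w i < w j}"
      proof -
        have "\<not> spanned M i {j \<in> B. w i < w j}" using i(1) unfolding I_def by blast
        then show ?thesis using spanned_mono[OF M, of i "{j \<in> I. w i < w j}" "{j \<in> B. w i < w j}"]
          unfolding I_def by blast
      qed
      ultimately show ?case unfolding J by (rule indep_insert[OF M])
    qed
    from this[of "Min (range w) - 1"] have "I \<in> indeps M"
    proof -
      have "Min (range w) \<le> w j" for j by simp
      then have "Min (range w) - 1 < w j" for j by (smt (verit))
      then have "{j \<in> I. Min (range w) - 1 < w j} = I" by blast
      then show ?thesis using \<open>{j \<in> I. Min (range w) - 1 < w j} \<in> indeps M\<close> by simp
    qed
    then show ?thesis using sp unfolding greedy_pair_def I_def[symmetric] by blast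
  qed
  then show "(\<lambda>B. let I = {i \<in> B. \<not> spanned M i {j \<in> B. w i < w j}} in (I, B - I)) ` UNIV
      \<subseteq> {(I, A). greedy_pair M w I A}"
    by (auto simp: Let_def)
qed (auto simp: Let_def)

lemma sum_rank_greedy:
  fixes w :: "'a::finite \<Rightarrow> real" and u v :: "'k::comm_ring_1"
  assumes M: "matroid M" and inj: "inj w"
  shows "(\<Sum>B\<in>UNIV. u ^ rank_of M B * v ^ (card B - rank_of M B)) =
    (\<Sum>(I, A)\<in>{(I, A). greedy_pair M w I A}. u ^ card I * v ^ card A)"
proof -
  have "(\<Sum>(I, A)\<in>{(I, A). greedy_pair M w I A}. u ^ card I * v ^ card A) =
    (\<Sum>p\<in>{(I, A). greedy_pair M w I A}. (\<lambda>B. u ^ rank_of M B * v ^ (card B - rank_of M B)) ((\<lambda>(I, A). I \<union> A) p))"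
  proof (rule sum.cong[OF refl])
    fix p assume "p \<in> {(I, A). greedy_pair M w I A}"
    then obtain I A where p: "p = (I, A)" and g: "greedy_pair M w I A" by blast
    have "card (I \<union> A) = card I + card A"
      using greedy_pair_disjoint[OF M g] by (intro card_Un_disjoint) auto
    then show "(case p of (I, A) \<Rightarrow> u ^ card I * v ^ card A) =
      u ^ rank_of M (case p of (I, A) \<Rightarrow> I \<union> A) *
        v ^ (card (case p of (I, A) \<Rightarrow> I \<union> A) - rank_of M (case p of (I, A) \<Rightarrow> I \<union> A))"
      unfolding p using greedy_pair_rank[OF M _ g] by simp
  qed
  also have "\<dots> = (\<Sum>B\<in>UNIV. u ^ rank_of M B * v ^ (card B - rank_of M B))"
    by (rule sum.reindex_bij_betw[OF greedy_pair_bij[OF M inj]])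
  finally show ?thesis ..
qed

lemma tutte_rank_sum:
  fixes u v :: "'k::field"
  assumes M: "matroid M" and r: "matroid_rank M = r" and u: "u \<noteq> 0" and g: "ground M = UNIV"
  shows "u ^ r * tutte M (1 + 1 / u) (1 + v) =
    (\<Sum>B\<in>UNIV. u ^ rank_of M B * v ^ (card B - rank_of M B))"
proof -
  have "u ^ r * ((1 / u) ^ (r - rank_of M B)) = u ^ rank_of M B" for B
  proof -
    have le: "rank_of M B \<le> r" using rank_mono[OF M, of B UNIV] r g by simp
    then have "u ^ r = u ^ rank_of M B * u ^ (r - rank_of M B)"
      by (simp flip: power_add)
    then show ?thesis using u by (simp add: power_divide)
  qed
  then show ?thesis
    unfolding tutte_def r sum_distrib_left using g by (simp add: mult.assoc[symmetric])
qed

section \<open>Minors along a chain\<close>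

text \<open>\<open>I - X\<close> is independent in the contraction by \<open>X\<close>. In this form
  different \<open>X\<close> can be compared by submodularity. It is independence of
  \<open>I\<close> for empty \<open>X\<close>, and void once \<open>X\<close> contains
  \<open>I\<close>.\<close>

definition indep_over :: "'a indep_structure \<Rightarrow> 'a set \<Rightarrow> 'a set \<Rightarrow> bool" where
  "indep_over M X I \<longleftrightarrow> rank_of M (X \<union> I) = rank_of M X + card (I - X)"

lemma indep_over_iff:
  assumes M: "matroid M" and "finite I"
  shows "indep_over M X I \<longleftrightarrow> rank_of M X + card (I - X) \<le> rank_of M (X \<union> I)"
  unfolding indep_over_def using rank_Un_le[OF assms, of X] by auto

text \<open>Passing from \<open>Y\<close> to \<open>X\<close> only removes elements outside
  \<open>I\<close>, so \<open>I - X\<close> and \<open>I - Y\<close> agree; by submodularity the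
  rank that \<open>I\<close> adds cannot drop.\<close>

lemma indep_over_antimono:
  assumes M: "matroid M" and fin: "finite I" and Y: "indep_over M Y I" "X \<subseteq> Y" "Y \<inter> I \<subseteq> X"
  shows "indep_over M X I"
proof -
  have eq: "(X \<union> I) \<union> Y = Y \<union> I" "(X \<union> I) \<inter> Y = X" "I - X = I - Y" using Y by auto
  have "rank_of M (Y \<union> I) + rank_of M X \<le> rank_of M (X \<union> I) + rank_of M Y"
    using rank_submodular[OF M, of "X \<union> I" Y] unfolding eq .
  then show ?thesis
    using Y(1) unfolding indep_over_iff[OF M fin] eq(3) by simp
qed

lemma bases_restriction:
  assumes M: "matroid M"
  shows "C \<in> bases (restriction M A) \<longleftrightarrow> C \<in> indeps M \<and> C \<subseteq> A \<and> card C = rank_of M A"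
proof
  assume C: "C \<in> bases (restriction M A)"
  then have ind: "C \<in> indeps M" "C \<subseteq> A" unfolding bases_def restriction_def by auto
  obtain I where "I \<in> indeps M" "C \<subseteq> I" "I \<subseteq> A" "card I = rank_of M A"
    using indep_extend[OF M ind] .
  then show "C \<in> indeps M \<and> C \<subseteq> A \<and> card C = rank_of M A"
    using C unfolding bases_def restriction_def by auto
next
  assume C: "C \<in> indeps M \<and> C \<subseteq> A \<and> card C = rank_of M A"
  have "I = C" if "I \<in> indeps M" "I \<subseteq> A" "C \<subseteq> I" for I
    using rank_ge[OF M that(1,2)] C that(3) matroid_finite[OF M that(1)] card_seteq[of I C] by auto
  then show "C \<in> bases (restriction M A)" using C unfolding bases_def restriction_def by auto
qed

abbreviation minor :: "'a indep_structure \<Rightarrow> 'a set \<Rightarrow> 'a set \<Rightarrow> 'a indep_structure" where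
  "minor M A B \<equiv> contraction (restriction M B) A"

text \<open>The contraction asks for some basis of \<open>A\<close>, and any basis \<open>C\<close>
  serves: a maximal independent subset of \<open>A \<union> J\<close> extending \<open>C\<close>
  meets \<open>A\<close> in \<open>C\<close> alone, so by counting it is
  \<open>J \<union> C\<close>. What remains is a condition on ranks.\<close>

lemma minor_indeps:
  fixes M :: "'a::finite indep_structure"
  assumes M: "matroid M" and g: "ground M = UNIV" and AB: "A \<subseteq> B"
  shows "J \<in> indeps (minor M A B) \<longleftrightarrow> J \<subseteq> B - A \<and> indep_over M A J"
proof -
  have rr: "restriction (restriction M B) A = restriction M A"
    using AB g unfolding restriction_def by auto
  have "J \<in> indeps (minor M A B) \<longleftrightarrow> J \<subseteq> B - A \<and>
      (\<exists>C. C \<in> indeps M \<and> C \<subseteq> A \<and> card C = rank_of M A \<and> J \<union> C \<in> indeps M \<and> J \<union> C \<subseteq> B)"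
    unfolding contraction_def indep_structure.simps rr Bex_def bases_restriction[OF M]
    unfolding restriction_def using g by auto
  also have "\<dots> \<longleftrightarrow> J \<subseteq> B - A \<and> indep_over M A J"
  proof (intro conj_cong refl iffI)
    assume J: "J \<subseteq> B - A"
      and "\<exists>C. C \<in> indeps M \<and> C \<subseteq> A \<and> card C = rank_of M A \<and> J \<union> C \<in> indeps M \<and> J \<union> C \<subseteq> B"
    then obtain C where C: "C \<subseteq> A" "card C = rank_of M A" "J \<union> C \<in> indeps M" by blast
    have "card (J \<union> C) \<le> rank_of M (A \<union> J)" by (rule rank_ge[OF M C(3)]) (use C in auto)
    moreover have "card (J \<union> C) = card J + card C" using J C by (intro card_Un_disjoint) auto
    moreover have "J - A = J" using J by auto
    ultimately show "indep_over M A J" using C(2) by (simp add: indep_over_iff[OF M])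
  next
    assume J: "J \<subseteq> B - A" and ov: "indep_over M A J"
    have JA: "J - A = J" using J by auto
    obtain C where C: "C \<in> indeps M" "C \<subseteq> A" "card C = rank_of M A" using rank_witness[OF M] by blast
    obtain I where I: "I \<in> indeps M" "C \<subseteq> I" "I \<subseteq> A \<union> J" "card I = rank_of M (A \<union> J)"
      using indep_extend[OF M C(1), of "A \<union> J"] C(2) by blast
    have "card (I \<inter> A) \<le> card C"
      unfolding C(3) by (rule rank_ge[OF M matroid_subset[OF M I(1)]]) auto
    then have CI: "C = I \<inter> A" using C I by (intro card_seteq) auto
    have "card I = card (I \<inter> A) + card (I - A)"
      by (subst card_Un_disjoint[symmetric]) (auto intro: arg_cong[of _ _ card])
    then have "card J \<le> card (I - A)"
      using I(4) ov C(3) CI JA unfolding indep_over_def by simp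
    then have "I - A = J" using I(3) by (intro card_seteq) auto
    then have "J \<union> C = I" using CI by auto
    then show "\<exists>C. C \<in> indeps M \<and> C \<subseteq> A \<and> card C = rank_of M A \<and> J \<union> C \<in> indeps M \<and> J \<union> C \<subseteq> B"
      using C I J AB by (intro exI[of _ C]) auto
  qed
  finally show ?thesis .
qed

lemma minor_loops:
  fixes M :: "'a::finite indep_structure"
  assumes M: "matroid M" and g: "ground M = UNIV" and AB: "A \<subseteq> B"
  shows "loops (minor M A B) = {e \<in> B - A. spanned M e A}"
proof -
  have "e \<in> loops (minor M A B) \<longleftrightarrow> e \<in> B - A \<and> spanned M e A" for e
  proof -
    have "ground (minor M A B) = B - A" using g by (simp add: contraction_def restriction_def)
    moreover have "indep_over M A {e} \<longleftrightarrow> \<not> spanned M e A" if "e \<notin> A"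
      using that insert_Diff_if[of e "{}" A] rank_Un_le[OF M, of "{e}" A] rank_mono[OF M subset_insertI[of A e]]
      unfolding indep_over_def spanned_def by auto
    ultimately show ?thesis unfolding loops_def using minor_indeps[OF M g AB, of "{e}"] by auto
  qed
  then show ?thesis by blast
qed

text \<open>Since \<open>K\<close> adds its full cardinality to the rank of \<open>F\<close>, by
  submodularity it does so to the smaller set \<open>A \<union> J\<close>; hence \<open>J\<close>
  alone decides.\<close>

lemma indep_over_chain_iff:
  fixes M :: "'a::finite indep_structure"
  assumes M: "matroid M" and AF: "A \<subseteq> F" "J \<subseteq> F - A" "K \<subseteq> - F" and ov: "indep_over M F K"
  shows "indep_over M A (J \<union> K) \<longleftrightarrow> indep_over M A J"
proof -
  have eq: "(J \<union> K) - A = J \<union> K" "J - A = J" "K - F = K" "K - (A \<union> J) = K"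
    "card (J \<union> K) = card J + card K"
    using AF by (auto intro!: card_Un_disjoint)
  show ?thesis
  proof
    assume "indep_over M A (J \<union> K)"
    moreover have "rank_of M (A \<union> (J \<union> K)) \<le> rank_of M (A \<union> J) + card K"
      using rank_Un_le[OF M, of K "A \<union> J"] eq by (simp add: Un_assoc)
    ultimately show "indep_over M A J" unfolding indep_over_iff[OF M finite] eq by simp
  next
    assume "indep_over M A J"
    moreover have "rank_of M (F \<union> K) + rank_of M (A \<union> J) \<le> rank_of M (A \<union> (J \<union> K)) + rank_of M F"
    proof -
      have "(A \<union> (J \<union> K)) \<union> F = F \<union> K" "(A \<union> (J \<union> K)) \<inter> F = A \<union> J" using AF by auto
      then show ?thesis using rank_submodular[OF M, of "A \<union> (J \<union> K)" F] by simp
    qed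
    ultimately show "indep_over M A (J \<union> K)"
      using ov unfolding indep_over_def eq using rank_Un_le[OF M, of "J \<union> K" A] eq by simp
  qed
qed

text \<open>Cutting \<open>I\<close> into \<open>I \<inter> F\<close> and \<open>I - F\<close> gives
  a bijection onto pairs for the first minor and for the rest of the chain, so the generating
  functions multiply. The chain starts at an arbitrary \<open>A\<close> for the sake of the
  induction.\<close>

lemma prod_indep_poly_chain:
  fixes M :: "'a::finite indep_structure" and u :: "'k::comm_ring_1"
  assumes M: "matroid M" and g: "ground M = UNIV" and "sorted_wrt (\<subset>) (A # Fs)"
  shows "(\<Prod>(A, B) \<leftarrow> zip (A # Fs) (Fs @ [UNIV]). indep_poly u (minor M A B)) =
    (\<Sum>I | I \<subseteq> - A \<and> (\<forall>X\<in>set (A # Fs). indep_over M X I). u ^ card I)"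
  using assms(3)
proof (induction Fs arbitrary: A)
  case Nil
  have "indeps (minor M A UNIV) = {I. I \<subseteq> - A \<and> (\<forall>X\<in>set [A]. indep_over M X I)}"
    using minor_indeps[OF M g, of A UNIV] by auto
  then show ?case by (simp add: indep_poly_def)
next
  case (Cons F Fs)
  let ?J = "{J. J \<subseteq> F - A \<and> indep_over M A J}"
  let ?K = "{K. K \<subseteq> - F \<and> (\<forall>X\<in>set (F # Fs). indep_over M X K)}"
  let ?I = "{I. I \<subseteq> - A \<and> (\<forall>X\<in>set (A # F # Fs). indep_over M X I)}"
  have AF: "A \<subset> F" and FX: "\<And>X. X \<in> set (F # Fs) \<Longrightarrow> F \<subseteq> X" using Cons.prems by auto
  \<comment> \<open>A subset of \<open>F\<close> lies in every later member \<open>X\<close> and is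
    invisible modulo \<open>X\<close>.\<close>
  have ov: "indep_over M X (J \<union> K) \<longleftrightarrow> indep_over M X K" if "J \<subseteq> F" "X \<in> set (F # Fs)" for J K X
  proof -
    have "J \<subseteq> X" using that FX by blast
    then have "X \<union> (J \<union> K) = X \<union> K" "J \<union> K - X = K - X" by auto
    then show ?thesis unfolding indep_over_def by simp
  qed
  have bij: "bij_betw (\<lambda>(J, K). J \<union> K) (?J \<times> ?K) ?I"
  proof (rule bij_betw_byWitness[where f' = "\<lambda>I. (I \<inter> F, I - F)"])
    show "(\<lambda>(J, K). J \<union> K) ` (?J \<times> ?K) \<subseteq> ?I"
    proof clarsimp
      fix J K assume J: "J \<subseteq> F - A" "indep_over M A J" and K: "K \<subseteq> - F" "indep_over M F K"
        "\<forall>X\<in>set Fs. indep_over M X K"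
      have "indep_over M A (J \<union> K)"
        using indep_over_chain_iff[OF M _ J(1) K(1,2)] J(2) AF by blast
      moreover have "J \<subseteq> F" using J by blast
      ultimately show "J \<subseteq> - A \<and> K \<subseteq> - A \<and> indep_over M A (J \<union> K) \<and> indep_over M F (J \<union> K) \<and>
          (\<forall>X\<in>set Fs. indep_over M X (J \<union> K))"
        using J K AF ov[of J F K] ov[of J _ K] by auto
    qed
    show "(\<lambda>I. (I \<inter> F, I - F)) ` ?I \<subseteq> ?J \<times> ?K"
    proof
      fix p assume "p \<in> (\<lambda>I. (I \<inter> F, I - F)) ` ?I"
      then obtain I where p: "p = (I \<inter> F, I - F)" and I: "I \<in> ?I" by blast
      have U: "(I \<inter> F) \<union> (I - F) = I" by auto
      have K: "I - F \<in> ?K" using I ov[of "I \<inter> F" _ "I - F"] unfolding U by auto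
      then have "indep_over M A ((I \<inter> F) \<union> (I - F)) \<longleftrightarrow> indep_over M A (I \<inter> F)"
        by (intro indep_over_chain_iff[OF M, where F = F]) (use I AF in auto)
      then have "indep_over M A (I \<inter> F)" using I unfolding U by simp
      moreover have "I \<inter> F \<subseteq> F - A" using I by blast
      ultimately show "p \<in> ?J \<times> ?K" using K unfolding p by simp
    qed
  qed auto
  have "indeps (minor M A F) = ?J" using minor_indeps[OF M g, of A F] AF by auto
  then have "(\<Prod>(A, B) \<leftarrow> zip (A # F # Fs) ((F # Fs) @ [UNIV]). indep_poly u (minor M A B)) =
      (\<Sum>J\<in>?J. u ^ card J) * (\<Sum>K\<in>?K. u ^ card K)"
    using Cons.IH[of F] Cons.prems by (simp add: indep_poly_def)
  also have "\<dots> = (\<Sum>(J, K)\<in>?J \<times> ?K. u ^ card (J \<union> K))"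
    unfolding sum_product sum.cartesian_product
  proof (rule sum.cong[OF refl])
    fix p assume "p \<in> ?J \<times> ?K"
    then obtain J K where p: "p = (J, K)" and "J \<subseteq> F" "K \<subseteq> - F" by auto
    then have "card (J \<union> K) = card J + card K" by (intro card_Un_disjoint) auto
    then show "(case p of (J, K) \<Rightarrow> u ^ card J * u ^ card K) = (case p of (J, K) \<Rightarrow> u ^ card (J \<union> K))"
      by (simp add: p power_add)
  qed
  also have "\<dots> = (\<Sum>I\<in>?I. u ^ card I)"
    using sum.reindex_bij_betw[OF bij, of "\<lambda>I. u ^ card I"] by (simp add: case_prod_beta)
  finally show ?case .
qed

text \<open>\<open>N\<close> agrees with being a loop on each step of the chain and stays fixed
  while \<open>A\<close> moves in the induction; it will be membership in
  \<open>flag_loops\<close>.\<close>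

lemma prod_loop_poly_chain:
  fixes M :: "'a::finite indep_structure" and v :: "'k::comm_ring_1"
  assumes M: "matroid M" and g: "ground M = UNIV" and "sorted_wrt (\<subset>) (A # Fs)"
    and "\<And>X Y e. (X, Y) \<in> set (zip (A # Fs) (Fs @ [UNIV])) \<Longrightarrow> e \<in> Y - X \<Longrightarrow> N e \<longleftrightarrow> spanned M e X"
  shows "(\<Prod>(A, B) \<leftarrow> zip (A # Fs) (Fs @ [UNIV]). loop_poly v (minor M A B)) =
    (1 + v) ^ card {e. e \<notin> A \<and> N e}"
  using assms(3,4)
proof (induction Fs arbitrary: A)
  case Nil
  have "loops (minor M A UNIV) = {e. e \<notin> A \<and> N e}"
    using minor_loops[OF M g, of A UNIV] Nil.prems(2)[of A UNIV] by auto
  then show ?case by (simp add: loop_poly_def)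
next
  case (Cons F Fs)
  have AF: "A \<subset> F" using Cons.prems by auto
  have l: "loops (minor M A F) = {e \<in> F - A. N e}"
    using minor_loops[OF M g, of A F] Cons.prems(2)[of A F] AF by auto
  have "(\<Prod>(A, B) \<leftarrow> zip (F # Fs) (Fs @ [UNIV]). loop_poly v (minor M A B)) =
    (1 + v) ^ card {e. e \<notin> F \<and> N e}"
    using Cons.prems by (intro Cons.IH) auto
  moreover have "card {e \<in> F - A. N e} + card {e. e \<notin> F \<and> N e} = card {e. e \<notin> A \<and> N e}"
    using AF by (subst card_Un_disjoint[symmetric]) (auto intro: arg_cong[of _ _ card])
  ultimately show ?case by (simp add: loop_poly_def l flip: power_add)
qed

lemma power_one_plus_card:
  fixes v :: "'k::comm_ring_1"
  assumes "finite Y"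
  shows "(1 + v) ^ card Y = (\<Sum>A\<in>Pow Y. v ^ card A)"
proof -
  have "(1 + v) ^ card Y = (\<Prod>i\<in>Y. v + 1)" by (simp add: add.commute)
  also have "\<dots> = (\<Sum>A\<in>Pow Y. (\<Prod>i\<in>A. v) * (\<Prod>i\<in>Y - A. 1))" by (rule prod_add[OF assms])
  finally show ?thesis by simp
qed

section \<open>The Euler integral of a pair of sets\<close>

text \<open>The points \<open>x\<close> for which \<open>I\<close> is independent in the initial matroid of \<open>M|W\<close> at \<open>x\<close> and
  \<open>A\<close> consists of loops of its initial matroid at \<open>x + w\<close>.\<close>

definition tight_set :: "'a indep_structure \<Rightarrow> ('a \<Rightarrow> real) \<Rightarrow> 'a set \<Rightarrow> 'a set \<Rightarrow> 'a set \<Rightarrow> ('a \<Rightarrow> real) set"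
  where "tight_set M w I A W = {x. (\<forall>\<tau>. indep_over M {j \<in> W. \<tau> < x j} I) \<and>
     (\<forall>a\<in>A. spanned M a {j \<in> W. x a + w a < x j + w j})}"

text \<open>Moving from \<open>p\<close> down to \<open>q\<close> changes no strict comparison with
  the finitely many thresholds in \<open>C\<close>. This yields the sets without least element
  required by \<open>euler_int_down_up\<close>.\<close>

lemma smaller_between:
  fixes p :: real
  assumes "finite C"
  shows "\<exists>q<p. \<forall>c\<in>C. c < p \<longrightarrow> c < q"
proof -
  have "Max (insert (p - 1) {c \<in> C. c < p}) < p"
    using assms by (subst Max_less_iff) auto
  then obtain q where q: "Max (insert (p - 1) {c \<in> C. c < p}) < q" "q < p" using dense by blast
  have "c < q" if "c \<in> C" "c < p" for c
    using q(1) that assms by (subst (asm) Max_less_iff) auto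
  then show ?thesis using q(2) by blast
qed

text \<open>Raising \<open>x e\<close> only lets \<open>e\<close> enter superlevel sets. As
  \<open>e\<close> lies outside \<open>I\<close> and \<open>A\<close>, independence can only be lost
  and spanning only gained: the fibre is a down-set closed above met with an up-set open below. Its
  integral is the truth value near minus infinity, where \<open>e\<close> no longer influences
  either condition.\<close>

lemma euler_int_tight_set:
  fixes M :: "'a::finite indep_structure"
  assumes M: "matroid M" and e: "e \<notin> I" "e \<notin> A" and I: "I \<subseteq> W"
  shows "euler_int (\<lambda>t. of_bool (x(e := t) \<in> tight_set M w I A W)) =
    of_bool (x \<in> tight_set M w I A (W - {e}))"
proof -
  define X where "X = (\<lambda>t \<tau>. {j \<in> W. \<tau> < (x(e := t)) j})"
  define Y where "Y = (\<lambda>t a. {j \<in> W. x a + w a < (x(e := t)) j + w j})"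
  define D where "D = {t. \<forall>\<tau>. indep_over M (X t \<tau>) I}"
  define U where "U = {t. \<forall>a\<in>A. spanned M a (Y t a)}"
  have mem: "x(e := t) \<in> tight_set M w I A W \<longleftrightarrow> t \<in> D \<inter> U" for t
  proof -
    have "(x(e := t)) a = x a" if "a \<in> A" for a using that e by auto
    then show ?thesis unfolding tight_set_def D_def U_def X_def Y_def by simp
  qed
  show ?thesis
    unfolding mem
  proof (rule euler_int_down_up)
    fix p q assume "p \<in> D" "q \<le> p"
    show "q \<in> D"
      unfolding D_def
    proof (intro CollectI allI)
      fix \<tau>
      show "indep_over M (X q \<tau>) I"
        by (rule indep_over_antimono[OF M finite, of "X p \<tau>"])
           (use \<open>p \<in> D\<close> \<open>q \<le> p\<close> e in \<open>auto simp: D_def X_def split: if_splits\<close>)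
    qed
  next
    fix p assume "p \<notin> D"
    then obtain \<tau> where \<tau>: "\<not> indep_over M (X p \<tau>) I" unfolding D_def by blast
    obtain q where q: "q < p" "\<tau> < p \<longrightarrow> \<tau> < q" using smaller_between[of "{\<tau>}" p] by auto
    then have "X q \<tau> = X p \<tau>" unfolding X_def by auto
    then have "q \<notin> D" using \<tau> unfolding D_def mem_Collect_eq by metis
    then show "\<exists>q<p. q \<notin> D" using q by blast
  next
    fix p q assume "p \<in> U" "p \<le> q"
    have "Y p a \<subseteq> Y q a" for a using \<open>p \<le> q\<close> unfolding Y_def by auto
    then show "q \<in> U" using \<open>p \<in> U\<close> spanned_mono[OF M] unfolding U_def by blast
  next
    fix p assume p: "p \<in> U"
    obtain q where q: "q < p" "\<forall>c\<in>(\<lambda>a. x a + w a - w e) ` A. c < p \<longrightarrow> c < q"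
      using smaller_between[of "(\<lambda>a. x a + w a - w e) ` A" p] by auto
    have "Y q a = Y p a" if "a \<in> A" for a
    proof -
      have "x a + w a - w e < p \<longleftrightarrow> x a + w a - w e < q" using q that by force
      then show ?thesis unfolding Y_def by auto
    qed
    then have "q \<in> U" using p unfolding U_def by auto
    then show "\<exists>q<p. q \<in> U" using q by blast
  next
    define m where "m = Min (range x)"
    define m' where "m' = Min (range (\<lambda>j. x j + w j))"
    have m: "m \<le> x j" "m' \<le> x j + w j" for j unfolding m_def m'_def by simp_all
    \<comment> \<open>Below these values \<open>e\<close> is the lowest coordinate both of
      \<open>x\<close> and of \<open>x + w\<close>.\<close>
    have ev: "\<forall>\<^sub>F t in at_bot. t < m \<and> t < m' - w e"
      by (intro eventually_conj eventually_gt_at_bot)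
    then show "\<forall>\<^sub>F t in at_bot. (t \<in> D \<inter> U) = (x \<in> tight_set M w I A (W - {e}))"
    proof eventually_elim
      case (elim t)
      have "t \<in> U \<longleftrightarrow> (\<forall>a\<in>A. spanned M a {j \<in> W - {e}. x a + w a < x j + w j})"
      proof -
        have "Y t a = {j \<in> W - {e}. x a + w a < x j + w j}" for a
          unfolding Y_def using elim m(2)[of a] by auto
        then show ?thesis unfolding U_def by simp
      qed
      moreover have "t \<in> D \<longleftrightarrow> (\<forall>\<tau>. indep_over M {j \<in> W - {e}. \<tau> < x j} I)"
      proof -
        have "indep_over M (X t \<tau>) I \<longleftrightarrow> indep_over M {j \<in> W - {e}. \<tau> < x j} I" for \<tau>
        proof (cases "\<tau> < t")
          case True
          \<comment> \<open>For thresholds below \<open>t\<close> the two superlevel sets may differ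
            by \<open>e\<close>, but both contain all of \<open>I\<close>, so both conditions are
            void.\<close>
          have "I \<subseteq> X t \<tau>" using True elim m(1) I unfolding X_def by (auto intro: less_le_trans order.strict_trans)
          moreover have "I \<subseteq> {j \<in> W - {e}. \<tau> < x j}"
            using True elim m(1) I e by (auto intro: less_le_trans order.strict_trans)
          ultimately show ?thesis unfolding indep_over_def by (simp add: Un_absorb2 Diff_eq_empty_iff[THEN iffD2])
        next
          case False
          then have "X t \<tau> = {j \<in> W - {e}. \<tau> < x j}" unfolding X_def by auto
          then show ?thesis by simp
        qed
        then show ?thesis unfolding D_def by simp
      qed
      ultimately show ?case unfolding tight_set_def by simp
    qed
  qed
qed

lemma iter_int_tight_set_delete:
  fixes M :: "'a::finite indep_structure"
  assumes M: "matroid M" and "set es \<inter> (I \<union> A) = {}" and "I \<subseteq> W"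
  shows "iter_int es (\<lambda>x. of_bool (x \<in> tight_set M w I A W)) =
    (\<lambda>x. of_bool (x \<in> tight_set M w I A (W - set es)))"
  using assms(2,3)
proof (induction es arbitrary: W)
  case (Cons e es)
  have "I \<subseteq> W - {e}" using Cons.prems by auto
  moreover have "W - {e} - set es = W - set (e # es)" by auto
  ultimately show ?case
    using Cons.IH[of "W - {e}"] Cons.prems by (simp add: euler_int_tight_set[OF M])
qed simp

lemma tight_set_nonempty:
  fixes M :: "'a::finite indep_structure"
  assumes M: "matroid M" and x: "x \<in> tight_set M w I A (I \<union> A)"
  shows "I \<in> indeps M" "I \<inter> A = {}" "\<forall>a\<in>A. spanned M a {i \<in> I. x a + w a < x i + w i}"
proof -
  \<comment> \<open>Above the largest coordinate the superlevel set is empty, and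
    \<open>indep_over\<close> becomes independence of \<open>I\<close>.\<close>
  have "x j \<le> Max (range x)" for j by simp
  then have e: "{j \<in> I \<union> A. Max (range x) < x j} = {}" by (auto simp: not_less)
  have "indep_over M {j \<in> I \<union> A. Max (range x) < x j} I" using x unfolding tight_set_def by blast
  then have "indep_over M {} I" by (simp only: e)
  moreover have "rank_of M {} = 0" using rank_le_card[OF M, of "{}"] by simp
  ultimately show I: "I \<in> indeps M" using indep_iff_rank[OF M] unfolding indep_over_def by simp
  have "\<forall>a\<in>A. spanned M a {j \<in> I \<union> A. x a + w a < x j + w j}" using x unfolding tight_set_def by blast
  then have s: "\<forall>a\<in>A. spanned M a {j \<in> I \<union> A - A. x a + w a < x j + w j}"
    using spanned_above_greedy[OF M, of "I \<union> A" A "\<lambda>j. x j + w j"] by simp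
  have "False" if a: "a \<in> I" "a \<in> A" for a
  proof -
    have "{j \<in> I \<union> A - A. x a + w a < x j + w j} \<subseteq> I - {a}" by auto
    then show False using s a indep_not_spanned[OF M I a(1)] by blast
  qed
  then show d: "I \<inter> A = {}" by blast
  have "I \<union> A - A = I" using d by auto
  then show "\<forall>a\<in>A. spanned M a {i \<in> I. x a + w a < x i + w i}" using s by simp
qed

text \<open>Under these hypotheses every spanning condition becomes a containment of
  \<open>circuit_part M I a\<close>. Independence over all superlevel sets of \<open>x\<close> gives
  the weak inequalities, being a loop at \<open>x + w\<close> the strict ones.\<close>

lemma tight_set_iff:
  fixes M :: "'a::finite indep_structure"
  assumes M: "matroid M" and I: "I \<in> indeps M" and d: "I \<inter> A = {}" and sp: "\<forall>a\<in>A. spanned M a I"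
  shows "x \<in> tight_set M w I A (I \<union> A) \<longleftrightarrow>
    (\<forall>(a, i)\<in>(SIGMA a : A. circuit_part M I a). x a \<le> x i \<and> x a + w a < x i + w i)"
proof -
  have Isub: "circuit_part M I a \<subseteq> I" for a unfolding circuit_part_def by auto
  have 1: "(\<forall>a\<in>A. spanned M a {j \<in> I \<union> A. x a + w a < x j + w j}) \<longleftrightarrow>
    (\<forall>a\<in>A. \<forall>i\<in>circuit_part M I a. x a + w a < x i + w i)"
  proof -
    have "I \<union> A - A = I" using d by auto
    then have "(\<forall>a\<in>A. spanned M a {j \<in> I \<union> A. x a + w a < x j + w j}) \<longleftrightarrow>
      (\<forall>a\<in>A. spanned M a {j \<in> I. x a + w a < x j + w j})"
      using spanned_above_greedy[OF M, of "I \<union> A" A "\<lambda>j. x j + w j"] by simp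
    also have "\<dots> \<longleftrightarrow> (\<forall>a\<in>A. circuit_part M I a \<subseteq> {j \<in> I. x a + w a < x j + w j})"
      using spanned_iff_circuit[OF M I] sp by auto
    finally show ?thesis using Isub by blast
  qed
  have 2: "(\<forall>\<tau>. indep_over M {j \<in> I \<union> A. \<tau> < x j} I) \<longleftrightarrow> (\<forall>a\<in>A. \<forall>i\<in>circuit_part M I a. x a \<le> x i)"
  proof -
    \<comment> \<open>\<open>?X \<union> I\<close> has rank \<open>card I\<close> because
      \<open>I\<close> spans \<open>A\<close>. So the condition says that the elements of
      \<open>A\<close> in the superlevel set add nothing to the rank of its elements in
      \<open>I\<close>.\<close>
    have "indep_over M {j \<in> I \<union> A. \<tau> < x j} I \<longleftrightarrow> (\<forall>a\<in>A. \<tau> < x a \<longrightarrow> spanned M a {i \<in> I. \<tau> < x i})"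
      (is "?l \<longleftrightarrow> ?r") for \<tau>
    proof -
      let ?X = "{j \<in> I \<union> A. \<tau> < x j}" and ?J = "{i \<in> I. \<tau> < x i}"
      have J: "?J \<in> indeps M" by (rule matroid_subset[OF M I]) auto
      have "rank_of M (?X \<union> I) = card I"
      proof -
        have "?X \<union> I = I \<union> {a \<in> A. \<tau> < x a}" by auto
        then show ?thesis
          using rank_spanned_Un[OF M, of "{a \<in> A. \<tau> < x a}" I] sp indep_rank[OF M I] by simp
      qed
      moreover have "card (I - ?X) + card ?J = card I"
        by (subst card_Un_disjoint[symmetric]) (auto intro: arg_cong[of _ _ card])
      ultimately have "?l \<longleftrightarrow> rank_of M ?X = rank_of M ?J"
        unfolding indep_over_def indep_rank[OF M J] by auto
      also have "\<dots> \<longleftrightarrow> ?r"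
      proof
        assume eq: "rank_of M ?X = rank_of M ?J"
        show ?r
        proof (intro ballI impI)
          fix a assume "a \<in> A" "\<tau> < x a"
          then have "insert a ?J \<subseteq> ?X" by auto
          then have "rank_of M (insert a ?J) \<le> rank_of M ?J" using rank_mono[OF M] eq by metis
          then show "spanned M a ?J"
            using rank_mono[OF M subset_insertI[of ?J a]] unfolding spanned_def by simp
        qed
      next
        assume ?r
        then have "rank_of M (?J \<union> {a \<in> A. \<tau> < x a}) = rank_of M ?J"
          by (intro rank_spanned_Un[OF M]) auto
        moreover have "?J \<union> {a \<in> A. \<tau> < x a} = ?X" by auto
        ultimately show "rank_of M ?X = rank_of M ?J" by simp
      qed
      finally show ?thesis .
    qed
    then have "(\<forall>\<tau>. indep_over M {j \<in> I \<union> A. \<tau> < x j} I) \<longleftrightarrow>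
      (\<forall>a\<in>A. \<forall>\<tau><x a. spanned M a {i \<in> I. \<tau> < x i})"
      by blast
    also have "\<dots> \<longleftrightarrow> (\<forall>a\<in>A. \<forall>\<tau><x a. circuit_part M I a \<subseteq> {i \<in> I. \<tau> < x i})"
    proof -
      have "spanned M a {i \<in> I. \<tau> < x i} \<longleftrightarrow> circuit_part M I a \<subseteq> {i \<in> I. \<tau> < x i}"
        if "a \<in> A" for a \<tau>
        by (rule spanned_iff_circuit[OF M I]) (use sp that in auto)
      then show ?thesis by blast
    qed
    also have "\<dots> \<longleftrightarrow> (\<forall>a\<in>A. \<forall>i\<in>circuit_part M I a. x a \<le> x i)"
    proof (intro iffI ballI)
      fix a i assume H: "\<forall>a\<in>A. \<forall>\<tau><x a. circuit_part M I a \<subseteq> {i \<in> I. \<tau> < x i}"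
        and ai: "a \<in> A" "i \<in> circuit_part M I a"
      show "x a \<le> x i"
      proof (rule ccontr)
        assume "\<not> x a \<le> x i"
        \<comment> \<open>The threshold \<open>\<tau> = x i\<close> is the one at which
          \<open>i\<close> itself drops out.\<close>
        then have "circuit_part M I a \<subseteq> {i' \<in> I. x i < x i'}" using H ai by auto
        then show False using ai by auto
      qed
    next
      fix a assume "\<forall>a\<in>A. \<forall>i\<in>circuit_part M I a. x a \<le> x i" "a \<in> A"
      then show "\<forall>\<tau><x a. circuit_part M I a \<subseteq> {i \<in> I. \<tau> < x i}" using Isub by fastforce
    qed
    finally show ?thesis .
  qed
  show ?thesis unfolding tight_set_def mem_Collect_eq 1 2 by auto
qed

text \<open>Coordinates are eliminated in increasing order of \<open>w\<close>: the fibre of a \<open>w\<close>-minimal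
  element of \<open>A\<close> is a closed ray, that of a \<open>w\<close>-minimal element of \<open>I\<close> an open one.\<close>

lemma iter_int_bipartite:
  fixes w :: "'a::finite \<Rightarrow> real"
  assumes "I \<inter> A = {}" "R \<subseteq> A \<times> I"
  shows "\<exists>es. distinct es \<and> set es = I \<union> A \<and>
    iter_int es (\<lambda>x. of_bool (\<forall>(a, i)\<in>R. x a \<le> x i \<and> x a + w a < x i + w i)) =
    (\<lambda>x. of_bool (\<forall>(a, i)\<in>R. w a < w i))"
  using assms
proof (induction "card (I \<union> A)" arbitrary: I A R)
  case 0
  then have "I \<union> A = {}" "R = {}" by auto
  then show ?case by (intro exI[of _ "[]"]) auto
next
  case (Suc n)
  let ?ok = "\<lambda>R x. \<forall>(a, i)\<in>R. x a \<le> x i \<and> x a + w a < x i + w i"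
  show ?case
  proof (cases "\<exists>i\<in>I. \<forall>v\<in>I \<union> A. w i \<le> w v")
    case True
    then obtain i where i: "i \<in> I" "\<forall>v\<in>I \<union> A. w i \<le> w v" by blast
    define R' where "R' = {(a, k) \<in> R. k \<noteq> i}"
    define L where "L = {a. (a, i) \<in> R}"
    have L: "L \<subseteq> A" using Suc.prems unfolding L_def by auto
    have n: "n = card ((I - {i}) \<union> A)"
    proof -
      have eq: "(I - {i}) \<union> A = (I \<union> A) - {i}" using Suc.prems i by auto
      have i': "i \<in> I \<union> A" using i(1) by blast
      show ?thesis unfolding eq card_Diff_singleton[OF i'] using Suc.hyps(2) by linarith
    qed
    have R': "R' \<subseteq> A \<times> (I - {i})" using Suc.prems unfolding R'_def by auto
    obtain es where es: "distinct es" "set es = (I - {i}) \<union> A"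
      "iter_int es (\<lambda>x. of_bool (?ok R' x)) = (\<lambda>x. of_bool (\<forall>(a, i)\<in>R'. w a < w i))"
      using Suc.hyps(1)[OF n _ R'] Suc.prems by blast
    \<comment> \<open>\<open>w i \<le> w a\<close> makes the strict inequality imply the weak one,
      so only the lower bounds \<open>x a + w a - w i\<close> on \<open>t\<close> remain.\<close>
    have fibre: "?ok R (x(i := t)) \<longleftrightarrow> ?ok R' x \<and> (\<forall>a\<in>L. x a + w a - w i < t)" for x t
    proof -
      have "?ok R (x(i := t)) \<longleftrightarrow> ?ok R' (x(i := t)) \<and> (\<forall>a\<in>L. (x(i := t)) a \<le> t \<and> (x(i := t)) a + w a < t + w i)"
        unfolding R'_def L_def by force
      moreover have "?ok R' (x(i := t)) \<longleftrightarrow> ?ok R' x"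
      proof (rule ball_cong[OF refl], clarify)
        fix a k assume "(a, k) \<in> R'"
        then have "a \<noteq> i" "k \<noteq> i" using R' i(1) Suc.prems(1) by auto
        then show "((x(i := t)) a \<le> (x(i := t)) k \<and> (x(i := t)) a + w a < (x(i := t)) k + w k) =
           (x a \<le> x k \<and> x a + w a < x k + w k)" by simp
      qed
      moreover have "(x(i := t)) a = x a" "w i \<le> w a" if "a \<in> L" for a
        using that L i Suc.prems(1) by auto
      ultimately show ?thesis by (force simp: algebra_simps)
    qed
    have "iter_int (i # es) (\<lambda>x. of_bool (?ok R x)) = (\<lambda>x. of_bool (\<forall>(a, i)\<in>R. w a < w i))"
    proof (cases "L = {}")
      case True
      then have "R' = R" unfolding R'_def L_def by auto
      then show ?thesis
        using es(3) True by (simp only: iter_int.simps fibre) (simp add: euler_int_const)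
    next
      case False
      have "of_bool (?ok R (x(i := t))) =
        of_bool (?ok R' x) * (of_bool (Max ((\<lambda>a. x a + w a - w i) ` L) < t) :: int)" for x t
        unfolding fibre using False ball_less_iff_Max(1)[of L] by auto
      then have "(\<lambda>x. euler_int (\<lambda>t. of_bool (?ok R (x(i := t))))) = (\<lambda>x. 0)"
        by (simp add: euler_int_cmult tame_greater euler_int_greater)
      then have "iter_int (i # es) (\<lambda>x. of_bool (?ok R x)) = (\<lambda>x. 0)"
        by (simp add: iter_zero)
      \<comment> \<open>A pair ending in the minimal \<open>i\<close> violates the condition on
        \<open>w\<close>, in agreement with the integral 0 of an open ray.\<close>
      moreover have "\<not> (\<forall>(a, i)\<in>R. w a < w i)"
      proof -
        obtain a where "(a, i) \<in> R" using False unfolding L_def by auto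
        moreover from this have "w i \<le> w a" using i(2) Suc.prems by auto
        ultimately show ?thesis by force
      qed
      ultimately show ?thesis by (simp only: of_bool_eq(1))
    qed
    moreover have "distinct (i # es)" "set (i # es) = I \<union> A" using es i Suc.prems by auto
    ultimately show ?thesis by blast
  next
    case False
    have "I \<union> A \<noteq> {}" using Suc.hyps(2) by (metis card.empty nat.distinct(1))
    then obtain e where e: "e \<in> I \<union> A" "\<forall>v\<in>I \<union> A. w e \<le> w v"
      using arg_min_if_finite[of "I \<union> A" w] finite[of "I \<union> A"] by (metis not_less)
    then have eA: "e \<in> A" "e \<notin> I" using False by auto
    \<comment> \<open>The minimum is not attained in \<open>I\<close>, so for the pairs of
      \<open>e\<close> the weak inequality implies the strict one: the fibre is a closed ray or the
      line, of integral 1, and on the right-hand side these pairs hold automatically.\<close>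
    have lt: "w e < w i" if "i \<in> I" for i
      using e False that by (metis UnI1 not_less order_trans)
    define R' where "R' = {(a, k) \<in> R. a \<noteq> e}"
    define U where "U = {k. (e, k) \<in> R}"
    have U: "U \<subseteq> I" using Suc.prems unfolding U_def by auto
    have n: "n = card (I \<union> (A - {e}))"
    proof -
      have eq: "I \<union> (A - {e}) = (I \<union> A) - {e}" using eA by auto
      show ?thesis unfolding eq card_Diff_singleton[OF e(1)] using Suc.hyps(2) by linarith
    qed
    have R': "R' \<subseteq> (A - {e}) \<times> I" using Suc.prems unfolding R'_def by auto
    obtain es where es: "distinct es" "set es = I \<union> (A - {e})"
      "iter_int es (\<lambda>x. of_bool (?ok R' x)) = (\<lambda>x. of_bool (\<forall>(a, i)\<in>R'. w a < w i))"
      using Suc.hyps(1)[OF n _ R'] Suc.prems by blast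
    have fibre: "?ok R (x(e := t)) \<longleftrightarrow> ?ok R' x \<and> (\<forall>k\<in>U. t \<le> x k)" for x t
    proof -
      have "?ok R (x(e := t)) \<longleftrightarrow> ?ok R' (x(e := t)) \<and> (\<forall>k\<in>U. t \<le> (x(e := t)) k \<and> t + w e < (x(e := t)) k + w k)"
        unfolding R'_def U_def by force
      moreover have "?ok R' (x(e := t)) \<longleftrightarrow> ?ok R' x"
      proof (rule ball_cong[OF refl], clarify)
        fix a k assume "(a, k) \<in> R'"
        then have "a \<noteq> e" "k \<noteq> e" using R' eA Suc.prems(1) by auto
        then show "((x(e := t)) a \<le> (x(e := t)) k \<and> (x(e := t)) a + w a < (x(e := t)) k + w k) =
           (x a \<le> x k \<and> x a + w a < x k + w k)" by simp
      qed
      moreover have "(x(e := t)) k = x k" "w e < w k" if "k \<in> U" for k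
        using that U eA lt by auto
      ultimately show ?thesis by force
    qed
    have E: "(\<lambda>x. euler_int (\<lambda>t. of_bool (?ok R (x(e := t))))) = (\<lambda>x. of_bool (?ok R' x))"
    proof (cases "U = {}")
      case True
      then show ?thesis unfolding fibre by (simp add: euler_int_const)
    next
      case False
      have "of_bool (?ok R (x(e := t))) =
        of_bool (?ok R' x) * (of_bool (t \<le> Min (x ` U)) :: int)" for x t
        unfolding fibre using False Min_ge_iff[of "x ` U" t] by auto
      then show ?thesis by (simp add: euler_int_cmult tame_less_eq euler_int_less_eq)
    qed
    have "(\<forall>(a, i)\<in>R. w a < w i) \<longleftrightarrow> (\<forall>(a, i)\<in>R'. w a < w i)"
      unfolding R'_def using lt Suc.prems(2) by fastforce
    then have "iter_int (e # es) (\<lambda>x. of_bool (?ok R x)) = (\<lambda>x. of_bool (\<forall>(a, i)\<in>R. w a < w i))"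
      using es(3) by (simp only: iter_int.simps E)
    moreover have "distinct (e # es)" "set (e # es) = I \<union> A" using es eA Suc.prems by auto
    ultimately show ?thesis by blast
  qed
qed

text \<open>The coordinates outside \<open>I \<union> A\<close> go first, then a list that depends
  on the pair. If \<open>I\<close> is dependent, meets \<open>A\<close> or fails to span it, the
  remaining tight set is empty and the pair is not greedy.\<close>

lemma iter_int_tight_set:
  fixes M :: "'a::finite indep_structure"
  assumes M: "matroid M"
  shows "\<exists>es. distinct es \<and> set es = UNIV \<and>
    iter_int es (\<lambda>x. of_bool (x \<in> tight_set M w I A UNIV)) = (\<lambda>x. of_bool (greedy_pair M w I A))"
proof -
  obtain ds where ds: "distinct ds" "set ds = - (I \<union> A)"
    using finite_distinct_list[of "- (I \<union> A)"] by auto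
  have dI: "set ds \<inter> (I \<union> A) = {}" "UNIV - set ds = I \<union> A" unfolding ds(2) by blast+
  have del: "iter_int ds (\<lambda>x. of_bool (x \<in> tight_set M w I A UNIV)) =
    (\<lambda>x. of_bool (x \<in> tight_set M w I A (I \<union> A)))"
    using iter_int_tight_set_delete[OF M dI(1) subset_UNIV] unfolding dI(2) .
  have "\<exists>es. distinct es \<and> set es = I \<union> A \<and>
    iter_int es (\<lambda>x. of_bool (x \<in> tight_set M w I A (I \<union> A))) = (\<lambda>x. of_bool (greedy_pair M w I A))"
  proof (cases "I \<in> indeps M \<and> I \<inter> A = {} \<and> (\<forall>a\<in>A. spanned M a I)")
    case True
    let ?R = "SIGMA a : A. circuit_part M I a"
    have g: "greedy_pair M w I A \<longleftrightarrow> (\<forall>(a, i)\<in>?R. w a < w i)"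
    proof -
      have "spanned M a {i \<in> I. w a < w i} \<longleftrightarrow> circuit_part M I a \<subseteq> {i \<in> I. w a < w i}"
        if "a \<in> A" for a
        by (rule spanned_iff_circuit[OF M]) (use True that in auto)
      then have "greedy_pair M w I A \<longleftrightarrow> (\<forall>a\<in>A. circuit_part M I a \<subseteq> {i \<in> I. w a < w i})"
        unfolding greedy_pair_def using True by blast
      also have "\<dots> \<longleftrightarrow> (\<forall>(a, i)\<in>?R. w a < w i)" unfolding circuit_part_def by auto
      finally show ?thesis .
    qed
    have t: "x \<in> tight_set M w I A (I \<union> A) \<longleftrightarrow> (\<forall>(a, i)\<in>?R. x a \<le> x i \<and> x a + w a < x i + w i)" for x
      by (rule tight_set_iff[OF M]) (use True in auto)
    have "?R \<subseteq> A \<times> I" unfolding circuit_part_def by auto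
    then show ?thesis
      unfolding g t using True by (intro iter_int_bipartite) auto
  next
    case False
    have "x \<notin> tight_set M w I A (I \<union> A)" for x
    proof
      assume x: "x \<in> tight_set M w I A (I \<union> A)"
      have "spanned M a I" if "a \<in> A" for a
        using tight_set_nonempty(3)[OF M x] that spanned_mono[OF M, of a "{i \<in> I. x a + w a < x i + w i}" I]
        by auto
      then show False using False tight_set_nonempty(1,2)[OF M x] by blast
    qed
    moreover have "\<not> greedy_pair M w I A"
    proof
      assume g: "greedy_pair M w I A"
      have "spanned M a I" if "a \<in> A" for a
        using g that spanned_mono[OF M, of a "{i \<in> I. w a < w i}" I] unfolding greedy_pair_def by auto
      then show False using False greedy_pair_disjoint[OF M g] g unfolding greedy_pair_def by blast
    qed
    moreover obtain es where "distinct es" "set es = I \<union> A"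
      using finite_distinct_list[of "I \<union> A"] by auto
    ultimately show ?thesis by (intro exI[of _ es]) (simp add: iter_zero)
  qed
  then obtain es where es: "distinct es" "set es = I \<union> A"
    "iter_int es (\<lambda>x. of_bool (x \<in> tight_set M w I A (I \<union> A))) = (\<lambda>x. of_bool (greedy_pair M w I A))"
    by blast
  show ?thesis
    by (rule exI[of _ "ds @ es"]) (use ds es del in \<open>auto simp: iter_append\<close>)
qed

section \<open>Flags and adapted vectors\<close>

lemma proj_NR_eq_iff: "proj_NR x = proj_NR y \<longleftrightarrow> (\<exists>c. \<forall>i. x $ i = y $ i + c)"
proof -
  have "x - y = c *\<^sub>R 1 \<longleftrightarrow> (\<forall>i. x $ i = y $ i + c)" for c
    by (auto simp: vec_eq_iff algebra_simps)
  then show ?thesis unfolding NR.abs_eq_iff diag_equiv_def by simp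
qed

lemma proj_NR_add: "proj_NR x + proj_NR y = proj_NR (x + y)"
  by (rule plus_NR.abs_eq)

lemma proj_NR_scaleR: "c *\<^sub>R proj_NR x = proj_NR (c *\<^sub>R x)"
  by (rule scaleR_NR.abs_eq)

lemma proj_NR_zero: "proj_NR 0 = 0"
  by (rule zero_NR.abs_eq[symmetric])

lemma proj_NR_diff: "proj_NR x - proj_NR y = proj_NR (x - y)"
  unfolding minus_NR_def uminus_NR.abs_eq plus_NR.abs_eq by simp

lemma proj_NR_sum: "(\<Sum>s\<in>S. proj_NR (f s)) = proj_NR (\<Sum>s\<in>S. f s)"
  by (induction S rule: infinite_finite_induct) (simp_all add: proj_NR_zero proj_NR_add)

lemma proj_NR_cases: obtains x where "z = proj_NR x"
  by (induction z) blast

lemma e_bar_eq: "e_bar S = proj_NR (\<chi> i. of_bool (i \<in> S))"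
proof -
  have "(\<Sum>i\<in>S. axis i (1::real)) = (\<chi> i. of_bool (i \<in> S))"
    by (auto simp: vec_eq_iff sum_component axis_def)
  then show ?thesis unfolding e_bar_def by simp
qed

text \<open>A flag is used through the total preorder in which \<open>i\<close> is below
  \<open>j\<close> if every member containing \<open>i\<close> contains \<open>j\<close>. For a
  chain, counting members encodes this preorder, with the highest level on the smallest
  member.\<close>

definition level :: "'a set list \<Rightarrow> 'a \<Rightarrow> nat" where
  "level Fs i = card {U \<in> set Fs. i \<in> U}"

text \<open>Describes cones by representatives in R^n: weakly adapted vectors represent the points
  of the cone, \<open>adapted\<close> ones those of its relative interior.\<close>

definition weakly_adapted :: "'a set list \<Rightarrow> ('a \<Rightarrow> real) \<Rightarrow> bool" where
  "weakly_adapted Fs x \<longleftrightarrow> (\<forall>i j. level Fs i \<le> level Fs j \<longrightarrow> x i \<le> x j)"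

definition adapted :: "'a set list \<Rightarrow> ('a \<Rightarrow> real) \<Rightarrow> bool" where
  "adapted Fs x \<longleftrightarrow> (\<forall>i j. x i < x j \<longleftrightarrow> level Fs i < level Fs j)"

lemma chain_total:
  assumes "sorted_wrt (\<subset>) Fs" "U \<in> set Fs" "V \<in> set Fs"
  shows "U \<subseteq> V \<or> V \<subseteq> U"
  using assms by (induction Fs) auto

lemma
  assumes "sorted_wrt (\<subset>) Fs"
  shows level_le_iff: "level Fs i \<le> level Fs j \<longleftrightarrow> (\<forall>U\<in>set Fs. i \<in> U \<longrightarrow> j \<in> U)"
    and level_less_iff: "level Fs i < level Fs j \<longleftrightarrow> (\<exists>U\<in>set Fs. j \<in> U \<and> i \<notin> U)"
proof -
  have 1: "level Fs i \<le> level Fs j" if "\<forall>U\<in>set Fs. i \<in> U \<longrightarrow> j \<in> U" for i j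
    unfolding level_def by (rule card_mono) (use that in auto)
  have 2: "level Fs i < level Fs j" if U: "U \<in> set Fs" "j \<in> U" "i \<notin> U" for i j U
    unfolding level_def
  proof (rule psubset_card_mono)
    have "j \<in> V" if "V \<in> set Fs" "i \<in> V" for V
      using chain_total[OF assms, of U V] U that by blast
    then show "{U \<in> set Fs. i \<in> U} \<subset> {U \<in> set Fs. j \<in> U}" using U by blast
  qed simp
  show "level Fs i \<le> level Fs j \<longleftrightarrow> (\<forall>U\<in>set Fs. i \<in> U \<longrightarrow> j \<in> U)"
    using 1[of i j] 2[of _ i j] by (meson not_less)
  show "level Fs i < level Fs j \<longleftrightarrow> (\<exists>U\<in>set Fs. j \<in> U \<and> i \<notin> U)"
    using 1[of j i] 2[of _ j i] by (meson not_less)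
qed

lemma flagsD:
  assumes "F \<in> flags"
  shows "sorted_wrt (\<subset>) F" "\<And>U. U \<in> set F \<Longrightarrow> U \<noteq> {}" "\<And>U. U \<in> set F \<Longrightarrow> U \<noteq> UNIV"
  using assms unfolding flags_def by auto

lemma flags_tl: "F # Fs \<in> flags \<Longrightarrow> Fs \<in> flags"
  unfolding flags_def by auto

text \<open>\<open>b\<close> is in the second highest block, outside the smallest member but in all
  others. It marks the level just below \<open>F\<close> when \<open>F\<close> is split off.\<close>

lemma flag_second_level:
  assumes "F # Fs \<in> flags"
  obtains b where "b \<notin> F" "\<And>U. U \<in> set Fs \<Longrightarrow> b \<in> U"
proof (cases Fs)
  case Nil
  then show ?thesis using flagsD(3)[OF assms, of F] that by auto
next
  case (Cons G Gs)
  then obtain b where "b \<in> G - F" using flagsD(1)[OF assms] by auto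
  then show ?thesis using that[of b] flagsD(1)[OF assms] Cons by auto
qed

lemma level_Cons:
  assumes "F # Fs \<in> flags"
  shows "level (F # Fs) i = level Fs i + of_bool (i \<in> F)"
proof -
  have "F \<notin> set Fs" using flagsD(1)[OF assms] by auto
  moreover have "{U \<in> set (F # Fs). i \<in> U} = (if i \<in> F then insert F {U \<in> set Fs. i \<in> U} else {U \<in> set Fs. i \<in> U})"
    by auto
  ultimately show ?thesis unfolding level_def by simp
qed

lemma level_top:
  assumes "Fs \<in> flags" "\<And>U. U \<in> set Fs \<Longrightarrow> i \<in> U"
  shows "level Fs i = length Fs"
  using assms
proof (induction Fs)
  case (Cons F Fs)
  then show ?case using level_Cons[OF Cons.prems(1), of i] flags_tl[OF Cons.prems(1)] by auto
qed (simp add: level_def)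

text \<open>A flag of length \<open>k\<close> has \<open>k + 1\<close> nonempty blocks, one per
  level. This ties the length to the number of classes of equal coordinates.\<close>

lemma range_level:
  fixes Fs :: "'n::finite set list"
  assumes "Fs \<in> flags"
  shows "range (level Fs) = {..length Fs}"
  using assms
proof (induction Fs)
  case (Cons F Fs)
  note lC = level_Cons[OF Cons.prems]
  have IH: "range (level Fs) = {..length Fs}" using Cons.IH flags_tl[OF Cons.prems] by blast
  obtain b where b: "b \<notin> F" "\<And>U. U \<in> set Fs \<Longrightarrow> b \<in> U" using flag_second_level[OF Cons.prems] by blast
  have inF: "level Fs i = length Fs" if "i \<in> F" for i
    using flagsD(1)[OF Cons.prems] that by (intro level_top flags_tl[OF Cons.prems]) auto
  obtain a where a: "a \<in> F" using flagsD(2)[OF Cons.prems, of F] by auto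
  show ?case
  proof (intro equalityI subsetI)
    fix k assume "k \<in> range (level (F # Fs))"
    then obtain i where "k = level Fs i + of_bool (i \<in> F)" using lC by auto
    moreover have "level Fs i \<in> {..length Fs}" unfolding IH[symmetric] by simp
    ultimately show "k \<in> {..length (F # Fs)}" by auto
  next
    fix k assume k: "k \<in> {..length (F # Fs)}"
    consider "k < length Fs" | "k = length Fs" | "k = Suc (length Fs)" using k by force
    then show "k \<in> range (level (F # Fs))"
    proof cases
      case 1
      then have "k \<in> range (level Fs)" unfolding IH by simp
      then obtain i where i: "level Fs i = k" by auto
      then have "i \<notin> F" using inF 1 by auto
      then show ?thesis using lC[of i] i by (metis add_0_right of_bool_eq(1) rangeI)
    next
      case 2
      have "level Fs b = length Fs" using b by (intro level_top flags_tl[OF Cons.prems])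
      then show ?thesis using lC[of b] b 2 by (metis add_0_right of_bool_eq(1) rangeI)
    next
      case 3
      then show ?thesis using lC[of a] inF[OF a] a by (metis Suc_eq_plus1 of_bool_eq(2) rangeI)
    qed
  qed
qed (auto simp: level_def)

lemma weakly_adapted_decomp:
  fixes Fs :: "'n::finite set list"
  assumes "Fs \<in> flags" "weakly_adapted Fs x"
  shows "\<exists>c k. (\<forall>U. c U \<ge> (0::real)) \<and> (\<forall>i. x i = k + (\<Sum>U\<in>set Fs. c U * of_bool (i \<in> U)))"
  using assms
proof (induction Fs arbitrary: x)
  case Nil
  then have "x i \<le> x j" for i j unfolding weakly_adapted_def level_def by simp
  then have "x i = x undefined" for i by (intro order_antisym)
  then show ?case by (intro exI[of _ "\<lambda>_. 0"] exI[of _ "x undefined"]) (simp only: list.set sum.empty, simp)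
next
  case (Cons F Fs)
  note ch = flagsD(1)[OF Cons.prems(1)]
  have wa: "x i \<le> x j" if "i \<in> F \<longrightarrow> j \<in> F" "\<forall>U\<in>set Fs. i \<in> U \<longrightarrow> j \<in> U" for i j
    using Cons.prems(2) that unfolding weakly_adapted_def level_le_iff[OF ch] by auto
  have FU: "i \<in> U" if "i \<in> F" "U \<in> set Fs" for i U using ch that by auto
  obtain a where a: "a \<in> F" using flagsD(2)[OF Cons.prems(1), of F] by auto
  obtain b where b: "b \<notin> F" "\<And>U. U \<in> set Fs \<Longrightarrow> b \<in> U" using flag_second_level[OF Cons.prems(1)] by blast
  have xF: "x i = x a" if "i \<in> F" for i
    by (rule order_antisym; rule wa) (use that a FU in auto)
  \<comment> \<open>The coefficient of the smallest member is the drop from the top block to the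
    next; subtracting it merges the two blocks.\<close>
  define d where "d = x a - x b"
  have d: "d \<ge> 0" unfolding d_def using wa[of b a] b a FU by auto
  define x' where "x' = (\<lambda>i. x i - d * of_bool (i \<in> F))"
  have "weakly_adapted Fs x'"
    unfolding weakly_adapted_def level_le_iff[OF flagsD(1)[OF flags_tl[OF Cons.prems(1)]]]
  proof (intro allI impI)
    fix i j assume ij: "\<forall>U\<in>set Fs. i \<in> U \<longrightarrow> j \<in> U"
    consider "i \<in> F" "j \<in> F" | "i \<notin> F" "j \<notin> F" | "i \<notin> F" "j \<in> F" | "i \<in> F" "j \<notin> F" by blast
    then show "x' i \<le> x' j"
    proof cases
      case 1
      then show ?thesis unfolding x'_def using xF[of i] xF[of j] by simp
    next
      case 2
      then show ?thesis unfolding x'_def using wa[of i j] ij by simp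
    next
      case 3
      then show ?thesis unfolding x'_def d_def using xF[of j] wa[of i b] b by simp
    next
      case 4
      then have "\<forall>U\<in>set Fs. j \<in> U" using ij FU by blast
      then show ?thesis unfolding x'_def d_def using 4 xF[of i] wa[of b j] b by simp
    qed
  qed
  then obtain c k where c: "\<And>U. c U \<ge> (0::real)" "\<And>i. x' i = k + (\<Sum>U\<in>set Fs. c U * of_bool (i \<in> U))"
    using Cons.IH[OF flags_tl[OF Cons.prems(1)]] by blast
  have nF: "F \<notin> set Fs" using ch by auto
  show ?case
  proof (intro exI[of _ "c(F := d)"] exI[of _ k] conjI allI)
    show "0 \<le> (c(F := d)) U" for U using c(1) d by simp
    fix i
    have "(\<Sum>U\<in>set Fs. (c(F := d)) U * of_bool (i \<in> U)) = (\<Sum>U\<in>set Fs. c U * of_bool (i \<in> U))"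
      using nF by (intro sum.cong) auto
    then show "x i = k + (\<Sum>U\<in>set (F # Fs). (c(F := d)) U * of_bool (i \<in> U))"
      using c(2)[of i] nF unfolding x'_def list.set(2) by (subst sum.insert) (simp_all del: sum.insert)
  qed
qed

lemma flag_cone_iff:
  fixes Fs :: "'n::finite set list"
  assumes "Fs \<in> flags"
  shows "proj_NR x \<in> flag_cone Fs \<longleftrightarrow> weakly_adapted Fs (($) x)"
proof -
  have sum: "(\<Sum>U\<in>set Fs. c U *\<^sub>R e_bar U) = proj_NR (\<chi> i. \<Sum>U\<in>set Fs. c U * of_bool (i \<in> U))" for c
    unfolding e_bar_eq proj_NR_scaleR proj_NR_sum
    by (rule arg_cong[of _ _ proj_NR]) (simp add: vec_eq_iff sum_component)
  have "proj_NR x \<in> flag_cone Fs \<longleftrightarrow>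
    (\<exists>c k. (\<forall>U. c U \<ge> 0) \<and> (\<forall>i. x $ i = (\<Sum>U\<in>set Fs. c U * of_bool (i \<in> U)) + k))"
    unfolding flag_cone_def sum mem_Collect_eq proj_NR_eq_iff by auto
  also have "\<dots> \<longleftrightarrow> weakly_adapted Fs (($) x)"
  proof
    assume "\<exists>c k. (\<forall>U. c U \<ge> 0) \<and> (\<forall>i. x $ i = (\<Sum>U\<in>set Fs. c U * of_bool (i \<in> U)) + k)"
    then obtain c k where c: "\<And>U. c U \<ge> 0" "\<And>i. x $ i = (\<Sum>U\<in>set Fs. c U * of_bool (i \<in> U)) + k" by blast
    show "weakly_adapted Fs (($) x)"
      unfolding weakly_adapted_def level_le_iff[OF flagsD(1)[OF assms]] c(2)
    proof (intro allI impI add_right_mono sum_mono mult_left_mono c(1))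
      show "of_bool (i \<in> U) \<le> (of_bool (j \<in> U) :: real)"
        if "\<forall>U\<in>set Fs. i \<in> U \<longrightarrow> j \<in> U" "U \<in> set Fs" for i j U
        using that by auto
    qed
  qed (use weakly_adapted_decomp[OF assms] in \<open>simp add: add.commute\<close>)
  finally show ?thesis .
qed

lemma adapted_imp_weakly: "adapted Fs x \<Longrightarrow> weakly_adapted Fs x"
  unfolding adapted_def weakly_adapted_def by (simp flip: not_less)

lemma adapted_eq: "adapted Fs x \<Longrightarrow> level Fs i = level Fs j \<Longrightarrow> x i = x j"
proof -
  assume "adapted Fs x" "level Fs i = level Fs j"
  then have "\<not> x i < x j" "\<not> x j < x i" unfolding adapted_def by simp_all
  then show "x i = x j" by simp
qed

lemma adapted_iff:
  "adapted Fs x \<longleftrightarrow> (\<forall>i j. (level Fs i < level Fs j \<longrightarrow> x i < x j) \<and> (level Fs i = level Fs j \<longrightarrow> x i = x j))"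
proof
  assume H: "\<forall>i j. (level Fs i < level Fs j \<longrightarrow> x i < x j) \<and> (level Fs i = level Fs j \<longrightarrow> x i = x j)"
  show "adapted Fs x"
    unfolding adapted_def
  proof (intro allI iffI)
    fix i j assume ij: "x i < x j"
    show "level Fs i < level Fs j"
    proof (rule ccontr)
      assume "\<not> level Fs i < level Fs j"
      then consider "level Fs j < level Fs i" | "level Fs i = level Fs j" by linarith
      then show False
        using H[THEN spec, of j, THEN spec, of i] ij by cases simp_all
    qed
  next
    fix i j assume "level Fs i < level Fs j"
    then show "x i < x j" using H[THEN spec, of i, THEN spec, of j] by simp
  qed
next
  assume a: "adapted Fs x"
  show "\<forall>i j. (level Fs i < level Fs j \<longrightarrow> x i < x j) \<and> (level Fs i = level Fs j \<longrightarrow> x i = x j)"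
  proof (intro allI conjI impI)
    show "x i < x j" if "level Fs i < level Fs j" for i j using a that unfolding adapted_def by simp
    show "x i = x j" if "level Fs i = level Fs j" for i j by (rule adapted_eq[OF a that])
  qed
qed

lemma adapted_level: "adapted Fs (\<lambda>i. real (level Fs i))"
  unfolding adapted_def by simp

lemma adapted_add:
  assumes "adapted Fs x" "weakly_adapted Fs v"
  shows "adapted Fs (\<lambda>i. x i + v i)"
  unfolding adapted_iff
proof (intro allI conjI impI)
  fix i j
  show "x i + v i < x j + v j" if "level Fs i < level Fs j"
    using assms that unfolding adapted_def weakly_adapted_def by (intro add_less_le_mono) auto
  show "x i + v i = x j + v j" if "level Fs i = level Fs j"
  proof -
    have "v i \<le> v j" "v j \<le> v i" using assms(2) that unfolding weakly_adapted_def by auto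
    then show ?thesis using adapted_eq[OF assms(1) that] by simp
  qed
qed

lemma weakly_adapted_add:
  "weakly_adapted Fs x \<Longrightarrow> weakly_adapted Fs v \<Longrightarrow> weakly_adapted Fs (\<lambda>i. x i + v i)"
  unfolding weakly_adapted_def by (intro allI impI add_mono) blast+

lemma weakly_adapted_scale:
  "weakly_adapted Fs x \<Longrightarrow> c \<ge> 0 \<Longrightarrow> weakly_adapted Fs (\<lambda>i. c * x i)"
  unfolding weakly_adapted_def by (intro allI impI mult_left_mono) blast+

lemma adapted_scale:
  "adapted Fs x \<Longrightarrow> c > 0 \<Longrightarrow> adapted Fs (\<lambda>i. c * x i)"
  unfolding adapted_def by simp

text \<open>A member is cut off by the largest coordinate outside it. Thus an adapted vector
  determines its flag.\<close>

lemma mem_flag_iff_superlevel: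
  fixes F :: "'n::finite set list"
  assumes F: "F \<in> flags" and x: "adapted F x"
  shows "U \<in> set F \<longleftrightarrow> U \<noteq> {} \<and> U \<noteq> UNIV \<and> (\<exists>t. U = {j. t < x j})"
proof
  note less = level_less_iff[OF flagsD(1)[OF F]]
  assume U: "U \<in> set F"
  define t where "t = Max (x ` (- U))"
  have ne: "x ` (- U) \<noteq> {}" using flagsD(3)[OF F U] by auto
  have "t < x j" if "j \<in> U" for j
  proof -
    have "x k < x j" if "k \<notin> U" for k
      using x U \<open>j \<in> U\<close> that less[of k j] unfolding adapted_def by blast
    then show ?thesis unfolding t_def using ne by (subst Max_less_iff) auto
  qed
  moreover have "j \<in> U" if "t < x j" for j
  proof (rule ccontr)
    assume "j \<notin> U"
    then have "x j \<le> t" unfolding t_def by (intro Max_ge) auto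
    then show False using that by simp
  qed
  ultimately have "U = {j. t < x j}" by blast
  then show "U \<noteq> {} \<and> U \<noteq> UNIV \<and> (\<exists>t. U = {j. t < x j})" using flagsD[OF F] U by blast
next
  note less = level_less_iff[OF flagsD(1)[OF F]] and le = level_le_iff[OF flagsD(1)[OF F]]
  assume "U \<noteq> {} \<and> U \<noteq> UNIV \<and> (\<exists>t. U = {j. t < x j})"
  then obtain t where ne: "U \<noteq> {}" "- U \<noteq> {}" and U: "U = {j. t < x j}" by auto
  obtain a where a: "a \<in> U" "\<And>j. j \<in> U \<Longrightarrow> x a \<le> x j"
    proof -
    have "Min (x ` U) \<in> x ` U" using ne(1) by (intro Min_in) auto
    then obtain a where "a \<in> U" "x a = Min (x ` U)" by (metis imageE)
    moreover from this have "x a \<le> x j" if "j \<in> U" for j using that by simp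
    ultimately show ?thesis using that by blast
  qed
  obtain b where b: "b \<in> - U" "\<And>j. j \<in> - U \<Longrightarrow> x j \<le> x b"
    proof -
    have "Max (x ` (- U)) \<in> x ` (- U)" using ne(2) by (intro Max_in) auto
    then obtain b where "b \<in> - U" "x b = Max (x ` (- U))" by (metis imageE)
    moreover from this have "x j \<le> x b" if "j \<in> - U" for j using that by simp
    ultimately show ?thesis using that by blast
  qed
  have wa: "x i \<le> x j \<longleftrightarrow> level F i \<le> level F j" for i j
    using x unfolding adapted_def by (simp flip: not_less)
  have "x b < x a" using a(1) b(1) unfolding U by auto
  then obtain V where V: "V \<in> set F" "a \<in> V" "b \<notin> V" using x less unfolding adapted_def by blast
  have "j \<in> V" if "j \<in> U" for j using a(2)[OF that] wa le V by blast
  moreover have "j \<in> U" if "j \<in> V" for j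
  proof (rule ccontr)
    assume "j \<notin> U"
    then have "x j \<le> x b" using b(2) by simp
    then show False using wa le V that by blast
  qed
  ultimately have "V = U" by blast
  then show "U \<in> set F" using V by simp
qed

section \<open>Every vector is adapted to exactly one flag\<close>

lemma chain_unique:
  "sorted_wrt (\<subset>) F \<Longrightarrow> sorted_wrt (\<subset>) G \<Longrightarrow> set F = set G \<Longrightarrow> F = (G :: 'a set list)"
proof (induction F arbitrary: G)
  case (Cons A F)
  then obtain B G' where G: "G = B # G'" by (cases G) auto
  have "A \<in> set (B # G')" "B \<in> set (A # F)"
    using Cons.prems(3) unfolding G by (metis list.set_intros(1))+
  then have AB: "A = B" using Cons.prems(1,2) unfolding G by auto
  have "A \<notin> set F" "A \<notin> set G'" using Cons.prems(1,2) unfolding G AB by auto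
  then have "set F = set G'" using Cons.prems(3) unfolding G AB by (simp add: insert_ident)
  then show ?case using Cons.IH[of G'] Cons.prems(1,2) unfolding G AB by simp
qed simp

lemma adapted_flag_unique:
  fixes F G :: "'n::finite set list"
  assumes "F \<in> flags" "G \<in> flags" "adapted F x" "adapted G x"
  shows "F = G"
proof (rule chain_unique)
  show "set F = set G"
    by (rule set_eqI)
       (simp only: mem_flag_iff_superlevel[OF assms(1,3)] mem_flag_iff_superlevel[OF assms(2,4)])
qed (use flagsD(1) assms in auto)

lemma adapted_flag_exists:
  fixes x :: "'n::finite \<Rightarrow> real"
  shows "\<exists>F\<in>flags. adapted F x"
proof -
  \<comment> \<open>The maximum is left out because its superlevel set is empty; as thresholds are
    values of \<open>x\<close>, the whole set does not occur. Decreasing thresholds list the sets in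
    increasing order.\<close>
  define T where "T = range x - {Max (range x)}"
  define F where "F = map (\<lambda>t. {j. t < x j}) (rev (sorted_list_of_set T))"
  have finT: "finite T" unfolding T_def by simp
  have setF: "set F = (\<lambda>t. {j. t < x j}) ` T" unfolding F_def using finT by simp
  have "sorted_wrt (<) (sorted_list_of_set T)" by (rule strict_sorted_list_of_set)
  then have "sorted_wrt (\<lambda>s t. t < s) (rev (sorted_list_of_set T))" by (simp add: sorted_wrt_rev)
  then have ch: "sorted_wrt (\<subset>) F"
    unfolding F_def sorted_wrt_map
  proof (rule sorted_wrt_mono_rel[rotated])
    fix s t assume st: "s \<in> set (rev (sorted_list_of_set T))" "t \<in> set (rev (sorted_list_of_set T))" "t < s"
    then have "s \<in> range x" using finT unfolding T_def by simp
    then obtain i where "s = x i" by auto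
    then show "{j. s < x j} \<subset> {j. t < x j}" using st(3) by auto
  qed
  have "{j. t < x j} \<noteq> {} \<and> {j. t < x j} \<noteq> UNIV" if tT: "t \<in> T" for t
  proof -
    have "t \<le> Max (range x)" "t \<noteq> Max (range x)" using tT unfolding T_def by auto
    moreover have "Max (range x) \<in> range x" by (intro Max_in) auto
    then obtain j where "x j = Max (range x)" by (metis imageE)
    ultimately have "t < x j" by simp
    then have "{j. t < x j} \<noteq> {}" by blast
    moreover obtain i where "t = x i" using tT unfolding T_def by auto
    ultimately show ?thesis by auto
  qed
  then have "F \<in> flags" unfolding flags_def using ch setF by auto
  moreover have "adapted F x"
    unfolding adapted_def level_less_iff[OF ch] setF
  proof (intro allI iffI)
    fix i j assume ij: "x i < x j"
    have "x j \<le> Max (range x)" by simp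
    then have "x i \<in> T" unfolding T_def using ij by auto
    then show "\<exists>U\<in>(\<lambda>t. {j. t < x j}) ` T. j \<in> U \<and> i \<notin> U" using ij by auto
  qed auto
  ultimately show ?thesis by blast
qed

section \<open>Dimensions of cells\<close>

lemma transversal_exists:
  assumes "\<And>i. r i i" "\<And>i j. r i j \<Longrightarrow> r j i" "\<And>i j k. r i j \<Longrightarrow> r j k \<Longrightarrow> r i k"
  shows "\<exists>T. transversal r UNIV T"
proof -
  define f where "f = (\<lambda>i. SOME j. r i j)"
  have f: "r i (f i)" for i unfolding f_def by (rule someI[of _ i]) (rule assms(1))
  have feq: "f i = f j" if "r i j" for i j
  proof -
    have "r i = r j" using that assms(2,3) by blast
    then show ?thesis unfolding f_def by simp
  qed
  have "transversal r UNIV (range f)"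
    unfolding transversal_def
  proof (intro conjI ballI impI)
    fix s t assume "s \<in> range f" "t \<in> range f" "r s t"
    then obtain i j where ij: "s = f i" "t = f j" by blast
    then have "r i j" using f[of i] f[of j] \<open>r s t\<close> assms(2,3) by blast
    then show "s = t" using feq ij by simp
  qed (use f in auto)
  then show ?thesis ..
qed

text \<open>Strict inequalities survive a small step in any direction, equations survive it if the
  direction is constant on their classes: a solution set is open in its affine hull.\<close>

lemma sols_perturb:
  fixes v :: "'i \<Rightarrow> real"
  assumes fin: "finite Q" and p: "p \<in> sols Q" and v: "\<And>i j. diff_const (sols Q) i j \<Longrightarrow> v i = v j"
  shows "\<exists>\<epsilon>>0. (\<lambda>i. p i + \<epsilon> * v i) \<in> sols Q"
proof -
  have "\<forall>\<^sub>F \<epsilon> in at_right 0. sat (\<lambda>i. p i + \<epsilon> * v i) q" if q: "q \<in> Q" for q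
  proof -
    obtain b i j c where qq: "q = (b, i, j, c)" by (cases q)
    have pq: "sat p q" using p q unfolding sols_def by blast
    show ?thesis
    proof (cases b)
      case True
      then have qb: "q = (True, i, j, c)" using qq by simp
      have "x i - x j = c" if "x \<in> sols Q" for x
      proof -
        have "sat x q" using that q unfolding sols_def by blast
        then show ?thesis unfolding qb by simp
      qed
      then have "v i = v j" by (intro v) (auto simp: diff_const_def)
      then show ?thesis using pq unfolding qb by simp
    next
      case False
      then have qb: "q = (False, i, j, c)" using qq by simp
      have "((\<lambda>\<epsilon>. (p i + \<epsilon> * v i) - (p j + \<epsilon> * v j)) \<longlongrightarrow> (p i + 0 * v i) - (p j + 0 * v j)) (at_right 0)"
        by (intro tendsto_intros)
      moreover have "(p i + 0 * v i) - (p j + 0 * v j) < c" using pq unfolding qb by simp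
      ultimately have "\<forall>\<^sub>F \<epsilon> in at_right 0. (p i + \<epsilon> * v i) - (p j + \<epsilon> * v j) < c"
        by (rule order_tendstoD)
      then show ?thesis unfolding qb by simp
    qed
  qed
  then have "\<forall>\<^sub>F \<epsilon> in at_right 0. \<forall>q\<in>Q. sat (\<lambda>i. p i + \<epsilon> * v i) q"
    by (intro eventually_ball_finite fin) blast
  then have "\<forall>\<^sub>F \<epsilon> in at_right (0::real). \<epsilon> > 0 \<and> (\<lambda>i. p i + \<epsilon> * v i) \<in> sols Q"
    unfolding sols_def using eventually_at_right_less[of 0] by eventually_elim simp
  then show ?thesis using eventually_happens trivial_limit_at_right_real by blast
qed

text \<open>The class indicators form a basis of the vectors constant on classes, and their sum is
  the diagonal vector, which vanishes in the quotient. Dropping the indicator of one representative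
  \<open>t0\<close> leaves a basis there.\<close>

lemma dim_class_constant:
  fixes r :: "'n::finite \<Rightarrow> 'n \<Rightarrow> bool"
  assumes r: "\<And>i. r i i" "\<And>i j. r i j \<Longrightarrow> r j i" "\<And>i j k. r i j \<Longrightarrow> r j k \<Longrightarrow> r i k"
    and T: "transversal r UNIV T"
  shows "dim {proj_NR v | v. \<forall>i j. r i j \<longrightarrow> v $ i = v $ j} = card T - 1"
proof -
  have Tex: "\<exists>t\<in>T. r i t" for i using T unfolding transversal_def by simp
  then obtain t0 where t0: "t0 \<in> T" by blast
  have Tun: "s = t" if "s \<in> T" "t \<in> T" "r s t" for s t
    using T that unfolding transversal_def by simp
  define b where "b = (\<lambda>t. \<chi> i. (of_bool (r i t) :: real))"
  have bT: "b t $ s = of_bool (s = t)" if "s \<in> T" "t \<in> T" for s t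
  proof -
    have "r s t \<longleftrightarrow> s = t" using Tun[OF that] r(1) by metis
    then show ?thesis by (simp add: b_def)
  qed
  let ?V = "{proj_NR v | v. \<forall>i j. r i j \<longrightarrow> v $ i = v $ j}"
  let ?B = "(\<lambda>t. proj_NR (b t)) ` (T - {t0})"
  have decomp: "v = (\<Sum>t\<in>T. v $ t *\<^sub>R b t)" if v: "\<forall>i j. r i j \<longrightarrow> v $ i = v $ j" for v
  proof -
    have "v $ i = (\<Sum>t\<in>T. v $ t * of_bool (r i t))" for i
    proof -
      obtain s where s: "s \<in> T" "r i s" using Tex by blast
      have ts: "t = s" if "t \<in> T" "r i t" for t
        using Tun[OF that(1) s(1)] r(3)[OF r(2)[OF that(2)] s(2)] by simp
      have "(\<Sum>t\<in>T. v $ t * of_bool (r i t)) = (\<Sum>t\<in>T. if t = s then v $ t else 0)"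
      proof (rule sum.cong[OF refl])
        fix t assume "t \<in> T"
        then have "r i t \<longleftrightarrow> t = s" using ts s(2) by blast
        then show "v $ t * of_bool (r i t) = (if t = s then v $ t else 0)" by simp
      qed
      also have "\<dots> = v $ s" using s by simp
      also have "\<dots> = v $ i" by (rule v[rule_format, OF s(2), symmetric])
      finally show ?thesis by (rule sym)
    qed
    then show ?thesis
      unfolding vec_eq_iff sum_component vector_scaleR_component b_def vec_lambda_beta real_scaleR_def
      by (intro allI)
  qed
  have lin: "\<forall>t\<in>T - {t0}. a t = 0" if "(\<Sum>t\<in>T - {t0}. a t *\<^sub>R proj_NR (b t)) = 0" for a
  proof
    fix s assume s: "s \<in> T - {t0}"
    have "proj_NR (\<Sum>t\<in>T - {t0}. a t *\<^sub>R b t) = proj_NR 0"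
      using that unfolding proj_NR_scaleR proj_NR_sum proj_NR_zero .
    then obtain c where c: "\<And>i. (\<Sum>t\<in>T - {t0}. a t *\<^sub>R b t) $ i = c"
      unfolding proj_NR_eq_iff by auto
    have ev: "(\<Sum>t\<in>T - {t0}. a t *\<^sub>R b t) $ s = (if s = t0 then 0 else a s)" if "s \<in> T" for s
    proof -
      have "(\<Sum>t\<in>T - {t0}. a t *\<^sub>R b t) $ s = (\<Sum>t\<in>T - {t0}. if t = s then a t else 0)"
        unfolding sum_component by (intro sum.cong) (auto simp: bT that)
      then show ?thesis using that by simp
    qed
    \<comment> \<open>The combination is a constant vector and vanishes at \<open>t0\<close>, so the
      constant is 0.\<close>
    show "a s = 0" using ev[OF t0] ev[of s] s c[of t0] c[of s] by simp
  qed
  have inj: "inj_on (\<lambda>t. proj_NR (b t)) (T - {t0})"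
  proof (rule inj_onI)
    fix s t assume st: "s \<in> T - {t0}" "t \<in> T - {t0}" "proj_NR (b s) = proj_NR (b t)"
    then obtain c where c: "\<And>i. b s $ i = b t $ i + c" unfolding proj_NR_eq_iff by blast
    show "s = t"
      using c[of t0] c[of s] bT[of t0 s] bT[of t0 t] bT[of s s] bT[of s t] st t0 by (auto split: if_splits)
  qed
  have fin: "finite ?B" by simp
  have "dim ?V = card ?B"
  proof (rule dim_eq_card[symmetric, THEN sym])
    show "independent ?B"
    proof
      assume "dependent ?B"
      then obtain a where a: "\<exists>v\<in>?B. a v \<noteq> 0" "(\<Sum>v\<in>?B. a v *\<^sub>R v) = 0"
        unfolding dependent_finite[OF fin] by blast
      have "(\<Sum>t\<in>T - {t0}. a (proj_NR (b t)) *\<^sub>R proj_NR (b t)) = 0"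
        using a(2) unfolding sum.reindex[OF inj] by (simp add: o_def)
      from lin[OF this] a(1) show False by auto
    qed
    have BV: "?B \<subseteq> ?V"
    proof
      fix z assume "z \<in> ?B"
      then obtain t where z: "z = proj_NR (b t)" by blast
      have "r i t \<longleftrightarrow> r j t" if "r i j" for i j using that r(2,3) by blast
      then show "z \<in> ?V" unfolding z b_def by force
    qed
    have "?V \<subseteq> span ?B"
    proof
      fix z assume "z \<in> ?V"
      then obtain v where z: "z = proj_NR v" and v: "\<forall>i j. r i j \<longrightarrow> v $ i = v $ j" by blast
      have "1 = (\<Sum>t\<in>T. (1 :: real ^ 'n) $ t *\<^sub>R b t)" by (rule decomp) simp
      then have one: "1 = (\<Sum>t\<in>T. b t)" by (simp only: one_index scaleR_one)
      have "v - v $ t0 *\<^sub>R 1 = (\<Sum>t\<in>T. (v $ t - v $ t0) *\<^sub>R b t)"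
      proof -
        have "(\<Sum>t\<in>T. (v $ t - v $ t0) *\<^sub>R b t) = (\<Sum>t\<in>T. v $ t *\<^sub>R b t) - v $ t0 *\<^sub>R (\<Sum>t\<in>T. b t)"
          unfolding scaleR_diff_left sum_subtractf scaleR_sum_right ..
        then show ?thesis unfolding decomp[OF v, symmetric] one[symmetric] by (rule sym)
      qed
      also have "\<dots> = (\<Sum>t\<in>T - {t0}. (v $ t - v $ t0) *\<^sub>R b t)"
        by (rule sum.mono_neutral_right) auto
      finally have "(\<Sum>t\<in>T - {t0}. (v $ t - v $ t0) *\<^sub>R b t) = v - v $ t0 *\<^sub>R 1" by (rule sym)
      moreover have "z = proj_NR (v - v $ t0 *\<^sub>R 1)"
        unfolding z proj_NR_eq_iff by (intro exI[of _ "v $ t0"]) simp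
      ultimately have "z = (\<Sum>t\<in>T - {t0}. (v $ t - v $ t0) *\<^sub>R proj_NR (b t))"
        unfolding proj_NR_scaleR proj_NR_sum by (simp only:)
      then show "z \<in> span ?B" by (auto intro!: span_sum span_scale intro: span_base)
    qed
    moreover have "span ?B \<subseteq> span ?V" using BV by (rule span_mono)
    moreover have "span ?V \<subseteq> span ?B" using calculation(1) span_minimal[OF _ subspace_span] by blast
    ultimately show "span ?B = span ?V" by blast
  qed
  also have "\<dots> = card T - 1" using card_image[OF inj] t0 by simp
  finally show ?thesis .
qed

text \<open>\<open>K\<close> will be a closed cone or cell and \<open>sols Q\<close> its relatively
  open part, up to the shift by \<open>p\<close>. The midpoint condition keeps \<open>K\<close> in
  the affine hull of the smaller set; perturbing one solution shows that this hull has all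
  directions constant on the classes.\<close>

lemma convex_dim_eq:
  fixes Q :: "'n::finite difference_constraint set" and p :: "'n NR"
  assumes fin: "finite Q" and ne: "sols Q \<noteq> {}"
    and sub: "\<And>x. x \<in> sols Q \<Longrightarrow> proj_NR (\<chi> i. x i) + p \<in> K"
    and mid: "\<And>z x. proj_NR z + p \<in> K \<Longrightarrow> x \<in> sols Q \<Longrightarrow> (\<lambda>i. (z $ i + x i) / 2) \<in> sols Q"
    and T: "transversal (diff_const (sols Q)) UNIV T"
  shows "convex_dim K = card T - 1"
proof -
  obtain x where x: "x \<in> sols Q" using ne by blast
  define a where "a = proj_NR (\<chi> i. x i) + p"
  let ?r = "diff_const (sols Q)"
  let ?V = "{proj_NR v | v. \<forall>i j. ?r i j \<longrightarrow> v $ i = v $ j}"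
  have add: "y + z \<in> ?V" if "y \<in> ?V" "z \<in> ?V" for y z
  proof -
    obtain v w where "y = proj_NR v" "z = proj_NR w" "\<forall>i j. ?r i j \<longrightarrow> v $ i = v $ j"
      "\<forall>i j. ?r i j \<longrightarrow> w $ i = w $ j" using \<open>y \<in> ?V\<close> \<open>z \<in> ?V\<close> by blast
    note vw = this
    have "(v + w) $ i = (v + w) $ j" if "?r i j" for i j
      unfolding vector_add_component vw(3)[rule_format, OF that] vw(4)[rule_format, OF that] ..
    moreover have "y + z = proj_NR (v + w)" unfolding vw(1,2) by (rule proj_NR_add)
    ultimately show ?thesis by blast
  qed
  have scale: "c *\<^sub>R y \<in> ?V" if "y \<in> ?V" for y and c :: real
  proof -
    obtain v where "y = proj_NR v" "\<forall>i j. ?r i j \<longrightarrow> v $ i = v $ j" using \<open>y \<in> ?V\<close> by blast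
    note v = this
    have "(c *\<^sub>R v) $ i = (c *\<^sub>R v) $ j" if "?r i j" for i j
      unfolding vector_scaleR_component v(2)[rule_format, OF that] ..
    moreover have "c *\<^sub>R y = proj_NR (c *\<^sub>R v)" unfolding v(1) by (rule proj_NR_scaleR)
    ultimately show ?thesis by blast
  qed
  have KV: "K \<subseteq> {y. y - a \<in> ?V}"
  proof
    fix y assume y: "y \<in> K"
    obtain z where z: "y - p = proj_NR z" by (rule proj_NR_cases)
    have yz: "y = proj_NR z + p" using z by (simp add: algebra_simps)
    have "z $ i - x i = z $ j - x j" if ij: "?r i j" for i j
    proof -
      obtain c where c: "\<And>x. x \<in> sols Q \<Longrightarrow> x i - x j = c" using ij unfolding diff_const_def by blast
      have "proj_NR z + p \<in> K" using y yz by simp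
      \<comment> \<open>The midpoint of \<open>z\<close> and \<open>x\<close> is a solution and has
        the constant difference \<open>c\<close>; since \<open>x\<close> has it too, so has
        \<open>z\<close>.\<close>
      from c[OF mid[OF this x]] have "(z $ i + x i) - (z $ j + x j) = 2 * c"
        unfolding diff_divide_distrib[symmetric] by simp
      then show ?thesis using c[OF x] by simp
    qed
    then have "\<forall>i j. ?r i j \<longrightarrow> (z - (\<chi> i. x i)) $ i = (z - (\<chi> i. x i)) $ j"
      unfolding vector_minus_component vec_lambda_beta by blast
    moreover have "y - a = proj_NR (z - (\<chi> i. x i))"
      unfolding yz a_def proj_NR_diff[symmetric] by (simp only: add_diff_cancel_right)
    ultimately show "y \<in> {y. y - a \<in> ?V}" by blast
  qed
  have aff: "affine {y. y - a \<in> ?V}"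
    unfolding affine_def
  proof clarify
    fix y z v w and c d :: real
    assume cd: "c + d = 1" and "y - a = proj_NR v" "\<forall>i j. ?r i j \<longrightarrow> v $ i = v $ j"
      and "z - a = proj_NR w" "\<forall>i j. ?r i j \<longrightarrow> w $ i = w $ j"
    then have "y - a \<in> ?V" "z - a \<in> ?V" by blast+
    then have "c *\<^sub>R (y - a) + d *\<^sub>R (z - a) \<in> ?V" by (intro add scale)
    moreover have "c *\<^sub>R (y - a) + d *\<^sub>R (z - a) = c *\<^sub>R y + d *\<^sub>R z - (c + d) *\<^sub>R a"
      by (simp add: algebra_simps)
    ultimately have "c *\<^sub>R y + d *\<^sub>R z - a \<in> ?V" using cd by simp
    then show "\<exists>v. c *\<^sub>R y + d *\<^sub>R z - a = proj_NR v \<and> (\<forall>i j. ?r i j \<longrightarrow> v $ i = v $ j)" by blast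
  qed
  have hull: "affine hull K \<subseteq> {y. y - a \<in> ?V}" by (rule hull_minimal[where S = affine, OF KV aff])
  have aK: "a \<in> K" unfolding a_def using sub x by blast
  have "{y - z | y z. y \<in> affine hull K \<and> z \<in> affine hull K} = ?V"
  proof (intro equalityI subsetI)
    fix d assume "d \<in> {y - z | y z. y \<in> affine hull K \<and> z \<in> affine hull K}"
    then obtain y z where yz: "d = y - z" "y \<in> affine hull K" "z \<in> affine hull K" by blast
    have "y - a \<in> ?V" "z - a \<in> ?V" using subsetD[OF hull yz(2)] subsetD[OF hull yz(3)] by simp_all
    then have "(y - a) + (- 1) *\<^sub>R (z - a) \<in> ?V" by (intro add scale)
    moreover have "(y - a) + (- 1) *\<^sub>R (z - a) = d" unfolding yz(1) by simp
    ultimately show "d \<in> ?V" by (rule subst[rotated])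
  next
    fix d assume "d \<in> ?V"
    then obtain v where d: "d = proj_NR v" and v: "\<And>i j. ?r i j \<Longrightarrow> v $ i = v $ j" by blast
    obtain \<epsilon> where \<epsilon>: "\<epsilon> > 0" "(\<lambda>i. x i + \<epsilon> * v $ i) \<in> sols Q"
      using sols_perturb[OF fin x, of "($) v", OF v] by blast
    define b where "b = proj_NR (\<chi> i. x i + \<epsilon> * v $ i) + p"
    have bK: "b \<in> K" unfolding b_def using sub[OF \<epsilon>(2)] .
    have "(\<chi> i. x i + \<epsilon> * v $ i) = (\<chi> i. x i) + \<epsilon> *\<^sub>R v" by (simp add: vec_eq_iff)
    then have b: "b = a + \<epsilon> *\<^sub>R d" unfolding b_def a_def d by (simp add: proj_NR_scaleR flip: proj_NR_add)
    \<comment> \<open>The factor \<open>1 / \<epsilon>\<close> stretches the short step from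
      \<open>a\<close> to \<open>b\<close> to the full vector \<open>d\<close>.\<close>
    have "(1 - 1 / \<epsilon>) *\<^sub>R a + (1 / \<epsilon>) *\<^sub>R b \<in> affine hull K"
      by (intro mem_affine[OF affine_affine_hull] hull_inc aK bK) simp
    also have "(1 - 1 / \<epsilon>) *\<^sub>R a + (1 / \<epsilon>) *\<^sub>R b = a + d"
      using \<epsilon>(1) unfolding b by (simp add: algebra_simps)
    finally have "a + d \<in> affine hull K" .
    moreover have "a \<in> affine hull K" using aK by (rule hull_inc)
    moreover have "d = (a + d) - a" by simp
    ultimately show "d \<in> {y - z | y z. y \<in> affine hull K \<and> z \<in> affine hull K}" by blast
  qed
  then have "convex_dim K = dim ?V" unfolding convex_dim_def by (simp only:)
  also have "\<dots> = card T - 1"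
    by (rule dim_class_constant[OF diff_const_refl diff_const_sym diff_const_trans T])
  finally show ?thesis .
qed

text \<open>The constraints say that \<open>x + s\<close> is ordered by \<open>l\<close>. With
  \<open>s = 0\<close> and \<open>s = w\<close> both flags of a cell are described in the same
  variable \<open>x\<close>.\<close>

definition order_constraints :: "('n \<Rightarrow> nat) \<Rightarrow> ('n \<Rightarrow> real) \<Rightarrow> 'n difference_constraint set" where
  "order_constraints l s = {(True, i, j, s j - s i) | i j. l i = l j} \<union>
     {(False, i, j, s j - s i) | i j. l i < l j}"

lemma finite_order_constraints:
  fixes l :: "'n::finite \<Rightarrow> nat"
  shows "finite (order_constraints l s)"
proof -
  have "order_constraints l s \<subseteq> (\<lambda>(b, i, j). (b, i, j, s j - s i)) ` UNIV"
    unfolding order_constraints_def by (force simp: image_iff)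
  then show ?thesis by (rule finite_subset) simp
qed

lemma sols_order_constraints:
  "x \<in> sols (order_constraints (level Fs) s) \<longleftrightarrow> adapted Fs (\<lambda>i. x i + s i)"
proof
  assume x: "x \<in> sols (order_constraints (level Fs) s)"
  show "adapted Fs (\<lambda>i. x i + s i)"
    unfolding adapted_iff
  proof (intro allI conjI impI)
    fix i j
    show "x i + s i < x j + s j" if "level Fs i < level Fs j"
    proof -
      have "(False, i, j, s j - s i) \<in> order_constraints (level Fs) s"
        using that unfolding order_constraints_def by simp
      then have "sat x (False, i, j, s j - s i)" using x unfolding sols_def by blast
      then show ?thesis by simp
    qed
    show "x i + s i = x j + s j" if "level Fs i = level Fs j"
    proof -
      have "(True, i, j, s j - s i) \<in> order_constraints (level Fs) s"
        using that unfolding order_constraints_def by simp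
      then have "sat x (True, i, j, s j - s i)" using x unfolding sols_def by blast
      then show ?thesis by simp
    qed
  qed
next
  assume a: "adapted Fs (\<lambda>i. x i + s i)"
  have "sat x q" if q: "q \<in> order_constraints (level Fs) s" for q
  proof -
    obtain b i j c where qq: "q = (b, i, j, c)" by (cases q)
    show ?thesis
    proof (cases b)
      case True
      then have "level Fs i = level Fs j" "c = s j - s i" using q unfolding qq order_constraints_def by auto
      then show ?thesis using adapted_eq[OF a, of i j] True unfolding qq by simp
    next
      case False
      then have "level Fs i < level Fs j" "c = s j - s i" using q unfolding qq order_constraints_def by auto
      then have "x i + s i < x j + s j" using a unfolding adapted_def by blast
      then show ?thesis using \<open>c = s j - s i\<close> False unfolding qq by simp
    qed
  qed
  then show "x \<in> sols (order_constraints (level Fs) s)" unfolding sols_def by blast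
qed

section \<open>Cells of the common refinement\<close>

lemma nth_vec_lambda: "($) (\<chi> i. f i) = f"
  by (simp add: fun_eq_iff)

lemma nth_vec_add: "($) (x + w) = (\<lambda>i. x $ i + w $ i)"
  by (simp add: fun_eq_iff)

lemma diff_const_transversal: "\<exists>T. transversal (diff_const P) UNIV T"
  by (rule transversal_exists) (blast intro: diff_const_refl diff_const_sym diff_const_trans)+

definition cell :: "'n set list \<Rightarrow> 'n set list \<Rightarrow> ('n \<Rightarrow> real) \<Rightarrow> ('n \<Rightarrow> real) set" where
  "cell F G w = {x. adapted F x \<and> adapted G (\<lambda>i. x i + w i)}"

definition cell_constraints :: "'n set list \<Rightarrow> 'n set list \<Rightarrow> ('n \<Rightarrow> real) \<Rightarrow> 'n difference_constraint set" where
  "cell_constraints F G w = order_constraints (level F) (\<lambda>i. 0) \<union> order_constraints (level G) w"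

lemma cell_sols: "sols (cell_constraints F G w) = cell F G w"
  unfolding cell_constraints_def sols_Un cell_def
  by (auto simp: sols_order_constraints)

lemma finite_cell_constraints: "finite (cell_constraints F G (w :: 'n::finite \<Rightarrow> real))"
  unfolding cell_constraints_def using finite_order_constraints by blast

lemma adapted_midpoint:
  assumes "weakly_adapted F z" "adapted F x"
  shows "adapted F (\<lambda>i. (z i + x i) / 2)"
proof -
  have "adapted F (\<lambda>i. (1 / 2) * (x i + z i))"
    by (intro adapted_scale adapted_add assms) simp
  then show ?thesis by (simp add: add.commute)
qed

lemma convex_dim_flag_cone:
  fixes F :: "'n::finite set list"
  assumes F: "F \<in> flags"
  shows "convex_dim (flag_cone F) = length F"
proof -
  let ?Q = "order_constraints (level F) (\<lambda>i. 0)"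
  have s: "x \<in> sols ?Q \<longleftrightarrow> adapted F x" for x
    using sols_order_constraints[of x F "\<lambda>i. 0"] by simp
  have dc: "diff_const (sols ?Q) i j \<longleftrightarrow> level F i = level F j" for i j
  proof
    assume "diff_const (sols ?Q) i j"
    then obtain c where c: "\<And>x. x \<in> sols ?Q \<Longrightarrow> x i - x j = c" unfolding diff_const_def by blast
    \<comment> \<open>The level vector and its double have the same difference at \<open>i\<close>
      and \<open>j\<close> only if it is 0.\<close>
    have "(\<lambda>i. real (level F i)) \<in> sols ?Q" "(\<lambda>i. 2 * real (level F i)) \<in> sols ?Q"
      unfolding s by (auto intro: adapted_level adapted_scale)
    from c[OF this(1)] c[OF this(2)] show "level F i = level F j" by simp
  next
    assume "level F i = level F j"
    then have "\<forall>x\<in>sols ?Q. x i - x j = 0" using adapted_eq[of F _ i j] s by simp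
    then show "diff_const (sols ?Q) i j" unfolding diff_const_def by blast
  qed
  obtain T where T: "transversal (diff_const (sols ?Q)) UNIV T"
    using diff_const_transversal by blast
  have "convex_dim (flag_cone F) = card T - 1"
  proof (rule convex_dim_eq[OF finite_order_constraints, where p = 0])
    show "sols ?Q \<noteq> {}" using adapted_level s by blast
    show "proj_NR (\<chi> i. x i) + 0 \<in> flag_cone F" if "x \<in> sols ?Q" for x
      using that unfolding s add_0_right flag_cone_iff[OF F] nth_vec_lambda by (rule adapted_imp_weakly)
    show "(\<lambda>i. (z $ i + x i) / 2) \<in> sols ?Q" if "proj_NR z + 0 \<in> flag_cone F" "x \<in> sols ?Q" for z x
      using that unfolding s add_0_right flag_cone_iff[OF F] by (rule adapted_midpoint)
  qed (rule T)
  also have "card T = card (range (level F))"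
  proof (rule bij_betw_same_card)
    show "bij_betw (level F) T (range (level F))"
      unfolding bij_betw_def
    proof
      show "inj_on (level F) T" using T unfolding transversal_def dc inj_on_def by blast
      show "level F ` T = range (level F)"
      proof
        show "range (level F) \<subseteq> level F ` T"
        proof
          fix k assume "k \<in> range (level F)"
          then obtain i where i: "k = level F i" by blast
          obtain t where "t \<in> T" "level F i = level F t" using T unfolding transversal_def dc by blast
          then show "k \<in> level F ` T" using i by blast
        qed
      qed auto
    qed
  qed
  finally show ?thesis unfolding range_level[OF F] by simp
qed

lemma mem_translate_flag_cone:
  fixes F :: "'n::finite set list"
  assumes "F \<in> flags"
  shows "proj_NR z + proj_NR w \<in> translate (flag_cone F) (proj_NR w) \<longleftrightarrow> weakly_adapted F (($) z)"
  unfolding translate_def flag_cone_iff[OF assms, symmetric] by auto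

text \<open>A nonempty cell is the relatively open part of the closed intersection: averaging a
  point of the cell with a closed point keeps all strict comparisons. Hence both have the same
  dimension.\<close>

lemma convex_dim_cell:
  fixes F G :: "'n::finite set list" and w :: "real ^ 'n"
  assumes F: "F \<in> flags" and G: "G \<in> flags" and ne: "cell F G (($) w) \<noteq> {}"
    and T: "transversal (diff_const (cell F G (($) w))) UNIV T"
  shows "convex_dim (translate (flag_cone F) (proj_NR w) \<inter> flag_cone G) = card T - 1"
proof (rule convex_dim_eq[OF finite_cell_constraints[of F G "($) w"], where p = "proj_NR w", unfolded cell_sols])
  fix x assume x: "x \<in> cell F G (($) w)"
  have "proj_NR (\<chi> i. x i) + proj_NR w \<in> flag_cone G"
    using x unfolding proj_NR_add flag_cone_iff[OF G] cell_def nth_vec_add vec_lambda_beta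
    by (simp add: adapted_imp_weakly)
  moreover have "proj_NR (\<chi> i. x i) + proj_NR w \<in> translate (flag_cone F) (proj_NR w)"
    using x unfolding mem_translate_flag_cone[OF F] cell_def nth_vec_lambda
    by (simp add: adapted_imp_weakly)
  ultimately show "proj_NR (\<chi> i. x i) + proj_NR w \<in> translate (flag_cone F) (proj_NR w) \<inter> flag_cone G"
    by blast
next
  fix z x assume z: "proj_NR z + proj_NR w \<in> translate (flag_cone F) (proj_NR w) \<inter> flag_cone G"
    and x: "x \<in> cell F G (($) w)"
  have "adapted F (\<lambda>i. (z $ i + x i) / 2)"
    using z x unfolding Int_iff mem_translate_flag_cone[OF F] cell_def by (intro adapted_midpoint) auto
  moreover have "adapted G (\<lambda>i. ((z + w) $ i + (x i + w $ i)) / 2)"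
  proof (rule adapted_midpoint)
    show "weakly_adapted G (($) (z + w))"
      using z unfolding Int_iff proj_NR_add flag_cone_iff[OF G] by blast
    show "adapted G (\<lambda>i. x i + w $ i)" using x unfolding cell_def by blast
  qed
  then have "adapted G (\<lambda>i. (z $ i + x i) / 2 + w $ i)" by (simp add: field_simps)
  ultimately show "(\<lambda>i. (z $ i + x i) / 2) \<in> cell F G (($) w)" unfolding cell_def by simp
qed (rule ne, rule T)

text \<open>From a relatively interior point one can step back a little against the level vector
  \<open>v\<close> and stay in the cone. Undoing the step, which is strict between levels, orders
  the coordinates strictly.\<close>

lemma rel_interior_flag_cone:
  fixes F :: "'n::finite set list"
  assumes F: "F \<in> flags" and z: "proj_NR x \<in> rel_interior (flag_cone F)"
  shows "adapted F (($) x)"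
proof -
  obtain U where U: "openin (top_of_set (affine hull flag_cone F)) U" "proj_NR x \<in> U" "U \<subseteq> flag_cone F"
    using z unfolding rel_interior_def by blast
  then obtain V where V: "open V" "U = affine hull flag_cone F \<inter> V" unfolding openin_open by blast
  have wx: "weakly_adapted F (($) x)" using U flag_cone_iff[OF F] by blast
  define v :: "real ^ 'n" where "v = (\<chi> i. real (level F i))"
  have v: "weakly_adapted F (($) v)" unfolding v_def nth_vec_lambda by (rule adapted_imp_weakly[OF adapted_level])
  have hull: "proj_NR (x - \<epsilon> *\<^sub>R v) \<in> affine hull flag_cone F" for \<epsilon>
  proof -
    have "weakly_adapted F (($) (x + v))"
      using weakly_adapted_add[OF wx v] by (simp only: vector_add_component[symmetric])
    then have "proj_NR x \<in> flag_cone F" "proj_NR (x + v) \<in> flag_cone F" using wx flag_cone_iff[OF F] by blast+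
    then have "(1 + \<epsilon>) *\<^sub>R proj_NR x + (- \<epsilon>) *\<^sub>R proj_NR (x + v) \<in> affine hull flag_cone F"
      by (intro mem_affine[OF affine_affine_hull] hull_inc) auto
    moreover have "(1 + \<epsilon>) *\<^sub>R x + (- \<epsilon>) *\<^sub>R (x + v) = x - \<epsilon> *\<^sub>R v" by (simp add: algebra_simps)
    ultimately show ?thesis by (simp only: proj_NR_scaleR proj_NR_add)
  qed
  have "open (proj_NR -` V)" using V(1) unfolding open_NR_def .
  moreover have "x \<in> proj_NR -` V" using U V by simp
  moreover have "((\<lambda>\<epsilon>. x - \<epsilon> *\<^sub>R v) \<longlongrightarrow> x - 0 *\<^sub>R v) (at_right 0)" by (intro tendsto_intros)
  ultimately have "\<forall>\<^sub>F \<epsilon> in at_right 0. x - \<epsilon> *\<^sub>R v \<in> proj_NR -` V"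
    by (intro topological_tendstoD) simp_all
  then have "\<forall>\<^sub>F \<epsilon> in at_right (0::real). \<epsilon> > 0 \<and> x - \<epsilon> *\<^sub>R v \<in> proj_NR -` V"
    using eventually_at_right_less[of 0] by eventually_elim simp
  then obtain \<epsilon> where \<epsilon>: "\<epsilon> > 0" "proj_NR (x - \<epsilon> *\<^sub>R v) \<in> V"
    using eventually_happens trivial_limit_at_right_real by blast
  then have "proj_NR (x - \<epsilon> *\<^sub>R v) \<in> flag_cone F" using hull U V by blast
  then have "weakly_adapted F (($) (x - \<epsilon> *\<^sub>R v))" unfolding flag_cone_iff[OF F] .
  moreover have "adapted F (\<lambda>i. \<epsilon> * real (level F i))" by (intro adapted_scale adapted_level \<epsilon>(1))
  ultimately have "adapted F (\<lambda>i. \<epsilon> * real (level F i) + (x - \<epsilon> *\<^sub>R v) $ i)" by (intro adapted_add)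
  then show ?thesis unfolding v_def by simp
qed

section \<open>Consequences of genericity\<close>

lemma generic_cell:
  fixes F G :: "'n::finite set list" and w :: "real ^ 'n"
  assumes gen: "generic (proj_NR w)" and F: "F \<in> flags" and G: "G \<in> flags"
    and meet: "translate (flag_cone F) (proj_NR w) \<inter> flag_cone G \<noteq> {}"
  shows "cell F G (($) w) \<noteq> {}"
    and "int (convex_dim (translate (flag_cone F) (proj_NR w) \<inter> flag_cone G)) =
      int (length F) + int (length G) - int CARD('n) + 1"
proof -
  have g: "translate (rel_interior (flag_cone F)) (proj_NR w) \<inter> rel_interior (flag_cone G) \<noteq> {}"
    "int (convex_dim (translate (flag_cone F) (proj_NR w) \<inter> flag_cone G)) =
      int (convex_dim (flag_cone F)) + int (convex_dim (flag_cone G)) - (int CARD('n) - 1)"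
    using gen meet F G unfolding generic_def permutohedral_fan_def by auto
  show "int (convex_dim (translate (flag_cone F) (proj_NR w) \<inter> flag_cone G)) =
      int (length F) + int (length G) - int CARD('n) + 1"
    using g(2) unfolding convex_dim_flag_cone[OF F] convex_dim_flag_cone[OF G] by simp
  obtain y where "y \<in> rel_interior (flag_cone F)" "y + proj_NR w \<in> rel_interior (flag_cone G)"
    using g(1) unfolding translate_def by auto
  moreover obtain x where "y = proj_NR x" by (rule proj_NR_cases)
  ultimately have "adapted F (($) x)" "adapted G (($) (x + w))"
    using rel_interior_flag_cone F G by (auto simp: proj_NR_add)
  then have "($) x \<in> cell F G (($) w)" unfolding cell_def nth_vec_add by simp
  then show "cell F G (($) w) \<noteq> {}" by blast
qed

lemma cell_meets:
  fixes F G :: "'n::finite set list" and w :: "real ^ 'n"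
  assumes F: "F \<in> flags" and G: "G \<in> flags" and x: "x \<in> cell F G (($) w)"
  shows "translate (flag_cone F) (proj_NR w) \<inter> flag_cone G \<noteq> {}"
proof -
  have "proj_NR (\<chi> i. x i) + proj_NR w \<in> translate (flag_cone F) (proj_NR w)"
    using x unfolding mem_translate_flag_cone[OF F] cell_def nth_vec_lambda
    by (simp add: adapted_imp_weakly)
  moreover have "proj_NR (\<chi> i. x i) + proj_NR w \<in> flag_cone G"
    using x unfolding proj_NR_add flag_cone_iff[OF G] cell_def nth_vec_add vec_lambda_beta
    by (simp add: adapted_imp_weakly)
  ultimately show ?thesis by blast
qed

text \<open>A generic \<open>w\<close> has distinct coordinates: otherwise some cone meets its own translate in a set
  of the same dimension.\<close>

lemma generic_inj:
  fixes w :: "real ^ 'n::finite"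
  assumes gen: "generic (proj_NR w)"
  shows "inj (($) w)"
proof (rule injI, rule ccontr)
  fix i j assume ij: "w $ i = w $ j" "i \<noteq> j"
  obtain f :: "'n \<Rightarrow> nat" where f: "inj f" using finite_imp_inj_to_nat_seg[of "UNIV :: 'n set"] by auto
  \<comment> \<open>Separates all indices except \<open>i\<close> and \<open>j\<close>, so its flag
    has the single nontrivial block \<open>{i, j}\<close>, on which \<open>w\<close> is
    constant.\<close>
  define g where "g = (\<lambda>k. f (if k = j then i else k))"
  \<comment> \<open>Larger than every difference of coordinates of \<open>w\<close>: once the gaps
    of \<open>g\<close> are scaled by \<open>N\<close>, adding \<open>w\<close> changes no
    comparison.\<close>
  define N where "N = 1 + 2 * Max (range (\<lambda>k. \<bar>w $ k\<bar>))"
  have wb: "\<bar>w $ k\<bar> \<le> Max (range (\<lambda>k. \<bar>w $ k\<bar>))" for k by simp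
  have wd: "w $ k - w $ l < N" for k l using wb[of k] wb[of l] unfolding N_def by linarith
  have "N > 0" using wd[of i i] by simp
  have weq: "w $ k = w $ l" if "g k = g l" for k l
    using that ij injD[OF f] unfolding g_def by (auto split: if_splits dest: injD[OF f])
  define x where "x = (\<lambda>k. N * real (g k))"
  have lt: "c * x k + w $ k < c * x l + w $ l \<longleftrightarrow> g k < g l" if c: "c \<ge> 1" for c k l
  proof -
    have *: "c * x k + w $ k < c * x l + w $ l" if "g k < g l" for k l
    proof -
      have "real (g k) + 1 \<le> real (g l)" using that by simp
      then have "N * 1 \<le> N * (real (g l) - real (g k))" using \<open>N > 0\<close> by (intro mult_left_mono) auto
      then have "N \<le> x l - x k" unfolding x_def by (simp add: right_diff_distrib)
      moreover have "1 * (x l - x k) \<le> c * (x l - x k)" using c \<open>N > 0\<close> calculation by (intro mult_right_mono) auto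
      ultimately show ?thesis using wd[of k l] by (simp add: right_diff_distrib)
    qed
    have "\<not> c * x k + w $ k < c * x l + w $ l" if "g k = g l"
      using weq[OF that] that unfolding x_def by simp
    then show ?thesis using *[of k l] *[of l k] by (cases "g k" "g l" rule: linorder_cases) auto
  qed
  have ltx: "x k < x l \<longleftrightarrow> g k < g l" for k l unfolding x_def using \<open>N > 0\<close> by simp
  obtain F where F: "F \<in> flags" "adapted F x" using adapted_flag_exists by blast
  have lv: "level F k < level F l \<longleftrightarrow> g k < g l" for k l using F(2) ltx unfolding adapted_def by blast
  have mem: "(\<lambda>k. c * x k) \<in> cell F F (($) w)" if "c \<ge> 1" for c
  proof -
    have "adapted F (\<lambda>k. c * x k + w $ k)" unfolding adapted_def lv using lt[OF that] by blast
    moreover have "adapted F (\<lambda>k. c * x k)" using F(2) that by (intro adapted_scale) auto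
    ultimately show ?thesis unfolding cell_def by simp
  qed
  let ?P = "cell F F (($) w)"
  have dc: "diff_const ?P k l \<longleftrightarrow> level F k = level F l" for k l
  proof
    assume "diff_const ?P k l"
    then obtain c where c: "\<And>x. x \<in> ?P \<Longrightarrow> x k - x l = c" unfolding diff_const_def by blast
    \<comment> \<open>Both \<open>x\<close> and its double lie in the cell, so a constant difference
      must be 0.\<close>
    have "x k = x l" using c[OF mem[of 1]] c[OF mem[of 2]] by simp
    then show "level F k = level F l" using F(2) unfolding adapted_def by (metis less_irrefl linorder_neqE)
  next
    assume "level F k = level F l"
    then have "\<forall>x\<in>?P. x k - x l = 0" using adapted_eq[of F _ k l] unfolding cell_def by simp
    then show "diff_const ?P k l" unfolding diff_const_def by blast
  qed
  obtain T where T: "transversal (diff_const ?P) UNIV T"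
    using diff_const_transversal by blast
  have ne: "?P \<noteq> {}" using mem[of 1] by blast
  have "card T = card (range (level F))"
  proof (rule bij_betw_same_card)
    show "bij_betw (level F) T (range (level F))"
      unfolding bij_betw_def
    proof
      show "inj_on (level F) T" using T unfolding transversal_def dc inj_on_def by blast
      show "level F ` T = range (level F)"
      proof
        show "range (level F) \<subseteq> level F ` T"
        proof
          fix k assume "k \<in> range (level F)"
          then obtain i where i: "k = level F i" by blast
          obtain t where "t \<in> T" "level F i = level F t" using T unfolding transversal_def dc by blast
          then show "k \<in> level F ` T" using i by blast
        qed
      qed auto
    qed
  qed
  then have cT: "card T = Suc (length F)" unfolding range_level[OF F(1)] by simp
  \<comment> \<open>The cell has the dimension \<open>length F\<close> of the cone itself. The
    dimension formula then forces \<open>length F = CARD('n) - 1\<close>, so all levels are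
    distinct; yet \<open>i\<close> and \<open>j\<close> share one.\<close>
  have "int (card T - 1) = int (length F) + int (length F) - int CARD('n) + 1"
    using generic_cell(2)[OF gen F(1) F(1) cell_meets[OF F(1) F(1) mem[of 1]]]
    unfolding convex_dim_cell[OF F(1) F(1) ne T] by simp
  then have "CARD('n) = card (range (level F))" unfolding range_level[OF F(1)] using cT by simp
  then have "inj (level F)" by (intro eq_card_imp_inj_on) auto
  moreover have "level F i = level F j" using lv[of i j] lv[of j i] unfolding g_def by simp
  ultimately show False using ij(2) by (auto dest: injD)
qed

text \<open>A nonzero vector common to both cones spans a ray in the cell. Conversely, if some
  difference with \<open>x j\<close> is unbounded above, the coordinates with this property form an
  up-set for both level orders, and its indicator is a nonzero common vector.\<close>

lemma cell_bounded_iff: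
  fixes F G :: "'n::finite set list"
  assumes F: "F \<in> flags" and G: "G \<in> flags" and p: "p \<in> cell F G w"
  shows "(\<forall>i j. diff_bdd (cell F G w) i j) \<longleftrightarrow> flag_cone F \<inter> flag_cone G = {0}"
proof
  assume b: "\<forall>i j. diff_bdd (cell F G w) i j"
  have "z = 0" if z: "z \<in> flag_cone F" "z \<in> flag_cone G" for z
  proof -
    obtain v where v: "z = proj_NR v" by (rule proj_NR_cases)
    have wv: "weakly_adapted F (($) v)" "weakly_adapted G (($) v)"
      using z v flag_cone_iff F G by blast+
    have mem: "(\<lambda>i. p i + t * v $ i) \<in> cell F G w" if "t \<ge> 0" for t
    proof -
      have "adapted F (\<lambda>i. p i + t * v $ i)"
        using p wv that unfolding cell_def by (intro adapted_add weakly_adapted_scale) auto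
      moreover have "adapted G (\<lambda>i. (p i + w i) + t * v $ i)"
        using p wv that unfolding cell_def
        by (intro adapted_add[of G "\<lambda>i. p i + w i"] weakly_adapted_scale) auto
      ultimately show ?thesis unfolding cell_def by (simp add: algebra_simps)
    qed
    have le: "v $ i \<le> v $ j" for i j
    proof (rule ccontr)
      assume "\<not> v $ i \<le> v $ j"
      then have d: "v $ i - v $ j > 0" by simp
      obtain B where B: "\<And>x. x \<in> cell F G w \<Longrightarrow> x i - x j \<le> B" using b unfolding diff_bdd_def by blast
      define t where "t = (\<bar>B - (p i - p j)\<bar> + 1) / (v $ i - v $ j)"
      have "t \<ge> 0" unfolding t_def using d by simp
      have "t * (v $ i - v $ j) = \<bar>B - (p i - p j)\<bar> + 1" unfolding t_def using d by simp
      then show False using B[OF mem[OF \<open>t \<ge> 0\<close>]] by (simp add: right_diff_distrib)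
    qed
    have "v $ i = v $ undefined" for i by (rule order_antisym; rule le)
    then have "proj_NR v = proj_NR 0" unfolding proj_NR_eq_iff by (intro exI[of _ "v $ undefined"]) simp
    then show ?thesis using v proj_NR_zero by simp
  qed
  moreover have "(0 :: 'n NR) \<in> flag_cone H" if "H \<in> flags" for H
    unfolding proj_NR_zero[symmetric] flag_cone_iff[OF that] weakly_adapted_def by simp
  ultimately show "flag_cone F \<inter> flag_cone G = {0}" using F G by blast
next
  assume z: "flag_cone F \<inter> flag_cone G = {0}"
  show "\<forall>i j. diff_bdd (cell F G w) i j"
  proof (rule ccontr)
    assume "\<not> (\<forall>i j. diff_bdd (cell F G w) i j)"
    then obtain i j where ij: "\<not> diff_bdd (cell F G w) i j" by blast
    define U where "U = {k. \<not> diff_bdd (cell F G w) k j}"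
    have up: "l \<in> U" if "k \<in> U" "diff_bdd (cell F G w) k l" for k l
      using that diff_bdd_trans[of "cell F G w" k l j] unfolding U_def by blast
    have le: "x k \<le> x l" if "adapted H x" "level H k \<le> level H l" for H x k l
      using adapted_imp_weakly[OF that(1)] that(2) unfolding weakly_adapted_def by blast
    have "diff_bdd (cell F G w) k l" if kl: "level F k \<le> level F l" for k l
      unfolding diff_bdd_def
    proof (intro exI[of _ 0] ballI)
      fix x assume "x \<in> cell F G w"
      then show "x k - x l \<le> 0" using le[of F x, OF _ kl] unfolding cell_def by simp
    qed
    then have "weakly_adapted F (($) (\<chi> k. of_bool (k \<in> U)))"
      unfolding weakly_adapted_def using up by auto
    then have zF: "proj_NR (\<chi> k. of_bool (k \<in> U)) \<in> flag_cone F" unfolding flag_cone_iff[OF F] .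
    have "diff_bdd (cell F G w) k l" if kl: "level G k \<le> level G l" for k l
      unfolding diff_bdd_def
    proof (intro exI[of _ "w l - w k"] ballI)
      fix x assume "x \<in> cell F G w"
      then show "x k - x l \<le> w l - w k" using le[of G "\<lambda>i. x i + w i", OF _ kl] unfolding cell_def by simp
    qed
    then have "weakly_adapted G (($) (\<chi> k. of_bool (k \<in> U)))"
      unfolding weakly_adapted_def using up by auto
    then have "proj_NR (\<chi> k. of_bool (k \<in> U)) \<in> flag_cone G" unfolding flag_cone_iff[OF G] .
    with zF have "proj_NR (\<chi> k. of_bool (k \<in> U)) \<in> {0}" unfolding z[symmetric] by (rule IntI)
    then have "proj_NR (\<chi> k. of_bool (k \<in> U)) = proj_NR 0" unfolding proj_NR_zero by (rule singletonD)
    then obtain c where c: "\<And>k. of_bool (k \<in> U) = (c :: real)" unfolding proj_NR_eq_iff by auto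
    have "i \<in> U" "j \<notin> U" using ij diff_bdd_refl[of "cell F G w" j] unfolding U_def by simp_all
    then show False using c[of i] c[of j] by simp
  qed
qed

text \<open>Coordinates are comparable through \<open>F\<close> alone, which rules out the line
  fibres excluded in \<open>iter_int_sols\<close>. Genericity rewrites \<open>card T - 1\<close> in
  terms of lengths, which shows that this exponent is nonnegative. The order \<open>es\<close> of
  all coordinates is arbitrary.\<close>

lemma iter_int_cell:
  fixes F G :: "'n::finite set list" and w :: "real ^ 'n"
  assumes gen: "generic (proj_NR w)" and F: "F \<in> flags" and G: "G \<in> flags"
    and ne: "cell F G (($) w) \<noteq> {}" and es: "distinct es" "set es = UNIV"
  shows "iter_tame es (\<lambda>x. of_bool (x \<in> cell F G (($) w)))"
    and "flag_cone F \<inter> flag_cone G = {0} \<Longrightarrow>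
      iter_int es (\<lambda>x. of_bool (x \<in> cell F G (($) w))) =
        (\<lambda>x. (- 1) ^ nat (int (length F) + int (length G) - int CARD('n) + 1)) \<and>
      0 \<le> int (length F) + int (length G) - int CARD('n) + 1"
    and "flag_cone F \<inter> flag_cone G \<noteq> {0} \<Longrightarrow>
      iter_int es (\<lambda>x. of_bool (x \<in> cell F G (($) w))) = (\<lambda>x. 0)"
proof -
  let ?P = "cell F G (($) w)" and ?m = "int (length F) + int (length G) - int CARD('n) + 1"
  have tot: "diff_bdd ?P i j \<or> diff_bdd ?P j i" for i j
  proof -
    have "diff_bdd ?P k l" if kl: "level F k \<le> level F l" for k l
      unfolding diff_bdd_def
    proof (intro exI[of _ 0] ballI)
      fix x assume "x \<in> ?P"
      then have "weakly_adapted F x" unfolding cell_def using adapted_imp_weakly by blast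
      then show "x k - x l \<le> 0" using kl unfolding weakly_adapted_def by simp
    qed
    then show ?thesis using linear[of "level F i" "level F j"] by blast
  qed
  have I: "iter_tame es (\<lambda>x. of_bool (x \<in> ?P)) \<and>
    (if \<forall>i\<in>set es. \<forall>j\<in>set es. diff_bdd ?P i j
     then \<exists>T. transversal (diff_const ?P) (set es) T \<and>
       iter_int es (\<lambda>x. of_bool (x \<in> ?P)) = (\<lambda>x. (- 1) ^ (card T - 1))
     else iter_int es (\<lambda>x. of_bool (x \<in> ?P)) = (\<lambda>x. 0))"
    unfolding cell_sols[symmetric]
  proof (rule iter_int_sols[OF es(1) _ finite_cell_constraints])
    show "es \<noteq> []" using es(2) by auto
    show "over (set es) (cell_constraints F G (($) w))" unfolding over_def es(2) by auto
    show "sols (cell_constraints F G (($) w)) \<noteq> {}" unfolding cell_sols by (rule ne)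
    show "diff_bdd (sols (cell_constraints F G (($) w))) i j \<or> diff_bdd (sols (cell_constraints F G (($) w))) j i" for i j
      unfolding cell_sols by (rule tot)
  qed
  then show "iter_tame es (\<lambda>x. of_bool (x \<in> ?P))" by blast
  obtain p where p: "p \<in> ?P" using ne by blast
  have b: "(\<forall>i\<in>set es. \<forall>j\<in>set es. diff_bdd ?P i j) \<longleftrightarrow> flag_cone F \<inter> flag_cone G = {0}"
    unfolding es(2) using cell_bounded_iff[OF F G p] by simp
  note I' = conjunct2[OF I, unfolded b]
  show "iter_int es (\<lambda>x. of_bool (x \<in> ?P)) = (\<lambda>x. 0)" if "flag_cone F \<inter> flag_cone G \<noteq> {0}"
    using I' that by simp
  show "iter_int es (\<lambda>x. of_bool (x \<in> ?P)) = (\<lambda>x. (- 1) ^ nat ?m) \<and> 0 \<le> ?m"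
    if bd: "flag_cone F \<inter> flag_cone G = {0}"
  proof -
    obtain T where T: "transversal (diff_const ?P) UNIV T"
      "iter_int es (\<lambda>x. of_bool (x \<in> ?P)) = (\<lambda>x. (- 1) ^ (card T - 1))"
      using I'[unfolded if_P[OF bd] es(2)] by blast
    have "int (card T - 1) = ?m"
      using generic_cell(2)[OF gen F G cell_meets[OF F G p]] convex_dim_cell[OF F G ne T(1)] by simp
    then have "nat ?m = card T - 1" "0 \<le> ?m" by linarith+
    then show ?thesis using T(2) by simp
  qed
qed

section \<open>Flag values as sums over subsets\<close>

lemma chain_steps:
  assumes "sorted_wrt (\<subset>) (A # Fs)" "(X, Y) \<in> set (zip (A # Fs) (Fs @ [UNIV]))"
  shows "X \<in> set (A # Fs) \<and> (\<forall>U\<in>set (A # Fs). U \<subseteq> X \<or> Y \<subseteq> U)"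
  using assms
proof (induction Fs arbitrary: A)
  case (Cons F Fs)
  show ?case
  proof (cases "(X, Y) = (A, F)")
    case True
    then show ?thesis using Cons.prems(1) by auto
  next
    case False
    then have XY: "(X, Y) \<in> set (zip (F # Fs) (Fs @ [UNIV]))" using Cons.prems(2) by auto
    have ch: "sorted_wrt (\<subset>) (F # Fs)" using Cons.prems(1) by simp
    note IH = Cons.IH[OF ch XY]
    then have "A \<subseteq> X" using Cons.prems(1) by auto
    then show ?thesis using IH by simp
  qed
qed auto

lemma empty_flag_chain: "F \<in> flags \<Longrightarrow> sorted_wrt (\<subset>) ({} # F)"
  unfolding flags_def by auto

lemma flag_value_indep_poly:
  fixes M :: "'n::finite indep_structure" and u :: "'k::comm_ring_1"
  assumes M: "matroid M" and g: "ground M = UNIV" and F: "F \<in> flags"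
  shows "flag_value (indep_poly u) M F = (\<Sum>I | \<forall>X\<in>set ({} # F). indep_over M X I. u ^ card I)"
  unfolding flag_value_def g prod_indep_poly_chain[OF M g empty_flag_chain[OF F]] by simp

text \<open>The loops of the initial matroid for \<open>G\<close>: elements of strictly higher level
  than \<open>e\<close> make up the largest member of \<open>G\<close> avoiding \<open>e\<close>, or
  the empty set.\<close>

definition flag_loops :: "'n indep_structure \<Rightarrow> 'n set list \<Rightarrow> 'n set" where
  "flag_loops M G = {e. spanned M e {j. level G e < level G j}}"

lemma flag_value_loop_poly:
  fixes M :: "'n::finite indep_structure" and v :: "'k::comm_ring_1"
  assumes M: "matroid M" and g: "ground M = UNIV" and G: "G \<in> flags"
  shows "flag_value (loop_poly v) M G = (\<Sum>A | A \<subseteq> flag_loops M G. v ^ card A)"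
proof -
  have "e \<in> flag_loops M G \<longleftrightarrow> spanned M e X"
    if XY: "(X, Y) \<in> set (zip ({} # G) (G @ [UNIV]))" and e: "e \<in> Y - X" for X Y e
  proof -
    note st = chain_steps[OF empty_flag_chain[OF G] XY]
    \<comment> \<open>No member lies strictly between \<open>X\<close> and \<open>Y\<close>, so for
      \<open>e \<in> Y - X\<close> the elements of higher level are exactly those of
      \<open>X\<close>.\<close>
    have "level G e < level G j \<longleftrightarrow> j \<in> X" for j
    proof
      assume "level G e < level G j"
      then obtain U where "U \<in> set G" "j \<in> U" "e \<notin> U" using level_less_iff[OF flagsD(1)[OF G]] by blast
      then show "j \<in> X" using st e by auto
    next
      assume "j \<in> X"
      then have "X \<in> set G" using st by auto
      then show "level G e < level G j" using \<open>j \<in> X\<close> e level_less_iff[OF flagsD(1)[OF G], of e j] by blast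
    qed
    then have "{j. level G e < level G j} = X" by blast
    then show ?thesis unfolding flag_loops_def by simp
  qed
  then have "flag_value (loop_poly v) M G = (1 + v) ^ card {e. e \<notin> {} \<and> e \<in> flag_loops M G}"
    unfolding flag_value_def g by (intro prod_loop_poly_chain[OF M g empty_flag_chain[OF G]])
  then show ?thesis by (simp add: power_one_plus_card Pow_def)
qed

text \<open>Strict superlevel sets of \<open>x\<close> are empty, everything, or members of
  \<open>F\<close>, and those of \<open>x + w\<close> follow the levels of \<open>G\<close>. So the
  tight condition is constant on a cell: it says whether the product of flag values for
  \<open>(F, G)\<close> contains the term of \<open>(I, A)\<close>.\<close>

lemma cell_tight_set:
  fixes M :: "'n::finite indep_structure"
  assumes F: "F \<in> flags" and G: "G \<in> flags" and x: "x \<in> cell F G w"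
  shows "x \<in> tight_set M w I A UNIV \<longleftrightarrow>
    (\<forall>X\<in>set ({} # F). indep_over M X I) \<and> A \<subseteq> flag_loops M G"
proof -
  have aF: "adapted F x" and aG: "adapted G (\<lambda>i. x i + w i)" using x unfolding cell_def by auto
  have "(\<forall>\<tau>. indep_over M {j. \<tau> < x j} I) \<longleftrightarrow> (\<forall>X\<in>set ({} # F). indep_over M X I)"
  proof
    assume H: "\<forall>\<tau>. indep_over M {j. \<tau> < x j} I"
    have "x j \<le> Max (range x)" for j by simp
    then have "{j. Max (range x) < x j} = {}" by (auto simp: not_less)
    then have "indep_over M {} I" using H by metis
    moreover have "indep_over M X I" if "X \<in> set F" for X
      using that H mem_flag_iff_superlevel[OF F aF, of X] by blast
    ultimately show "\<forall>X\<in>set ({} # F). indep_over M X I" by simp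
  next
    assume H: "\<forall>X\<in>set ({} # F). indep_over M X I"
    show "\<forall>\<tau>. indep_over M {j. \<tau> < x j} I"
    proof
      fix \<tau>
      consider "{j. \<tau> < x j} = {}" | "{j. \<tau> < x j} = UNIV" | "{j. \<tau> < x j} \<in> set F"
        using mem_flag_iff_superlevel[OF F aF, of "{j. \<tau> < x j}"] by blast
      then show "indep_over M {j. \<tau> < x j} I"
      proof cases
        case 1
        then show ?thesis unfolding 1 using H by simp
      next
        case 2
        show ?thesis unfolding 2 indep_over_def by simp
      next
        case 3
        then show ?thesis using H by simp
      qed
    qed
  qed
  moreover have "{j. x a + w a < x j + w j} = {j. level G a < level G j}" for a
    using aG unfolding adapted_def by simp
  ultimately show ?thesis unfolding tight_set_def flag_loops_def by auto
qed

text \<open>The tight set is the disjoint union of the cells on which the condition holds.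
  Integrating in the order found for \<open>(I, A)\<close> turns the tight set into greediness and
  each cell into its sign or 0; the cells with nonzero integral are exactly the pairs of the
  sum.\<close>

lemma signed_count:
  fixes M :: "'n::finite indep_structure" and w :: "real ^ 'n"
  assumes M: "matroid M" and gen: "generic (proj_NR w)"
  shows "(\<Sum>(F, G) \<in> {(F, G). F \<in> flags \<and> G \<in> flags \<and> flag_cone F \<inter> flag_cone G = {0} \<and>
          translate (flag_cone F) (proj_NR w) \<inter> flag_cone G \<noteq> {}}.
        of_bool ((\<forall>X\<in>set ({} # F). indep_over M X I) \<and> A \<subseteq> flag_loops M G) *
        (- 1) ^ nat (int (length F) + int (length G) - int CARD('n) + 1)) =
    (of_bool (greedy_pair M (($) w) I A) :: int)"
proof -
  define cond where "cond = (\<lambda>(F, G). (\<forall>X\<in>set ({} # F). indep_over M X I) \<and> A \<subseteq> flag_loops M G)"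
  define C where "C = {(F, G). F \<in> flags \<and> G \<in> flags \<and> cell F G (($) w) \<noteq> {}}"
  define D where "D = {(F, G). F \<in> flags \<and> G \<in> flags \<and> flag_cone F \<inter> flag_cone G = {0} \<and>
          translate (flag_cone F) (proj_NR w) \<inter> flag_cone G \<noteq> {}}"
  define P where "P = (\<lambda>(F, G). cell F G (($) w))"
  have finC: "finite C"
    by (rule finite_subset[of _ "flags \<times> flags"]) (auto simp: C_def finite_flags)
  have DC: "D \<subseteq> C"
  proof
    fix c assume "c \<in> D"
    then obtain F G where c: "c = (F, G)" "F \<in> flags" "G \<in> flags"
      "translate (flag_cone F) (proj_NR w) \<inter> flag_cone G \<noteq> {}"
      unfolding D_def by auto
    then show "c \<in> C" using generic_cell(1)[OF gen c(2,3,4)] unfolding C_def by auto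
  qed
  obtain es where es: "distinct es" "set es = UNIV"
    and E: "iter_int es (\<lambda>x. of_bool (x \<in> tight_set M (($) w) I A UNIV)) = (\<lambda>x. of_bool (greedy_pair M (($) w) I A))"
    using iter_int_tight_set[OF M] by blast
  have "of_bool (x \<in> tight_set M (($) w) I A UNIV) = (\<Sum>c\<in>C. of_bool (cond c) * of_bool (x \<in> P c) :: int)" for x
  proof -
    obtain F where F: "F \<in> flags" "adapted F x" using adapted_flag_exists by blast
    obtain G where G: "G \<in> flags" "adapted G (\<lambda>i. x i + w $ i)" using adapted_flag_exists by blast
    have x: "x \<in> cell F G (($) w)" using F G unfolding cell_def by simp
    then have FG: "(F, G) \<in> C" using F G unfolding C_def by auto
    have uniq: "c = (F, G)" if "c \<in> C" "x \<in> P c" for c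
    proof -
      obtain F' G' where c: "c = (F', G')" by (cases c)
      have "F' \<in> flags" "G' \<in> flags" "adapted F' x" "adapted G' (\<lambda>i. x i + w $ i)"
        using that unfolding c C_def P_def cell_def by auto
      then show ?thesis using adapted_flag_unique F G c by blast
    qed
    have "(\<Sum>c\<in>C. of_bool (cond c) * of_bool (x \<in> P c) :: int) =
      (\<Sum>c\<in>C. if c = (F, G) then of_bool (cond c) else 0)"
    proof (rule sum.cong[OF refl])
      fix c assume "c \<in> C"
      moreover have "x \<in> P (F, G)" using x unfolding P_def by simp
      ultimately have "x \<in> P c \<longleftrightarrow> c = (F, G)" using uniq by blast
      then show "of_bool (cond c) * of_bool (x \<in> P c) = (if c = (F, G) then of_bool (cond c) else (0 :: int))"
        by simp
    qed
    also have "\<dots> = of_bool (cond (F, G))" using finC FG by simp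
    finally show ?thesis using cell_tight_set[OF F(1) G(1) x, of M I A] unfolding cond_def by simp
  qed
  then have "(\<lambda>x. of_bool (greedy_pair M (($) w) I A)) =
      iter_int es (\<lambda>x. \<Sum>c\<in>C. of_bool (cond c) * of_bool (x \<in> P c))"
    using E by simp
  also have "\<dots> = (\<lambda>x. \<Sum>c\<in>C. of_bool (cond c) * iter_int es (\<lambda>x. of_bool (x \<in> P c)) x)"
  proof (rule iter_sum[OF finC])
    show "iter_tame es (\<lambda>x. of_bool (x \<in> P c))" if "c \<in> C" for c
      using that iter_int_cell(1)[OF gen _ _ _ es] unfolding C_def P_def by auto
  qed
  \<comment> \<open>Both sides are constant functions, so the evaluation point is arbitrary.\<close>
  finally have "of_bool (greedy_pair M (($) w) I A) =
      (\<Sum>c\<in>C. of_bool (cond c) * iter_int es (\<lambda>x. of_bool (x \<in> P c)) (\<lambda>_. 0))"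
    by (rule fun_cong)
  also have "\<dots> = (\<Sum>c\<in>D. of_bool (cond c) * iter_int es (\<lambda>x. of_bool (x \<in> P c)) (\<lambda>_. 0))"
  proof (rule sum.mono_neutral_right[OF finC DC], rule ballI)
    \<comment> \<open>A nonempty cell already makes the cones meet, so it is missing from
      \<open>D\<close> only for being unbounded, and then its integral is 0.\<close>
    fix c assume "c \<in> C - D"
    then obtain F G where c: "c = (F, G)" "F \<in> flags" "G \<in> flags" "cell F G (($) w) \<noteq> {}" "(F, G) \<notin> D"
      unfolding C_def by auto
    obtain p where "p \<in> cell F G (($) w)" using c(4) by blast
    then have "translate (flag_cone F) (proj_NR w) \<inter> flag_cone G \<noteq> {}" by (rule cell_meets[OF c(2,3)])
    then have "flag_cone F \<inter> flag_cone G \<noteq> {0}" using c(2,3,5) unfolding D_def by auto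
    then show "of_bool (cond c) * iter_int es (\<lambda>x. of_bool (x \<in> P c)) (\<lambda>_. 0) = 0"
      using iter_int_cell(3)[OF gen c(2,3,4) es] unfolding P_def c(1) by simp
  qed
  also have "\<dots> = (\<Sum>(F, G)\<in>D. of_bool ((\<forall>X\<in>set ({} # F). indep_over M X I) \<and> A \<subseteq> flag_loops M G) *
        (- 1) ^ nat (int (length F) + int (length G) - int CARD('n) + 1))"
  proof (rule sum.cong[OF refl])
    fix c assume cD: "c \<in> D"
    then obtain F G where c: "c = (F, G)" "F \<in> flags" "G \<in> flags" "flag_cone F \<inter> flag_cone G = {0}"
      unfolding D_def by auto
    have "cell F G (($) w) \<noteq> {}" using DC cD unfolding C_def c(1) by auto
    from iter_int_cell(2)[OF gen c(2,3) this es c(4)]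
    show "of_bool (cond c) * iter_int es (\<lambda>x. of_bool (x \<in> P c)) (\<lambda>_. 0) =
      (case c of (F, G) \<Rightarrow> of_bool ((\<forall>X\<in>set ({} # F). indep_over M X I) \<and> A \<subseteq> flag_loops M G) *
        (- 1) ^ nat (int (length F) + int (length G) - int CARD('n) + 1))"
      unfolding c(1) cond_def P_def prod.case by simp
  qed
  finally show ?thesis unfolding D_def by (rule sym)
qed

section \<open>Comparison of coefficients\<close>

lemma sum_filter_of_bool:
  fixes f :: "'a::finite \<Rightarrow> 'k::comm_ring_1"
  shows "(\<Sum>x | Q x. f x) = (\<Sum>x\<in>UNIV. of_bool (Q x) * f x)"
  by (rule sum.mono_neutral_cong_left) auto

theorem corollary1p9:
  fixes M :: "'n::finite indep_structure" and r :: nat and w :: "'n NR"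
    and u v :: "'k::field"
  assumes "matroid M" and "ground M = UNIV" and "loopless M" and "matroid_rank M = r"
    and "w \<in> lattice_N" and "generic w"
    and "u \<noteq> 0"
  shows "u ^ r * tutte M (1 + 1 / u) (1 + v) =
    (\<Sum>(F, G) \<in> {(F, G). F \<in> flags \<and> G \<in> flags \<and>
          flag_cone F \<inter> flag_cone G = {0} \<and>
          translate (flag_cone F) w \<inter> flag_cone G \<noteq> {}}.
       (- 1) powi (int (length F) + int (length G) - int CARD('n) + 1) *
       flag_value (indep_poly u) M F * flag_value (loop_poly v) M G)"
proof -
  note M = assms(1) and g = assms(2)
  obtain w0 where w: "w = proj_NR w0" by (rule proj_NR_cases)
  have gen: "generic (proj_NR w0)" using assms(6) unfolding w .
  define D where "D = {(F, G). F \<in> flags \<and> G \<in> flags \<and> flag_cone F \<inter> flag_cone G = {0} \<and>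
      translate (flag_cone F) w \<inter> flag_cone G \<noteq> ({} :: 'n NR set)}"
  define sgn where "sgn = (\<lambda>(F :: 'n set list, G :: 'n set list).
      (- 1 :: int) ^ nat (int (length F) + int (length G) - int CARD('n) + 1))"
  define p where "p = (\<lambda>F I. \<forall>X\<in>set ({} # F). indep_over M X I)"
  define q where "q = (\<lambda>G A. A \<subseteq> flag_loops M G)"
  have "(\<Sum>(F, G)\<in>D. (- 1) powi (int (length F) + int (length G) - int CARD('n) + 1) *
      flag_value (indep_poly u) M F * flag_value (loop_poly v) M G) =
    (\<Sum>c\<in>D. \<Sum>I\<in>UNIV. \<Sum>A\<in>UNIV. of_int (of_bool (p (fst c) I \<and> q (snd c) A) * sgn c) * (u ^ card I * v ^ card A))"
  proof (rule sum.cong[OF refl])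
    fix c assume cD: "c \<in> D"
    then obtain F G where c: "c = (F, G)" "F \<in> flags" "G \<in> flags" "flag_cone F \<inter> flag_cone G = {0}"
      and meet: "translate (flag_cone F) (proj_NR w0) \<inter> flag_cone G \<noteq> {}"
      unfolding D_def w by auto
    let ?m = "int (length F) + int (length G) - int CARD('n) + 1"
    \<comment> \<open>The exponent is the dimension of a nonempty intersection, so the integer power
      is an ordinary one.\<close>
    have "0 \<le> ?m" using generic_cell(2)[OF gen c(2,3) meet] by linarith
    then have s: "(- 1 :: 'k) powi ?m = of_int (sgn c)" unfolding sgn_def c(1) by (simp add: power_int_def)
    have "(- 1 :: 'k) powi ?m * flag_value (indep_poly u) M F * flag_value (loop_poly v) M G =
      of_int (sgn c) * ((\<Sum>I\<in>UNIV. of_bool (p F I) * u ^ card I) * (\<Sum>A\<in>UNIV. of_bool (q G A) * v ^ card A))"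
      unfolding s flag_value_indep_poly[OF M g c(2)] flag_value_loop_poly[OF M g c(3)]
        sum_filter_of_bool p_def q_def by (simp only: mult.assoc)
    also have "\<dots> = (\<Sum>I\<in>UNIV. \<Sum>A\<in>UNIV. of_int (of_bool (p F I \<and> q G A) * sgn c) * (u ^ card I * v ^ card A))"
      unfolding sum_product unfolding sum_distrib_left
      by (intro sum.cong refl) (simp add: of_bool_conj mult_ac)
    finally show "(case c of (F, G) \<Rightarrow> (- 1) powi (int (length F) + int (length G) - int CARD('n) + 1) *
        flag_value (indep_poly u) M F * flag_value (loop_poly v) M G) =
      (\<Sum>I\<in>UNIV. \<Sum>A\<in>UNIV. of_int (of_bool (p (fst c) I \<and> q (snd c) A) * sgn c) * (u ^ card I * v ^ card A))"
      unfolding c(1) by simp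
  qed
  \<comment> \<open>Exchanging the sums isolates the integer coefficient of each
    \<open>u ^ card I * v ^ card A\<close>, which \<open>signed_count\<close> evaluates.\<close>
  also have "\<dots> = (\<Sum>I\<in>UNIV. \<Sum>A\<in>UNIV. \<Sum>c\<in>D. of_int (of_bool (p (fst c) I \<and> q (snd c) A) * sgn c) * (u ^ card I * v ^ card A))"
    by (subst sum.swap, rule sum.cong[OF refl], rule sum.swap)
  also have "\<dots> = (\<Sum>I\<in>UNIV. \<Sum>A\<in>UNIV. of_bool (greedy_pair M (($) w0) I A) * (u ^ card I * v ^ card A))"
  proof (intro sum.cong refl)
    fix I A
    have "(\<Sum>c\<in>D. of_bool (p (fst c) I \<and> q (snd c) A) * sgn c) = of_bool (greedy_pair M (($) w0) I A)"
      using signed_count[OF M gen, of I A] unfolding D_def w sgn_def p_def q_def case_prod_beta .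
    then show "(\<Sum>c\<in>D. of_int (of_bool (p (fst c) I \<and> q (snd c) A) * sgn c) * (u ^ card I * v ^ card A)) =
      of_bool (greedy_pair M (($) w0) I A) * (u ^ card I * v ^ card A)"
      unfolding sum_distrib_right[symmetric] of_int_sum[symmetric] by simp
  qed
  also have "\<dots> = (\<Sum>x\<in>UNIV \<times> UNIV. of_bool (case x of (I, A) \<Rightarrow> greedy_pair M (($) w0) I A) *
      (case x of (I, A) \<Rightarrow> u ^ card I * v ^ card A))"
    unfolding sum.cartesian_product by (rule sum.cong) auto
  also have "\<dots> = (\<Sum>(I, A)\<in>{(I, A). greedy_pair M (($) w0) I A}. u ^ card I * v ^ card A)"
    unfolding UNIV_Times_UNIV by (rule sum_filter_of_bool[symmetric])
  also have "\<dots> = (\<Sum>B\<in>UNIV. u ^ rank_of M B * v ^ (card B - rank_of M B))"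
    by (rule sum_rank_greedy[OF M generic_inj[OF gen], symmetric])
  also have "\<dots> = u ^ r * tutte M (1 + 1 / u) (1 + v)"
    by (rule tutte_rank_sum[OF M assms(4,7) g, symmetric])
  finally show ?thesis unfolding D_def by (rule sym)
qed

end
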